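(* Let $A$ be a logmodular algebra on a compact Hausdorff space $X$, let $\varphi$ be a multiplicative linear functional on $A$, and let $m$ be the (unique) representing measure for $\varphi$ on $X$. If $H^{2}(m)$ is a reproducing kernel Hilbert space, then $H^{\infty}(m)$, acting on $H^{2}(m)$ by multiplication, is catalytic on $H^{2}(m)$; that is, every transitive subalgebra of $B(H^{2}(m))$ containing $\{T_h : h\in H^{\infty}(m)\}$ is dense in $B(H^{2}(m))$ in the strong operator topology.
   Context: A uniform algebra on a compact Hausdorff space $X$ is a uniformly closed subalgebra $A$ of $C(X)$ (continuous complex-valued functions) containing the constants and separating the points of $X$; $A^{-1}$ is the set of invertible elements of $A$. $A$ is a logmodular algebra on $X$ if $\{\log|f| : f\in A^{-1}\}$ is uniformly dense in the space $\mathrm{Re}\,C(X)$ of real continuous functions on $X$. Let $M_A$ be the set of (nonzero) multiplicative linear functionals on $A$. A representing measure for $\varphi\in M_A$ is a positive measure $m$ on $X$ with $\varphi(f)=\int_X f\,dm$ for all $f\in A$; for a logmodular algebra it is unique. $H^{2}(m)$ is the closure of $A$ in $L^{2}(m)$, and $H^{\infty}(m)$ is the weak-star closure of $A$ in $L^{\infty}(m)$. For $h\in H^{\infty}(m)$, $T_h\in B(H^{2}(m))$ is $T_hf=hf$. "$H^{2}(m)$ is a reproducing kernel Hilbert space" means: there is a set $\Omega\subset M_A$ such that for each $\lambda\in\Omega$ the functional $f\mapsto\lambda(f)$ on $A$ extends to a bounded linear functional on $H^{2}(m)$, written $f\mapsto f(\lambda)$, and an element $f\in H^{2}(m)$ with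 $f(\lambda)=0$ for all $\lambda\in\Omega$ is $0$. $B(\mathcal{H})$ is the algebra of bounded linear operators on a complex Hilbert space $\mathcal{H}$. A unital subalgebra of $B(\mathcal{H})$ is transitive if its only closed invariant subspaces are $\{0\}$ and $\mathcal{H}$. A set of operators is catalytic if every transitive subalgebra of $B(\mathcal{H})$ containing it is strongly dense in $B(\mathcal{H})$. *)

theory Defs
  imports "HOL-Analysis.Analysis"
begin

section \<open>Logmodular algebras\<close>

text \<open>The compact Hausdorff space \<open>X\<close> is a type \<open>'a\<close> of class \<open>t2_space\<close> whose universe is compact
  (the latter is assumed where needed). Multiplication by scalars is multiplication by constants.\<close>

definition uniform_algebra :: "('a::t2_space \<Rightarrow> complex) set \<Rightarrow> bool" where
  "uniform_algebra A \<longleftrightarrow>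
     (\<forall>f\<in>A. continuous_on UNIV f) \<and>
     (\<forall>c. (\<lambda>x. c) \<in> A) \<and>
     (\<forall>f\<in>A. \<forall>g\<in>A. (\<lambda>x. f x + g x) \<in> A \<and> (\<lambda>x. f x * g x) \<in> A) \<and>
     (\<forall>F f. (\<forall>n. F n \<in> A) \<and> uniform_limit UNIV F f sequentially \<longrightarrow> f \<in> A) \<and>
     (\<forall>x y. x \<noteq> y \<longrightarrow> (\<exists>f\<in>A. f x \<noteq> f y))"

definition alg_units :: "('a \<Rightarrow> complex) set \<Rightarrow> ('a \<Rightarrow> complex) set" where
  "alg_units A = {f \<in> A. \<exists>g\<in>A. \<forall>x. f x * g x = 1}"

definition logmodular_algebra :: "('a::t2_space \<Rightarrow> complex) set \<Rightarrow> bool" where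
  "logmodular_algebra A \<longleftrightarrow> uniform_algebra A \<and>
     (\<forall>u :: 'a \<Rightarrow> real. continuous_on UNIV u \<longrightarrow>
        (\<forall>e>0. \<exists>f\<in>alg_units A. \<forall>x. \<bar>u x - ln (cmod (f x))\<bar> < e))"

text \<open>Functionals on \<open>A\<close> are HOL functions on all of \<open>'a \<Rightarrow> complex\<close>; only their values on \<open>A\<close>
  are ever used.\<close>

definition mult_functionals :: "('a \<Rightarrow> complex) set \<Rightarrow> (('a \<Rightarrow> complex) \<Rightarrow> complex) set" where
  "mult_functionals A = {\<phi>.
     (\<forall>f\<in>A. \<forall>g\<in>A. \<phi> (\<lambda>x. f x + g x) = \<phi> f + \<phi> g) \<and>
     (\<forall>c. \<forall>f\<in>A. \<phi> (\<lambda>x. c * f x) = c * \<phi> f) \<and>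
     (\<forall>f\<in>A. \<forall>g\<in>A. \<phi> (\<lambda>x. f x * g x) = \<phi> f * \<phi> g) \<and>
     (\<exists>f\<in>A. \<phi> f \<noteq> 0)}"

text \<open>Measures on \<open>X\<close> are finite regular Borel measures, as in the Riesz representation theorem;
  without regularity, representing measures on a nonmetrizable \<open>X\<close> need not be unique.\<close>

definition regular_borel_measure :: "'a::t2_space measure \<Rightarrow> bool" where
  "regular_borel_measure m \<longleftrightarrow> sets m = sets borel \<and> finite_measure m \<and>
     (\<forall>B\<in>sets m. emeasure m B = (SUP K\<in>{K. K \<subseteq> B \<and> compact K}. emeasure m K) \<and>
                 emeasure m B = (INF U\<in>{U. B \<subseteq> U \<and> open U}. emeasure m U))"

definition representing_measure ::
  "('a::t2_space \<Rightarrow> complex) set \<Rightarrow> (('a \<Rightarrow> complex) \<Rightarrow> complex) \<Rightarrow> 'a measure \<Rightarrow> bool" where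
  "representing_measure A \<phi> m \<longleftrightarrow> regular_borel_measure m \<and> (\<forall>f\<in>A. \<phi> f = (\<integral>x. f x \<partial>m))"

section \<open>Operators on a Hilbert space with explicit carrier\<close>

record 'v hilbert =
  hcarrier :: "'v set"
  hzero :: 'v
  hadd :: "'v \<Rightarrow> 'v \<Rightarrow> 'v"
  hscale :: "complex \<Rightarrow> 'v \<Rightarrow> 'v"
  hinner :: "'v \<Rightarrow> 'v \<Rightarrow> complex"

definition hnorm :: "('v, 'b) hilbert_scheme \<Rightarrow> 'v \<Rightarrow> real" where
  "hnorm H u = sqrt (Re (hinner H u u))"

text \<open>The value off the carrier is fixed because \<open>Metric_space\<close> demands nonnegativity and symmetry
  of the distance everywhere.\<close>

definition hdist :: "('v, 'b) hilbert_scheme \<Rightarrow> 'v \<Rightarrow> 'v \<Rightarrow> real" where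
  "hdist H u v =
     (if u \<in> hcarrier H \<and> v \<in> hcarrier H then hnorm H (hadd H u (hscale H (- 1) v)) else 0)"

definition htopology :: "('v, 'b) hilbert_scheme \<Rightarrow> 'v topology" where
  "htopology H = Metric_space.mtopology (hcarrier H) (hdist H)"

definition hsubspace :: "('v, 'b) hilbert_scheme \<Rightarrow> 'v set \<Rightarrow> bool" where
  "hsubspace H M \<longleftrightarrow> M \<subseteq> hcarrier H \<and> hzero H \<in> M \<and>
     (\<forall>u\<in>M. \<forall>v\<in>M. hadd H u v \<in> M) \<and> (\<forall>c. \<forall>u\<in>M. hscale H c u \<in> M)"

definition bounded_functional :: "('v, 'b) hilbert_scheme \<Rightarrow> ('v \<Rightarrow> complex) \<Rightarrow> bool" where
  "bounded_functional H l \<longleftrightarrow>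
     (\<forall>u\<in>hcarrier H. \<forall>v\<in>hcarrier H. l (hadd H u v) = l u + l v) \<and>
     (\<forall>c. \<forall>u\<in>hcarrier H. l (hscale H c u) = c * l u) \<and>
     (\<exists>K. \<forall>u\<in>hcarrier H. cmod (l u) \<le> K * hnorm H u)"

text \<open>Operators are extensional functions on the carrier, so that HOL equality is equality of
  operators.\<close>

definition bounded_ops :: "('v, 'b) hilbert_scheme \<Rightarrow> ('v \<Rightarrow> 'v) set" where
  "bounded_ops H = {T \<in> hcarrier H \<rightarrow>\<^sub>E hcarrier H.
     (\<forall>u\<in>hcarrier H. \<forall>v\<in>hcarrier H. T (hadd H u v) = hadd H (T u) (T v)) \<and>
     (\<forall>c. \<forall>u\<in>hcarrier H. T (hscale H c u) = hscale H c (T u)) \<and>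
     (\<exists>K. \<forall>u\<in>hcarrier H. hnorm H (T u) \<le> K * hnorm H u)}"

definition strong_operator_topology :: "('v, 'b) hilbert_scheme \<Rightarrow> ('v \<Rightarrow> 'v) topology" where
  "strong_operator_topology H =
     subtopology (product_topology (\<lambda>u. htopology H) (hcarrier H)) (bounded_ops H)"

definition unital_subalgebra :: "('v, 'b) hilbert_scheme \<Rightarrow> ('v \<Rightarrow> 'v) set \<Rightarrow> bool" where
  "unital_subalgebra H \<A> \<longleftrightarrow> \<A> \<subseteq> bounded_ops H \<and>
     (\<lambda>u\<in>hcarrier H. u) \<in> \<A> \<and>
     (\<forall>S\<in>\<A>. \<forall>T\<in>\<A>. (\<lambda>u\<in>hcarrier H. hadd H (S u) (T u)) \<in> \<A>) \<and>
     (\<forall>c. \<forall>T\<in>\<A>. (\<lambda>u\<in>hcarrier H. hscale H c (T u)) \<in> \<A>) \<and>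
     (\<forall>S\<in>\<A>. \<forall>T\<in>\<A>. (\<lambda>u\<in>hcarrier H. S (T u)) \<in> \<A>)"

definition transitive_algebra :: "('v, 'b) hilbert_scheme \<Rightarrow> ('v \<Rightarrow> 'v) set \<Rightarrow> bool" where
  "transitive_algebra H \<A> \<longleftrightarrow> unital_subalgebra H \<A> \<and>
     (\<forall>M. hsubspace H M \<and> closedin (htopology H) M \<and> (\<forall>T\<in>\<A>. T ` M \<subseteq> M) \<longrightarrow>
          M = {hzero H} \<or> M = hcarrier H)"

definition catalytic :: "('v, 'b) hilbert_scheme \<Rightarrow> ('v \<Rightarrow> 'v) set \<Rightarrow> bool" where
  "catalytic H S \<longleftrightarrow> S \<subseteq> bounded_ops H \<and>
     (\<forall>\<A>. transitive_algebra H \<A> \<and> S \<subseteq> \<A> \<longrightarrow>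
          strong_operator_topology H closure_of \<A> = bounded_ops H)"

section \<open>The spaces \<open>L\<^sup>2(m)\<close>, \<open>H\<^sup>2(m)\<close> and \<open>H\<^sup>\<infinity>(m)\<close>\<close>

text \<open>Elements of \<open>L\<^sup>2(m)\<close> are classes of measurable functions modulo equality almost everywhere.\<close>

definition ae_class :: "'a measure \<Rightarrow> ('a \<Rightarrow> complex) \<Rightarrow> ('a \<Rightarrow> complex) set" where
  "ae_class m f = {g \<in> borel_measurable m. AE x in m. g x = f x}"

definition rep :: "('a \<Rightarrow> complex) set \<Rightarrow> 'a \<Rightarrow> complex" where
  "rep u = (SOME f. f \<in> u)"

definition L2 :: "'a measure \<Rightarrow> ('a \<Rightarrow> complex) set hilbert" where
  "L2 m = \<lparr>
     hcarrier = ae_class m ` {f \<in> borel_measurable m. integrable m (\<lambda>x. (cmod (f x))\<^sup>2)},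
     hzero = ae_class m (\<lambda>x. 0),
     hadd = (\<lambda>u v. ae_class m (\<lambda>x. rep u x + rep v x)),
     hscale = (\<lambda>c u. ae_class m (\<lambda>x. c * rep u x)),
     hinner = (\<lambda>u v. \<integral>x. rep u x * cnj (rep v x) \<partial>m)\<rparr>"

definition H2 :: "('a \<Rightarrow> complex) set \<Rightarrow> 'a measure \<Rightarrow> ('a \<Rightarrow> complex) set hilbert" where
  "H2 A m = (L2 m)\<lparr>hcarrier := htopology (L2 m) closure_of (ae_class m ` A)\<rparr>"

text \<open>Elements of \<open>L\<^sup>\<infinity>(m)\<close> are represented by functions rather than classes; the weak-star topology,
  induced by the pairing with \<open>L\<^sup>1(m)\<close>, does not separate functions that agree almost everywhere.\<close>

definition Linf :: "'a measure \<Rightarrow> ('a \<Rightarrow> complex) set" where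
  "Linf m = {h \<in> borel_measurable m. \<exists>C. AE x in m. cmod (h x) \<le> C}"

definition L1 :: "'a measure \<Rightarrow> ('a \<Rightarrow> complex) set" where
  "L1 m = {g. integrable m g}"

definition weak_star_topology :: "'a measure \<Rightarrow> ('a \<Rightarrow> complex) topology" where
  "weak_star_topology m =
     pullback_topology (Linf m) (\<lambda>h. \<lambda>g\<in>L1 m. \<integral>x. h x * g x \<partial>m)
       (product_topology (\<lambda>g. euclidean) (L1 m))"

definition Hinf :: "('a \<Rightarrow> complex) set \<Rightarrow> 'a measure \<Rightarrow> ('a \<Rightarrow> complex) set" where
  "Hinf A m = weak_star_topology m closure_of A"

definition mult_op ::
  "('a \<Rightarrow> complex) set \<Rightarrow> 'a measure \<Rightarrow> ('a \<Rightarrow> complex) \<Rightarrow> ('a \<Rightarrow> complex) set \<Rightarrow> ('a \<Rightarrow> complex) set"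
  where "mult_op A m h = (\<lambda>u\<in>hcarrier (H2 A m). ae_class m (\<lambda>x. h x * rep u x))"

text \<open>\<open>ev \<omega>\<close> is the extension of \<open>\<omega>\<close> to \<open>H\<^sup>2(m)\<close>, so that \<open>ev \<omega> u\<close> is \<open>u(\<omega>)\<close>; it is determined by
  \<open>\<omega>\<close> since \<open>A\<close> is dense in \<open>H\<^sup>2(m)\<close>.\<close>

definition is_rkhs :: "('a \<Rightarrow> complex) set \<Rightarrow> 'a measure \<Rightarrow> bool" where
  "is_rkhs A m \<longleftrightarrow>
     (\<exists>\<Omega> ev. \<Omega> \<subseteq> mult_functionals A \<and>
        (\<forall>\<omega>\<in>\<Omega>. bounded_functional (H2 A m) (ev \<omega>) \<and> (\<forall>f\<in>A. ev \<omega> (ae_class m f) = \<omega> f)) \<and>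
        (\<forall>u\<in>hcarrier (H2 A m). (\<forall>\<omega>\<in>\<Omega>. ev \<omega> u = 0) \<longrightarrow> u = hzero (H2 A m)))"

end

theory Submission
  imports Defs "HOL-Probability.Probability_Measure"
begin

text \<open>Evaluation \<open>\<phi>(u) = \<integral> u dm\<close> is bounded on \<open>H\<^sup>2\<close>, so an invariant linear manifold of a transitive
  algebra on which it vanishes is not dense, hence is zero. Two elements \<open>x, y\<close> of \<open>H\<^sup>2\<close> have a common
  bounded multiplier: there is \<open>h\<close> with \<open>\<phi>(h) \<noteq> 0\<close> such that \<open>h x\<close> and \<open>h y\<close> are bounded limits of
  functions in \<open>A\<close>. If \<open>X, Y\<close> lie in a closed invariant subspace \<open>M\<close> of \<open>H\<^sup>2 \<oplus> \<dots> \<oplus> H\<^sup>2\<close> and have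
  \<open>j\<close>-th coordinates \<open>x, y\<close>, then \<open>h x Y - h y X\<close> lies in \<open>M\<close>, has \<open>j\<close>-th coordinate zero, and
  \<open>\<phi>\<close> can be computed on its coordinates. Induction on the number of summands shows that \<open>M\<close> is
  everything unless its elements satisfy a nontrivial linear relation with constant coefficients.
  Applied to the closure of \<open>{(T u\<^sub>1, \<dots>, T u\<^sub>n)}\<close> this gives strong density.\<close>

section \<open>Square-integrable functions\<close>

text \<open>The obstacle is that coordinates \<open>x\<close> and \<open>y\<close> are unbounded:
  \<open>x Y\<close> need not be square-integrable, and \<open>M\<close> is only known to admit
  multiplication by \<open>A\<close> and L2 limits. So \<open>h\<close> must be small where
  \<open>x\<close> or \<open>y\<close> is large, and \<phi>(h) must still not vanish. Logmodularity
  provides this through Jensen's equality |\<phi>(f)| = exp \<integral> log |f| for invertible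
  \<open>f\<close>: a small modulus costs only its logarithmic integral. Expanding \<open>x\<close>
  and \<open>y\<close> in rapidly converging series from \<open>A\<close> makes that cost finite,
  and \<open>h\<close> is an infinite product of cutoffs, one for each term. The relation found has
  constant coefficients because elimination is seen by \<phi> as scalar arithmetic. If
  \<open>L\<close> is the combination of \<phi>-values that vanishes on the elements of
  \<open>M\<close> with zero \<open>j\<close>-th coordinate, then \<phi>(X_j) L(Y) = \<phi>(Y_j)
  L(X) on \<open>M\<close>, so \<open>L\<close> is proportional to \<phi> of the \<open>j\<close>-th
  coordinate.\<close>

definition L2fun :: "'a measure \<Rightarrow> ('a \<Rightarrow> complex) set" where
  "L2fun m = {f \<in> borel_measurable m. integrable m (\<lambda>x. (cmod (f x))\<^sup>2)}"

definition L2norm :: "'a measure \<Rightarrow> ('a \<Rightarrow> complex) \<Rightarrow> real" where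
  "L2norm m f = sqrt (\<integral>x. (cmod (f x))\<^sup>2 \<partial>m)"

lemma L2fun_measurable [measurable_dest]: "f \<in> L2fun m \<Longrightarrow> f \<in> borel_measurable m"
  by (simp add: L2fun_def)

lemma L2fun_integrable: "f \<in> L2fun m \<Longrightarrow> integrable m (\<lambda>x. (cmod (f x))\<^sup>2)"
  by (simp add: L2fun_def)

lemma L2fun_bound:
  assumes "g \<in> L2fun m" "f \<in> borel_measurable m" "AE x in m. cmod (f x) \<le> C * cmod (g x)"
  shows "f \<in> L2fun m"
proof -
  have "integrable m (\<lambda>x. (cmod (f x))\<^sup>2)"
  proof (rule Bochner_Integration.integrable_bound)
    show "integrable m (\<lambda>x. C\<^sup>2 * (cmod (g x))\<^sup>2)"
      using L2fun_integrable[OF assms(1)] by simp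
    show "(\<lambda>x. (cmod (f x))\<^sup>2) \<in> borel_measurable m" using assms(2) by measurable
    show "AE x in m. norm ((cmod (f x))\<^sup>2) \<le> norm (C\<^sup>2 * (cmod (g x))\<^sup>2)"
      using assms(3) by eventually_elim (metis norm_ge_zero power_mono power_mult_distrib
        real_norm_def abs_of_nonneg zero_le_power2)
  qed
  then show ?thesis using assms(2) by (simp add: L2fun_def)
qed

lemma L2fun_scale: "f \<in> L2fun m \<Longrightarrow> (\<lambda>x. c * f x) \<in> L2fun m"
  by (rule L2fun_bound[where C = "cmod c"]) (auto simp: norm_mult L2fun_measurable)

lemma L2fun_cnj: "f \<in> L2fun m \<Longrightarrow> (\<lambda>x. cnj (f x)) \<in> L2fun m"
  by (rule L2fun_bound[where C = 1])
     (auto dest!: L2fun_measurable intro!: borel_measurable_continuous_on[where f = cnj] continuous_intros)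

lemma cmod_add_sq: "(cmod (a + b))\<^sup>2 \<le> (cmod a)\<^sup>2 + 2 * (cmod a * cmod b) + (cmod b)\<^sup>2"
proof -
  have "(cmod (a + b))\<^sup>2 \<le> (cmod a + cmod b)\<^sup>2"
    by (intro power_mono norm_triangle_ineq norm_ge_zero)
  then show ?thesis by (simp add: power2_sum)
qed

lemma L2fun_integrable_abs_mult:
  assumes "f \<in> L2fun m" "g \<in> L2fun m"
  shows "integrable m (\<lambda>x. cmod (f x) * cmod (g x))"
proof (rule Bochner_Integration.integrable_bound)
  show "integrable m (\<lambda>x. (cmod (f x))\<^sup>2 + (cmod (g x))\<^sup>2)"
    using assms by (intro Bochner_Integration.integrable_add L2fun_integrable)
  show "(\<lambda>x. cmod (f x) * cmod (g x)) \<in> borel_measurable m"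
    using assms[THEN L2fun_measurable] by measurable
  have "s * t \<le> s\<^sup>2 + t\<^sup>2" if "s \<ge> 0" "t \<ge> 0" for s t :: real
    using sum_squares_bound[of s t] mult_nonneg_nonneg[OF that] by linarith
  then show "AE x in m. norm (cmod (f x) * cmod (g x)) \<le> norm ((cmod (f x))\<^sup>2 + (cmod (g x))\<^sup>2)"
    by auto
qed

lemma L2fun_integrable_mult:
  assumes "f \<in> L2fun m" "g \<in> L2fun m"
  shows "integrable m (\<lambda>x. f x * g x)"
  by (rule Bochner_Integration.integrable_bound[OF L2fun_integrable_abs_mult[OF assms]])
     (use assms[THEN L2fun_measurable] in \<open>auto simp: norm_mult\<close>)

lemma L2fun_integrable_mult_cnj:
  assumes "f \<in> L2fun m" "g \<in> L2fun m"
  shows "integrable m (\<lambda>x. f x * cnj (g x))"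
  using L2fun_integrable_mult[OF assms(1) L2fun_cnj[OF assms(2)]] .

lemma L2fun_add:
  assumes "f \<in> L2fun m" "g \<in> L2fun m"
  shows "(\<lambda>x. f x + g x) \<in> L2fun m"
proof -
  have "integrable m (\<lambda>x. (cmod (f x + g x))\<^sup>2)"
  proof (rule Bochner_Integration.integrable_bound)
    show "integrable m (\<lambda>x. (cmod (f x))\<^sup>2 + 2 * (cmod (f x) * cmod (g x)) + (cmod (g x))\<^sup>2)"
      using assms L2fun_integrable_abs_mult[OF assms]
      by (intro Bochner_Integration.integrable_add L2fun_integrable) auto
    show "(\<lambda>x. (cmod (f x + g x))\<^sup>2) \<in> borel_measurable m"
      using assms[THEN L2fun_measurable] by measurable
  qed (auto simp: cmod_add_sq)
  then show ?thesis using assms by (auto simp: L2fun_def)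
qed

lemma L2fun_diff:
  assumes "f \<in> L2fun m" "g \<in> L2fun m"
  shows "(\<lambda>x. f x - g x) \<in> L2fun m"
  using L2fun_add[OF assms(1) L2fun_scale[OF assms(2), of "-1"]] by simp

lemma L2fun_zero: "(\<lambda>x. 0) \<in> L2fun m"
  by (simp add: L2fun_def)

lemma L2fun_cong_AE:
  "f \<in> L2fun m \<Longrightarrow> g \<in> borel_measurable m \<Longrightarrow> AE x in m. g x = f x \<Longrightarrow> g \<in> L2fun m"
  by (rule L2fun_bound[where C = 1]) (auto elim: eventually_mono)

lemma L2norm_cong_AE:
  "f \<in> borel_measurable m \<Longrightarrow> g \<in> borel_measurable m \<Longrightarrow> AE x in m. g x = f x \<Longrightarrow>
    L2norm m g = L2norm m f"
  unfolding L2norm_def by (intro arg_cong[where f = sqrt] integral_cong_AE) auto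

lemma L2norm_nonneg: "0 \<le> L2norm m f"
  by (simp add: L2norm_def)

lemma L2norm_sq: "(L2norm m f)\<^sup>2 = (\<integral>x. (cmod (f x))\<^sup>2 \<partial>m)"
  by (simp add: L2norm_def)

lemma L2norm_scale: "L2norm m (\<lambda>x. c * f x) = cmod c * L2norm m f"
  by (simp add: L2norm_def norm_mult power_mult_distrib real_sqrt_mult)

lemma L2norm_commute: "L2norm m (\<lambda>x. f x - g x) = L2norm m (\<lambda>x. g x - f x)"
  by (simp add: L2norm_def norm_minus_commute)

lemma L2norm_zero [simp]: "L2norm m (\<lambda>x. 0) = 0"
  by (simp add: L2norm_def)

lemma L2norm_eq_0:
  assumes "f \<in> L2fun m"
  shows "L2norm m f = 0 \<longleftrightarrow> (AE x in m. f x = 0)"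
proof -
  have "L2norm m f = 0 \<longleftrightarrow> (\<integral>x. (cmod (f x))\<^sup>2 \<partial>m) = 0"
    by (simp add: L2norm_def)
  also have "\<dots> \<longleftrightarrow> (AE x in m. (cmod (f x))\<^sup>2 = 0)"
    by (rule integral_nonneg_eq_0_iff_AE[OF L2fun_integrable[OF assms]]) auto
  finally show ?thesis by simp
qed

text \<open>Integrates \<open>2 s t \<le> (b/a) s^2 + (a/b) t^2\<close>, where \<open>a\<close> and
  \<open>b\<close> are the two norms; these weights make both terms on the right contribute equally.
  Zero norms are split off because the weights divide by them.\<close>

lemma L2_Cauchy_Schwarz_abs:
  assumes f: "f \<in> L2fun m" and g: "g \<in> L2fun m"
  shows "(\<integral>x. cmod (f x) * cmod (g x) \<partial>m) \<le> L2norm m f * L2norm m g"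
proof (cases "L2norm m f = 0 \<or> L2norm m g = 0")
  case True
  then have "AE x in m. f x = 0 \<or> g x = 0"
    using L2norm_eq_0[OF f] L2norm_eq_0[OF g] by (auto elim: eventually_mono)
  then have "(\<integral>x. cmod (f x) * cmod (g x) \<partial>m) = (\<integral>x. 0 \<partial>m)"
    using f[THEN L2fun_measurable] g[THEN L2fun_measurable]
    by (intro integral_cong_AE) (auto elim: eventually_mono)
  then show ?thesis by (simp add: L2norm_nonneg)
next
  case False
  define a b where "a = L2norm m f" and "b = L2norm m g"
  have ab: "a > 0" "b > 0" using False L2norm_nonneg[of m f] L2norm_nonneg[of m g]
    by (auto simp: a_def b_def)
  have "(\<integral>x. cmod (f x) * cmod (g x) \<partial>m)
      \<le> (\<integral>x. b / (2 * a) * (cmod (f x))\<^sup>2 + a / (2 * b) * (cmod (g x))\<^sup>2 \<partial>m)"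
  proof (rule integral_mono)
    show "integrable m (\<lambda>x. cmod (f x) * cmod (g x))"
      by (rule L2fun_integrable_abs_mult[OF f g])
    show "integrable m (\<lambda>x. b / (2 * a) * (cmod (f x))\<^sup>2 + a / (2 * b) * (cmod (g x))\<^sup>2)"
      using L2fun_integrable[OF f] L2fun_integrable[OF g] by simp
    fix x
    have "2 * (b * cmod (f x)) * (a * cmod (g x)) \<le> (b * cmod (f x))\<^sup>2 + (a * cmod (g x))\<^sup>2"
      by (rule sum_squares_bound)
    then show "cmod (f x) * cmod (g x)
        \<le> b / (2 * a) * (cmod (f x))\<^sup>2 + a / (2 * b) * (cmod (g x))\<^sup>2"
      using ab by (simp add: field_simps power2_eq_square)
  qed
  also have "\<dots> = b / (2 * a) * a\<^sup>2 + a / (2 * b) * b\<^sup>2"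
    using L2fun_integrable[OF f] L2fun_integrable[OF g] by (simp add: a_def b_def L2norm_sq)
  also have "\<dots> = a * b" using ab by (simp add: power2_eq_square)
  finally show ?thesis by (simp add: a_def b_def)
qed

lemma L2_Cauchy_Schwarz:
  assumes f: "f \<in> L2fun m" and g: "g \<in> L2fun m"
  shows "cmod (\<integral>x. f x * cnj (g x) \<partial>m) \<le> L2norm m f * L2norm m g"
proof -
  have "cmod (\<integral>x. f x * cnj (g x) \<partial>m) \<le> (\<integral>x. cmod (f x * cnj (g x)) \<partial>m)"
    by (rule integral_norm_bound)
  also have "\<dots> \<le> L2norm m f * L2norm m g"
    using L2_Cauchy_Schwarz_abs[OF f g] by (simp add: norm_mult)
  finally show ?thesis .
qed

lemma L2norm_triangle:
  assumes f: "f \<in> L2fun m" and g: "g \<in> L2fun m"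
  shows "L2norm m (\<lambda>x. f x + g x) \<le> L2norm m f + L2norm m g"
proof (rule power2_le_imp_le)
  note [simp] = L2fun_integrable[OF f] L2fun_integrable[OF g] L2fun_integrable_abs_mult[OF f g]
    L2fun_integrable[OF L2fun_add[OF f g]]
  have "(L2norm m (\<lambda>x. f x + g x))\<^sup>2 = (\<integral>x. (cmod (f x + g x))\<^sup>2 \<partial>m)" by (rule L2norm_sq)
  also have "\<dots> \<le> (\<integral>x. (cmod (f x))\<^sup>2 + 2 * (cmod (f x) * cmod (g x)) + (cmod (g x))\<^sup>2 \<partial>m)"
    by (rule integral_mono) (auto simp: cmod_add_sq)
  also have "\<dots> = (L2norm m f)\<^sup>2 + 2 * (\<integral>x. cmod (f x) * cmod (g x) \<partial>m) + (L2norm m g)\<^sup>2"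
    by (simp add: L2norm_sq)
  also have "\<dots> \<le> (L2norm m f + L2norm m g)\<^sup>2"
    using L2_Cauchy_Schwarz_abs[OF f g] by (simp add: power2_sum)
  finally show "(L2norm m (\<lambda>x. f x + g x))\<^sup>2 \<le> (L2norm m f + L2norm m g)\<^sup>2" .
qed (simp add: L2norm_nonneg)

lemma L2norm_triangle_diff:
  assumes "f \<in> L2fun m" "g \<in> L2fun m" "h \<in> L2fun m"
  shows "L2norm m (\<lambda>x. f x - h x) \<le> L2norm m (\<lambda>x. f x - g x) + L2norm m (\<lambda>x. g x - h x)"
  using L2norm_triangle[OF L2fun_diff[OF assms(1,2)] L2fun_diff[OF assms(2,3)]] by simp

lemma L2norm_tendsto:
  assumes F: "\<And>n. F n \<in> L2fun m" and f: "f \<in> L2fun m"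
    and lim: "(\<lambda>n. L2norm m (\<lambda>x. F n x - f x)) \<longlonglongrightarrow> 0"
  shows "(\<lambda>n. L2norm m (F n)) \<longlonglongrightarrow> L2norm m f"
proof (rule LIM_zero_cancel, rule Lim_null_comparison)
  have "\<bar>L2norm m (F n) - L2norm m f\<bar> \<le> L2norm m (\<lambda>x. F n x - f x)" for n
    using L2norm_triangle_diff[OF F[of n] f L2fun_zero] L2norm_triangle_diff[OF f F[of n] L2fun_zero]
      L2norm_commute[of m f "F n"] by simp
  then show "\<forall>\<^sub>F n in sequentially. norm (L2norm m (F n) - L2norm m f) \<le> L2norm m (\<lambda>x. F n x - f x)"
    by simp
qed (rule lim)

lemma L2norm_mono:
  assumes "g \<in> L2fun m" "f \<in> borel_measurable m" "AE x in m. cmod (f x) \<le> C * cmod (g x)" "C \<ge> 0"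
  shows "L2norm m f \<le> C * L2norm m g"
proof -
  have "L2norm m f \<le> L2norm m (\<lambda>x. of_real C * g x)"
    unfolding L2norm_def
    using L2fun_integrable[OF L2fun_bound[OF assms(1-3)]]
      L2fun_integrable[OF L2fun_scale[OF assms(1), of "of_real C"]] assms(3,4)
    by (intro real_sqrt_le_mono integral_mono_AE) (auto simp: norm_mult intro!: power_mono elim!: eventually_mono)
  then show ?thesis using assms(4) by (simp add: L2norm_scale)
qed

text \<open>Cauchy-Schwarz against the constant 1, which has norm one here. The last bound is the
  continuity of \<phi> on H2.\<close>

lemma (in prob_space) L2_integral_abs:
  assumes f: "f \<in> L2fun M"
  shows "integrable M f" "(\<integral>x. cmod (f x) \<partial>M) \<le> L2norm M f" "cmod (\<integral>x. f x \<partial>M) \<le> L2norm M f"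
proof -
  have one: "(\<lambda>x. 1) \<in> L2fun M" by (simp add: L2fun_def)
  have n1: "L2norm M (\<lambda>x. 1) = 1" by (simp add: L2norm_def prob_space)
  show "integrable M f" using L2fun_integrable_mult[OF f one] by simp
  show *: "(\<integral>x. cmod (f x) \<partial>M) \<le> L2norm M f"
    using L2_Cauchy_Schwarz_abs[OF f one] by (simp add: n1)
  show "cmod (\<integral>x. f x \<partial>M) \<le> L2norm M f"
    using integral_norm_bound[of M f] * by linarith
qed

text \<open>The form in which Fatou's lemma delivers a bound: the extended integral is controlled
  before integrability is known.\<close>

lemma L2fun_of_nn_integral:
  assumes [measurable]: "f \<in> borel_measurable m"
    and le: "(\<integral>\<^sup>+x. ennreal ((cmod (f x))\<^sup>2) \<partial>m) \<le> ennreal (c\<^sup>2)" and c: "c \<ge> 0"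
  shows "f \<in> L2fun m" "L2norm m f \<le> c"
proof -
  have i: "integrable m (\<lambda>x. (cmod (f x))\<^sup>2)"
    using le by (intro integrableI_nonneg) (auto intro: le_less_trans)
  then show "f \<in> L2fun m" by (simp add: L2fun_def)
  have "ennreal (\<integral>x. (cmod (f x))\<^sup>2 \<partial>m) \<le> ennreal (c\<^sup>2)"
    using le nn_integral_eq_integral[OF i] by simp
  then have "(\<integral>x. (cmod (f x))\<^sup>2 \<partial>m) \<le> c\<^sup>2" by (simp add: ennreal_le_iff)
  then show "L2norm m f \<le> c" unfolding L2norm_def using c by (simp add: real_le_lsqrt)
qed

text \<open>The exact partial sum of the geometric series, not just its bound, is what lets the
  induction on \<open>k\<close> close.\<close>

lemma L2norm_telescope:
  assumes F: "\<And>n. F n \<in> L2fun m"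
    and d: "\<And>n. L2norm m (\<lambda>x. F (Suc n) x - F n x) \<le> C * (1/2)^n"
  shows "L2norm m (\<lambda>x. F (n + k) x - F n x) \<le> 2 * C * (1/2)^n * (1 - (1/2)^k)"
proof (induction k)
  case 0
  then show ?case by simp
next
  case (Suc k)
  have "L2norm m (\<lambda>x. F (n + Suc k) x - F n x)
    \<le> L2norm m (\<lambda>x. F (Suc (n + k)) x - F (n + k) x) + L2norm m (\<lambda>x. F (n + k) x - F n x)"
    using L2norm_triangle_diff[OF F[of "Suc (n + k)"] F[of "n + k"] F[of n]] by simp
  also have "\<dots> \<le> C * (1/2)^(n+k) + 2 * C * (1/2)^n * (1 - (1/2)^k)"
    by (intro add_mono d Suc)
  also have "\<dots> = 2 * C * (1/2)^n * (1 - (1/2)^Suc k)"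
    by (simp add: power_add field_simps)
  finally show ?case .
qed

text \<open>Riesz-Fischer for summable steps. The increments are summable in L1, hence absolutely
  summable at almost every point; Fatou's lemma applied to \<open>F (n + k) - F n\<close> as
  \<open>k\<close> grows then bounds the L2 distance to the pointwise limit. The whole sequence
  converges almost everywhere, so products of two such sequences can be followed pointwise
  later.\<close>

lemma (in prob_space) L2_rapid_Cauchy_converges:
  assumes F: "\<And>n. F n \<in> L2fun M"
    and d: "\<And>n. L2norm M (\<lambda>x. F (Suc n) x - F n x) \<le> C * (1/2)^n"
  obtains f where "f \<in> L2fun M" "AE x in M. (\<lambda>n. F n x) \<longlonglongrightarrow> f x"
    "(\<lambda>n. L2norm M (\<lambda>x. F n x - f x)) \<longlonglongrightarrow> 0"
proof -
  have [measurable]: "\<And>n. F n \<in> borel_measurable M" using F by (rule L2fun_measurable)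
  have C: "C \<ge> 0" using order_trans[OF L2norm_nonneg d[of 0]] by simp
  have dl: "(\<lambda>x. F (Suc n) x - F n x) \<in> L2fun M" for n by (intro L2fun_diff F)
  have "(\<integral>\<^sup>+x. (\<Sum>n. ennreal (cmod (F (Suc n) x - F n x))) \<partial>M)
      = (\<Sum>n. \<integral>\<^sup>+x. ennreal (cmod (F (Suc n) x - F n x)) \<partial>M)"
    by (rule nn_integral_suminf) measurable
  also have "\<dots> \<le> (\<Sum>n. ennreal (C * (1/2)^n))"
  proof (rule suminf_le)
    fix n
    have "(\<integral>\<^sup>+x. ennreal (cmod (F (Suc n) x - F n x)) \<partial>M)
        = ennreal (\<integral>x. cmod (F (Suc n) x - F n x) \<partial>M)"
      using L2_integral_abs(1)[OF dl] by (intro nn_integral_eq_integral) auto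
    also have "\<dots> \<le> ennreal (C * (1/2)^n)"
      using L2_integral_abs(2)[OF dl[of n]] d[of n] by (intro ennreal_leI) linarith
    finally show "(\<integral>\<^sup>+x. ennreal (cmod (F (Suc n) x - F n x)) \<partial>M) \<le> ennreal (C * (1/2)^n)" .
  qed auto
  also have "\<dots> = ennreal (\<Sum>n. C * (1/2)^n)"
    using C by (intro suminf_ennreal2) (auto intro!: summable_mult summable_geometric)
  also have "\<dots> < top" by simp
  finally have fin: "(\<integral>\<^sup>+x. (\<Sum>n. ennreal (cmod (F (Suc n) x - F n x))) \<partial>M) < top" .
  have "AE x in M. (\<Sum>n. ennreal (cmod (F (Suc n) x - F n x))) \<noteq> \<infinity>"
    by (rule nn_integral_noteq_infinite) (use fin in \<open>auto simp: less_top\<close>)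
  then have conv: "AE x in M. convergent (\<lambda>n. F n x)"
  proof eventually_elim
    case (elim x)
    have "summable (\<lambda>n. norm (F (Suc n) x - F n x))"
      using elim by (intro summable_suminf_not_top) (auto simp: infinity_ennreal_def)
    then have "summable (\<lambda>n. F (Suc n) x - F n x)" by (rule summable_norm_cancel)
    then have "convergent (\<lambda>n. \<Sum>i<n. F (Suc i) x - F i x)"
      by (simp add: summable_iff_convergent)
    then have "convergent (\<lambda>n. F n x - F 0 x)"
      using sum_lessThan_telescope[of "\<lambda>n. F n x"] by simp
    then have "convergent (\<lambda>n. (F n x - F 0 x) + F 0 x)"
      by (intro convergent_add convergent_const)
    then show ?case by simp
  qed
  define f where "f x = lim (\<lambda>n. F n x)" for x
  have [measurable]: "f \<in> borel_measurable M" unfolding f_def by measurable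
  have lim: "AE x in M. (\<lambda>n. F n x) \<longlonglongrightarrow> f x"
    using conv by eventually_elim (simp add: f_def convergent_LIMSEQ_iff)
  have bnd: "(\<integral>\<^sup>+x. ennreal ((cmod (F n x - f x))\<^sup>2) \<partial>M) \<le> ennreal ((2 * C * (1/2)^n)\<^sup>2)" for n
  proof -
    have "(\<integral>\<^sup>+x. ennreal ((cmod (F n x - f x))\<^sup>2) \<partial>M)
        = (\<integral>\<^sup>+x. liminf (\<lambda>k. ennreal ((cmod (F (n + k) x - F n x))\<^sup>2)) \<partial>M)"
    proof (rule nn_integral_cong_AE, use lim in eventually_elim)
      case (elim x)
      have "(\<lambda>k. F (n + k) x) \<longlonglongrightarrow> f x"
        using LIMSEQ_ignore_initial_segment[OF elim, of n] by (simp add: add.commute)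
      then have "(\<lambda>k. ennreal ((cmod (F (n + k) x - F n x))\<^sup>2)) \<longlonglongrightarrow> ennreal ((cmod (f x - F n x))\<^sup>2)"
        by (intro tendsto_intros)
      then show ?case
        using lim_imp_Liminf[OF sequentially_bot] norm_minus_commute[of "f x" "F n x"] by metis
    qed
    also have "\<dots> \<le> liminf (\<lambda>k. \<integral>\<^sup>+x. ennreal ((cmod (F (n + k) x - F n x))\<^sup>2) \<partial>M)"
      by (rule nn_integral_liminf) measurable
    also have "\<dots> \<le> ennreal ((2 * C * (1/2)^n)\<^sup>2)"
    proof -
      have "(\<integral>\<^sup>+x. ennreal ((cmod (F (n + k) x - F n x))\<^sup>2) \<partial>M) \<le> ennreal ((2 * C * (1/2)^n)\<^sup>2)" for k
      proof -
      have dk: "(\<lambda>x. F (n + k) x - F n x) \<in> L2fun M" by (intro L2fun_diff F)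
      have "L2norm M (\<lambda>x. F (n + k) x - F n x) \<le> 2 * C * (1/2)^n"
      proof -
        note L2norm_telescope[OF F d, of n k]
        also have "2 * C * (1/2)^n * (1 - (1/2)^k) \<le> 2 * C * (1/2)^n * 1"
          using C by (intro mult_left_mono) auto
        finally show ?thesis by simp
      qed
      then have "(L2norm M (\<lambda>x. F (n + k) x - F n x))\<^sup>2 \<le> (2 * C * (1/2)^n)\<^sup>2"
        by (intro power_mono) (auto simp: L2norm_nonneg)
      moreover have "(\<integral>\<^sup>+x. ennreal ((cmod (F (n + k) x - F n x))\<^sup>2) \<partial>M)
          = ennreal (\<integral>x. (cmod (F (n + k) x - F n x))\<^sup>2 \<partial>M)"
        using L2fun_integrable[OF dk] by (intro nn_integral_eq_integral) auto
      ultimately show "(\<integral>\<^sup>+x. ennreal ((cmod (F (n + k) x - F n x))\<^sup>2) \<partial>M) \<le> ennreal ((2 * C * (1/2)^n)\<^sup>2)"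
        by (simp add: L2norm_sq ennreal_leI)
      qed
      then show ?thesis
        by (intro Liminf_le always_eventually) auto
    qed
    finally show ?thesis .
  qed
  have fn: "(\<lambda>x. F n x - f x) \<in> L2fun M" "L2norm M (\<lambda>x. F n x - f x) \<le> 2 * C * (1/2)^n" for n
    using L2fun_of_nn_integral[OF _ bnd[of n]] C by auto
  have "f \<in> L2fun M" using L2fun_diff[OF F[of 0] fn(1)[of 0]] by simp
  moreover have "(\<lambda>n. L2norm M (\<lambda>x. F n x - f x)) \<longlonglongrightarrow> 0"
  proof (rule tendsto_sandwich)
    show "\<forall>\<^sub>F n in sequentially. 0 \<le> L2norm M (\<lambda>x. F n x - f x)" by (simp add: L2norm_nonneg)
    show "\<forall>\<^sub>F n in sequentially. L2norm M (\<lambda>x. F n x - f x) \<le> 2 * C * (1/2)^n" using fn(2) by simp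
    have "(\<lambda>n. (1/2::real)^n) \<longlonglongrightarrow> 0" by (rule LIMSEQ_power_zero) simp
    then show "(\<lambda>n. 2 * C * (1/2)^n) \<longlonglongrightarrow> 0" using tendsto_mult_right_zero by blast
  qed simp
  ultimately show thesis using that lim by blast
qed

section \<open>Orthogonal projection in L2\<close>

lemma L2norm_diff_scale_sq:
  assumes f: "f \<in> L2fun m" and g: "g \<in> L2fun m"
  defines "p \<equiv> \<integral>x. f x * cnj (g x) \<partial>m"
  shows "(L2norm m (\<lambda>x. f x - of_real t * p * g x))\<^sup>2
    = (L2norm m f)\<^sup>2 - 2 * t * (cmod p)\<^sup>2 + t\<^sup>2 * (cmod p)\<^sup>2 * (L2norm m g)\<^sup>2"
proof -
  note [simp] = L2fun_integrable[OF f] L2fun_integrable[OF g] L2fun_integrable_mult_cnj[OF f g]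
  have eq: "(cmod (f x - of_real t * p * g x))\<^sup>2
      = (cmod (f x))\<^sup>2 - 2 * t * Re (cnj p * (f x * cnj (g x))) + t\<^sup>2 * (cmod p)\<^sup>2 * (cmod (g x))\<^sup>2" for x
  proof -
    have "(cmod (a - b))\<^sup>2 = (cmod a)\<^sup>2 - 2 * Re (a * cnj b) + (cmod b)\<^sup>2" for a b
      unfolding cmod_power2 by (simp add: power2_eq_square algebra_simps)
    from this[of "f x" "of_real t * p * g x"] show ?thesis
      by (simp add: norm_mult power_mult_distrib algebra_simps)
  qed
  have "(\<integral>x. Re (cnj p * (f x * cnj (g x))) \<partial>m) = Re (cnj p * p)"
    unfolding p_def by (subst integral_Re) auto
  also have "\<dots> = (cmod p)\<^sup>2" unfolding cmod_power2 by (simp add: power2_eq_square)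
  finally have "(\<integral>x. Re (cnj p * (f x * cnj (g x))) \<partial>m) = (cmod p)\<^sup>2" .
  moreover have "integrable m (\<lambda>x. Re (cnj p * (f x * cnj (g x))))"
    by (intro integrable_Re) auto
  ultimately show ?thesis
    unfolding L2norm_sq eq by simp
qed

lemma L2norm_parallelogram:
  assumes f: "f \<in> L2fun m" and g: "g \<in> L2fun m"
  shows "(L2norm m (\<lambda>x. f x - g x))\<^sup>2 + (L2norm m (\<lambda>x. f x + g x))\<^sup>2
    = 2 * (L2norm m f)\<^sup>2 + 2 * (L2norm m g)\<^sup>2"
proof -
  have eq: "(cmod (a - b))\<^sup>2 + (cmod (a + b))\<^sup>2 = 2 * (cmod a)\<^sup>2 + 2 * (cmod b)\<^sup>2" for a b
    unfolding cmod_power2 by (simp add: power2_eq_square algebra_simps)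
  have "(L2norm m (\<lambda>x. f x - g x))\<^sup>2 + (L2norm m (\<lambda>x. f x + g x))\<^sup>2
      = (\<integral>x. (cmod (f x - g x))\<^sup>2 + (cmod (f x + g x))\<^sup>2 \<partial>m)"
    using L2fun_integrable[OF L2fun_diff[OF f g]] L2fun_integrable[OF L2fun_add[OF f g]]
    by (simp add: L2norm_sq)
  also have "\<dots> = 2 * (L2norm m f)\<^sup>2 + 2 * (L2norm m g)\<^sup>2"
    unfolding eq using L2fun_integrable[OF f] L2fun_integrable[OF g] by (simp add: L2norm_sq)
  finally show ?thesis .
qed

text \<open>\<open>w\<close> is \<open>f\<close> minus its projection onto the closure of
  \<open>S\<close>. A minimising sequence is Cauchy by the parallelogram law; its limit
  \<open>g\<close> need not lie in \<open>S\<close>, so minimality is always used along the sequence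
  and passed to the limit.\<close>

lemma (in prob_space) L2_orthogonal_witness:
  assumes S: "S \<subseteq> L2fun M" "S \<noteq> {}"
    and add: "\<And>a b. a \<in> S \<Longrightarrow> b \<in> S \<Longrightarrow> (\<lambda>x. a x + b x) \<in> S"
    and scale: "\<And>c a. a \<in> S \<Longrightarrow> (\<lambda>x. c * a x) \<in> S"
    and f: "f \<in> L2fun M" and e: "e > 0" and far: "\<And>a. a \<in> S \<Longrightarrow> e \<le> L2norm M (\<lambda>x. f x - a x)"
  obtains w where "w \<in> L2fun M" "\<And>b. b \<in> S \<Longrightarrow> (\<integral>x. b x * cnj (w x) \<partial>M) = 0"
    "(\<integral>x. f x * cnj (w x) \<partial>M) \<noteq> 0"
proof -
  define D where "D = (\<lambda>a. (L2norm M (\<lambda>x. f x - a x))\<^sup>2) ` S"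
  define d where "d = Inf D"
  have bdd: "bdd_below D" by (rule bdd_belowI[of _ 0]) (auto simp: D_def)
  have ne: "D \<noteq> {}" using S by (auto simp: D_def)
  have dle: "d \<le> (L2norm M (\<lambda>x. f x - a x))\<^sup>2" if "a \<in> S" for a
    unfolding d_def by (rule cInf_lower) (use that bdd in \<open>auto simp: D_def\<close>)
  have de: "e\<^sup>2 \<le> d"
    unfolding d_def by (rule cInf_greatest) (use ne far e in \<open>auto simp: D_def intro!: power_mono\<close>)
  \<comment> \<open>The margin concerns squared distances, so \<open>(1/4)^n\<close> becomes steps
    of order \<open>(1/2)^n\<close> once the root is taken.\<close>
  have "\<exists>a\<in>S. (L2norm M (\<lambda>x. f x - a x))\<^sup>2 < d + (1/4)^n" for n
    using cInf_lessD[OF ne, of "d + (1/4)^n"] unfolding d_def[symmetric] by (auto simp: D_def)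
  then obtain a where aS: "\<And>n. a n \<in> S" and a: "\<And>n. (L2norm M (\<lambda>x. f x - a n x))\<^sup>2 < d + (1/4)^n"
    by metis
  have aL: "a n \<in> L2fun M" for n using aS S by auto
  have fa: "(\<lambda>x. f x - a n x) \<in> L2fun M" for n by (intro L2fun_diff f aL)
  have step: "L2norm M (\<lambda>x. a (Suc n) x - a n x) \<le> 2 * (1/2)^n" for n
  proof (rule power2_le_imp_le)
    have mid: "(\<lambda>x. (1/2) * (a n x + a (Suc n) x)) \<in> S" by (intro scale add aS)
    have "4 * d \<le> 4 * (L2norm M (\<lambda>x. f x - (1/2) * (a n x + a (Suc n) x)))\<^sup>2"
      using dle[OF mid] by simp
    also have "\<dots> = (L2norm M (\<lambda>x. 2 * (f x - (1/2) * (a n x + a (Suc n) x))))\<^sup>2"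
      by (simp only: L2norm_scale power_mult_distrib) simp
    also have "(\<lambda>x. 2 * (f x - (1/2) * (a n x + a (Suc n) x))) = (\<lambda>x. (f x - a n x) + (f x - a (Suc n) x))"
      by (auto simp: algebra_simps)
    finally have "4 * d \<le> (L2norm M (\<lambda>x. (f x - a n x) + (f x - a (Suc n) x)))\<^sup>2" .
    moreover have "(\<lambda>x. (f x - a n x) - (f x - a (Suc n) x)) = (\<lambda>x. a (Suc n) x - a n x)" by auto
    ultimately have "(L2norm M (\<lambda>x. a (Suc n) x - a n x))\<^sup>2
        \<le> 2 * (L2norm M (\<lambda>x. f x - a n x))\<^sup>2 + 2 * (L2norm M (\<lambda>x. f x - a (Suc n) x))\<^sup>2 - 4 * d"
      using L2norm_parallelogram[OF fa[of n] fa[of "Suc n"]] by simp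
    also have "\<dots> \<le> 4 * (1/4)^n"
      using a[of n] a[of "Suc n"] zero_le_power[of "1/4::real" n] unfolding power_Suc by linarith
    also have "\<dots> = (2 * (1/2)^n)\<^sup>2"
      by (simp add: power_mult_distrib power2_eq_square flip: power_mult_distrib)
    finally show "(L2norm M (\<lambda>x. a (Suc n) x - a n x))\<^sup>2 \<le> (2 * (1/2)^n)\<^sup>2" .
  qed simp
  obtain g where g: "g \<in> L2fun M" and ag: "(\<lambda>n. L2norm M (\<lambda>x. a n x - g x)) \<longlonglongrightarrow> 0"
    using L2_rapid_Cauchy_converges[OF aL step] by blast
  define w where "w x = f x - g x" for x
  have w: "w \<in> L2fun M" unfolding w_def[abs_def] by (intro L2fun_diff f g)
  have near: "(\<lambda>n. L2norm M (\<lambda>x. f x - a n x)) \<longlonglongrightarrow> L2norm M w"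
  proof (rule L2norm_tendsto[OF fa w])
    have "L2norm M (\<lambda>x. f x - a n x - w x) = L2norm M (\<lambda>x. a n x - g x)" for n
      using L2norm_commute[of M g "a n"] by (simp add: w_def)
    then show "(\<lambda>n. L2norm M (\<lambda>x. f x - a n x - w x)) \<longlonglongrightarrow> 0" using ag by simp
  qed
  have wd: "(L2norm M w)\<^sup>2 = d"
  proof (rule antisym)
    have lim: "(\<lambda>n. (L2norm M (\<lambda>x. f x - a n x))\<^sup>2) \<longlonglongrightarrow> (L2norm M w)\<^sup>2"
      by (intro tendsto_intros near)
    show "d \<le> (L2norm M w)\<^sup>2"
      by (rule LIMSEQ_le_const[OF lim]) (auto simp: dle aS)
    have "(\<lambda>n. (1/4::real)^n) \<longlonglongrightarrow> 0" by (rule LIMSEQ_power_zero) simp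
    then have "(\<lambda>n. d + (1/4)^n) \<longlonglongrightarrow> d + 0" by (rule tendsto_add[OF tendsto_const])
    then show "(L2norm M w)\<^sup>2 \<le> d" using LIMSEQ_le[OF lim] a by (simp add: less_imp_le)
  qed
  have orth0: "(\<integral>x. w x * cnj (b x) \<partial>M) = 0" if b: "b \<in> S" for b
  proof (rule ccontr)
    define p where "p = (\<integral>x. w x * cnj (b x) \<partial>M)"
    assume "(\<integral>x. w x * cnj (b x) \<partial>M) \<noteq> 0"
    then have p: "p \<noteq> 0" by (simp add: p_def)
    have bL: "b \<in> L2fun M" using b S by auto
    \<comment> \<open>Moving from \<open>w\<close> by \<open>t * p * b\<close> changes the squared
      distance by \<open>- t * |p|^2 * (2 - t * |b|^2)\<close>, with \<open>|b|\<close> the L2 norm.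
      This is negative as soon as \<open>t * |b|^2 < 1\<close>; the added 1 covers
      \<open>|b| = 0\<close>.\<close>
    define t where "t = 1 / ((L2norm M b)\<^sup>2 + 1)"
    have pos: "(L2norm M b)\<^sup>2 + 1 > 0" using zero_le_power2[of "L2norm M b"] by linarith
    have t: "t > 0" "t * (L2norm M b)\<^sup>2 < 1" using pos by (auto simp: t_def field_simps)
    let ?v = "\<lambda>x. w x - of_real t * p * b x"
    have lim: "(\<lambda>n. L2norm M (\<lambda>x. f x - (a n x + of_real t * p * b x))) \<longlonglongrightarrow> L2norm M ?v"
    proof (rule L2norm_tendsto)
      have tb: "(\<lambda>x. of_real t * p * b x) \<in> L2fun M" using L2fun_scale[OF bL] .
      show "?v \<in> L2fun M" by (intro L2fun_diff w tb)
      show "(\<lambda>x. f x - (a n x + of_real t * p * b x)) \<in> L2fun M" for n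
        by (intro L2fun_diff L2fun_add f aL tb)
      have "L2norm M (\<lambda>x. f x - (a n x + of_real t * p * b x) - ?v x) = L2norm M (\<lambda>x. a n x - g x)" for n
        using L2norm_commute[of M g "a n"] by (simp add: w_def)
      then show "(\<lambda>n. L2norm M (\<lambda>x. f x - (a n x + of_real t * p * b x) - ?v x)) \<longlonglongrightarrow> 0"
        using ag by simp
    qed
    have "d \<le> (L2norm M ?v)\<^sup>2"
      by (rule LIMSEQ_le_const[OF tendsto_power[OF lim]]) (auto intro!: dle add scale aS b)
    also have "\<dots> = (L2norm M w)\<^sup>2 - 2 * t * (cmod p)\<^sup>2 + t\<^sup>2 * (cmod p)\<^sup>2 * (L2norm M b)\<^sup>2"
      unfolding p_def by (rule L2norm_diff_scale_sq[OF w bL])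
    finally have "2 * t * (cmod p)\<^sup>2 \<le> t * (cmod p)\<^sup>2 * (t * (L2norm M b)\<^sup>2)"
      using wd by (simp add: power2_eq_square mult_ac)
    also have "\<dots> \<le> t * (cmod p)\<^sup>2 * 1"
      using t by (intro mult_left_mono) auto
    finally show False using t p by (simp add: zero_less_mult_iff)
  qed
  have orth: "(\<integral>x. b x * cnj (w x) \<partial>M) = 0" if "b \<in> S" for b
  proof -
    have "(\<integral>x. cnj (w x * cnj (b x)) \<partial>M) = cnj (\<integral>x. w x * cnj (b x) \<partial>M)"
      by (rule Bochner_Integration.integral_cnj)
    then show ?thesis using orth0[OF that] by (simp add: mult.commute)
  qed
  \<comment> \<open>As \<open>a n\<close> is orthogonal to \<open>w\<close> and
    \<open>f - a n\<close> tends to \<open>w\<close>, the product of \<open>f\<close> with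
    \<open>w\<close> equals that of \<open>w\<close> with itself, which is
    \<open>d \<ge> e^2\<close>.\<close>
  have "(\<lambda>n. \<integral>x. (f x - a n x - w x) * cnj (w x) \<partial>M) \<longlonglongrightarrow> 0"
  proof (rule Lim_null_comparison)
    have "L2norm M (\<lambda>x. f x - a n x - w x) = L2norm M (\<lambda>x. a n x - g x)" for n
      using L2norm_commute[of M g "a n"] by (simp add: w_def)
    then show "\<forall>\<^sub>F n in sequentially. norm (\<integral>x. (f x - a n x - w x) * cnj (w x) \<partial>M)
        \<le> L2norm M (\<lambda>x. a n x - g x) * L2norm M w"
      using L2_Cauchy_Schwarz[OF L2fun_diff[OF fa w] w] by (auto intro!: always_eventually)
    show "(\<lambda>n. L2norm M (\<lambda>x. a n x - g x) * L2norm M w) \<longlonglongrightarrow> 0"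
      using tendsto_mult_left_zero[OF ag] .
  qed
  moreover have "(\<integral>x. (f x - a n x - w x) * cnj (w x) \<partial>M)
      = (\<integral>x. f x * cnj (w x) \<partial>M) - (\<integral>x. w x * cnj (w x) \<partial>M)" for n
    using L2fun_integrable_mult_cnj[OF f w] L2fun_integrable_mult_cnj[OF aL w]
      L2fun_integrable_mult_cnj[OF w w] orth[OF aS[of n]]
    by (simp add: left_diff_distrib)
  ultimately have "(\<integral>x. f x * cnj (w x) \<partial>M) = (\<integral>x. w x * cnj (w x) \<partial>M)"
    by (simp add: LIMSEQ_const_iff)
  also have "\<dots> = of_real ((L2norm M w)\<^sup>2)"
    by (simp add: L2norm_sq complex_norm_square[symmetric] flip: integral_complex_of_real)
  also have "\<dots> \<noteq> 0" using wd de e by auto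
  finally show thesis using that w orth by blast
qed

section \<open>Classes modulo null sets\<close>

lemma rep_ae_class:
  assumes "f \<in> borel_measurable m"
  shows "rep (ae_class m f) \<in> borel_measurable m" "AE x in m. rep (ae_class m f) x = f x"
proof -
  have "f \<in> ae_class m f" using assms by (simp add: ae_class_def)
  then have "rep (ae_class m f) \<in> ae_class m f" unfolding rep_def by (rule someI[of "\<lambda>g. g \<in> ae_class m f"])
  then show "rep (ae_class m f) \<in> borel_measurable m" "AE x in m. rep (ae_class m f) x = f x"
    by (auto simp: ae_class_def)
qed

lemma ae_class_eq_iff:
  assumes "f \<in> borel_measurable m" "g \<in> borel_measurable m"
  shows "ae_class m f = ae_class m g \<longleftrightarrow> (AE x in m. f x = g x)"
proof
  assume "ae_class m f = ae_class m g"
  then have "f \<in> ae_class m g" using assms by (auto simp: ae_class_def)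
  then show "AE x in m. f x = g x" by (simp add: ae_class_def)
next
  assume *: "AE x in m. f x = g x"
  have "(AE x in m. h x = f x) \<longleftrightarrow> (AE x in m. h x = g x)" for h
    by (rule eventually_subst, use * in eventually_elim) auto
  then show "ae_class m f = ae_class m g" by (simp add: ae_class_def)
qed

lemma ae_class_cong:
  "f \<in> borel_measurable m \<Longrightarrow> g \<in> borel_measurable m \<Longrightarrow> AE x in m. f x = g x \<Longrightarrow>
    ae_class m f = ae_class m g"
  by (simp add: ae_class_eq_iff)

text \<open>\<open>L2\<close> and \<open>H2\<close> differ only in their carrier; leaving the
  carrier free allows one treatment of metric and topology for both.\<close>

definition L2sub :: "'a measure \<Rightarrow> ('a \<Rightarrow> complex) set set \<Rightarrow> ('a \<Rightarrow> complex) set hilbert" where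
  "L2sub m C = (L2 m)\<lparr>hcarrier := C\<rparr>"

lemma L2sub_sel [simp]:
  "hcarrier (L2sub m C) = C" "hzero (L2sub m C) = ae_class m (\<lambda>x. 0)"
  "hadd (L2sub m C) u v = ae_class m (\<lambda>x. rep u x + rep v x)"
  "hscale (L2sub m C) c u = ae_class m (\<lambda>x. c * rep u x)"
  "hinner (L2sub m C) u v = (\<integral>x. rep u x * cnj (rep v x) \<partial>m)"
  by (simp_all add: L2sub_def L2_def)

lemma L2_eq_L2sub: "L2 m = L2sub m (ae_class m ` L2fun m)"
  by (simp add: L2sub_def L2_def L2fun_def)

lemma rep_L2:
  assumes "u \<in> ae_class m ` L2fun m"
  shows "rep u \<in> L2fun m" "ae_class m (rep u) = u"
proof -
  obtain f where f: "f \<in> L2fun m" "u = ae_class m f" using assms by (rule imageE)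
  note r = rep_ae_class[OF L2fun_measurable[OF f(1)]]
  show "rep u \<in> L2fun m" unfolding f(2) by (rule L2fun_cong_AE[OF f(1) r])
  show "ae_class m (rep u) = u"
    unfolding f(2) by (rule ae_class_cong[OF r(1) L2fun_measurable[OF f(1)] r(2)])
qed

lemma hnorm_L2sub: "hnorm (L2sub m C) u = L2norm m (rep u)"
proof -
  have "(\<lambda>x. rep u x * cnj (rep u x)) = (\<lambda>x. complex_of_real ((cmod (rep u x))\<^sup>2))"
    by (rule ext) (simp only: complex_norm_square)
  moreover have "(\<integral>x. complex_of_real ((cmod (rep u x))\<^sup>2) \<partial>m)
      = complex_of_real (\<integral>x. (cmod (rep u x))\<^sup>2 \<partial>m)"
    by (rule integral_complex_of_real)
  ultimately show ?thesis
    by (simp only: hnorm_def L2norm_def L2sub_sel Re_complex_of_real)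
qed

lemma L2norm_rep:
  assumes "f \<in> borel_measurable m"
  shows "L2norm m (rep (ae_class m f)) = L2norm m f"
  by (rule L2norm_cong_AE[OF assms rep_ae_class[OF assms]])

lemma L2norm_rep_diff:
  assumes f: "f \<in> borel_measurable m" and g: "g \<in> borel_measurable m"
  shows "L2norm m (\<lambda>x. rep (ae_class m f) x - rep (ae_class m g) x) = L2norm m (\<lambda>x. f x - g x)"
  using rep_ae_class[OF f] rep_ae_class[OF g] f g by (intro L2norm_cong_AE) auto

lemma hdist_L2sub:
  assumes C: "C \<subseteq> ae_class m ` L2fun m" and uv: "u \<in> C" "v \<in> C"
  shows "hdist (L2sub m C) u v = L2norm m (\<lambda>x. rep u x - rep v x)"
proof -
  have [measurable]: "rep u \<in> borel_measurable m" "rep v \<in> borel_measurable m"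
    using rep_L2(1)[OF subsetD[OF C]] uv by (simp_all add: L2fun_measurable)
  note r = rep_ae_class[of "\<lambda>x. - 1 * rep v x" m]
  have r1: "rep (ae_class m (\<lambda>x. - 1 * rep v x)) \<in> borel_measurable m" using r by simp
  note r2 = rep_ae_class[of "\<lambda>x. rep u x + rep (ae_class m (\<lambda>x. - 1 * rep v x)) x" m]
  have "L2norm m (rep (ae_class m (\<lambda>x. rep u x + rep (ae_class m (\<lambda>x. - 1 * rep v x)) x)))
      = L2norm m (\<lambda>x. rep u x - rep v x)"
    using r r2 r1 by (intro L2norm_cong_AE) auto
  then show ?thesis using uv by (simp add: hdist_def hnorm_L2sub)
qed

lemma Metric_space_L2sub:
  assumes C: "C \<subseteq> ae_class m ` L2fun m"
  shows "Metric_space C (hdist (L2sub m C))"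
proof (rule Metric_space.intro)
  note d = hdist_L2sub[OF C]
  have rL: "rep u \<in> L2fun m" if "u \<in> C" for u
    by (rule rep_L2(1)[OF subsetD[OF C that]])
  show "0 \<le> hdist (L2sub m C) u v" for u v
    by (simp add: hdist_def hnorm_L2sub L2norm_nonneg)
  show "hdist (L2sub m C) u v = hdist (L2sub m C) v u" for u v
  proof (cases "u \<in> C \<and> v \<in> C")
    case True
    then show ?thesis using L2norm_commute[of m "rep u" "rep v"] by (simp add: d)
  next
    case False
    then show ?thesis by (auto simp: hdist_def)
  qed
  show "hdist (L2sub m C) u v = 0 \<longleftrightarrow> u = v" if "u \<in> C" "v \<in> C" for u v
  proof -
    have "hdist (L2sub m C) u v = 0 \<longleftrightarrow> (AE x in m. rep u x = rep v x)"
      using L2norm_eq_0[OF L2fun_diff[OF rL rL]] that by (simp add: d)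
    also have "\<dots> \<longleftrightarrow> ae_class m (rep u) = ae_class m (rep v)"
      using that by (simp add: ae_class_eq_iff rL L2fun_measurable)
    also have "\<dots> \<longleftrightarrow> u = v" using rep_L2(2)[OF subsetD[OF C]] that by simp
    finally show ?thesis .
  qed
  show "hdist (L2sub m C) u w \<le> hdist (L2sub m C) u v + hdist (L2sub m C) v w"
    if "u \<in> C" "v \<in> C" "w \<in> C" for u v w
    using that L2norm_triangle_diff[OF rL rL rL] by (simp add: d)
qed

lemma closure_L2sub:
  assumes C: "C \<subseteq> ae_class m ` L2fun m" and S: "S \<subseteq> C"
  shows "htopology (L2sub m C) closure_of S
    = {u \<in> C. \<forall>e>0. \<exists>v\<in>S. L2norm m (\<lambda>x. rep u x - rep v x) < e}"
proof -
  interpret Metric_space C "hdist (L2sub m C)" by (rule Metric_space_L2sub[OF C])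
  have "hdist (L2sub m C) u v = L2norm m (\<lambda>x. rep u x - rep v x)" if "u \<in> C" "v \<in> S" for u v
    using that S by (intro hdist_L2sub[OF C]) auto
  then show ?thesis
    unfolding htopology_def L2sub_sel metric_closure_of using S
    by (intro Collect_cong conj_cong refl all_cong imp_cong bex_cong) auto
qed

lemma topspace_L2sub:
  assumes C: "C \<subseteq> ae_class m ` L2fun m"
  shows "topspace (htopology (L2sub m C)) = C"
proof -
  interpret Metric_space C "hdist (L2sub m C)" by (rule Metric_space_L2sub[OF C])
  show ?thesis by (simp add: htopology_def)
qed

lemma openin_L2sub_ball:
  assumes C: "C \<subseteq> ae_class m ` L2fun m" and U: "openin (htopology (L2sub m C)) U" and u: "u \<in> U"
  obtains e where "e > 0" "\<And>v. v \<in> C \<Longrightarrow> L2norm m (\<lambda>x. rep u x - rep v x) < e \<Longrightarrow> v \<in> U"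
proof -
  interpret Metric_space C "hdist (L2sub m C)" by (rule Metric_space_L2sub[OF C])
  have uC: "u \<in> C" using u openin_subset[OF U] topspace_L2sub[OF C] by auto
  obtain e where "e > 0" "mball u e \<subseteq> U"
    using U u unfolding htopology_def openin_mtopology L2sub_sel by blast
  then show thesis using that[of e] uC hdist_L2sub[OF C uC] by (auto simp: subset_iff)
qed

section \<open>H2 as a space of functions\<close>

definition H2fun :: "('a \<Rightarrow> complex) set \<Rightarrow> 'a measure \<Rightarrow> ('a \<Rightarrow> complex) set" where
  "H2fun A m = {f \<in> L2fun m. \<forall>e>0. \<exists>a\<in>A. L2norm m (\<lambda>x. f x - a x) < e}"

lemma H2fun_L2fun: "f \<in> H2fun A m \<Longrightarrow> f \<in> L2fun m"
  by (simp add: H2fun_def)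

lemma H2fun_measurable: "f \<in> H2fun A m \<Longrightarrow> f \<in> borel_measurable m"
  by (simp add: H2fun_def L2fun_measurable)

lemma H2fun_cong_AE:
  assumes "f \<in> H2fun A m" "g \<in> borel_measurable m" "AE x in m. g x = f x"
    "A \<subseteq> borel_measurable m"
  shows "g \<in> H2fun A m"
proof -
  have "L2norm m (\<lambda>x. g x - a x) = L2norm m (\<lambda>x. f x - a x)" if "a \<in> A" for a
    using assms that H2fun_measurable[OF assms(1)]
    by (intro L2norm_cong_AE) (auto intro!: borel_measurable_diff)
  moreover have "g \<in> L2fun m"
    by (rule L2fun_cong_AE[OF H2fun_L2fun[OF assms(1)] assms(2,3)])
  ultimately show ?thesis
    using assms(1) unfolding H2fun_def by fastforce
qed

lemma H2fun_closed:
  assumes f: "f \<in> L2fun m" and A: "A \<subseteq> L2fun m"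
    and near: "\<And>e. e > 0 \<Longrightarrow> \<exists>g\<in>H2fun A m. L2norm m (\<lambda>x. f x - g x) < e"
  shows "f \<in> H2fun A m"
proof -
  have "\<exists>a\<in>A. L2norm m (\<lambda>x. f x - a x) < e" if "e > 0" for e
  proof -
    obtain g where g: "g \<in> H2fun A m" "L2norm m (\<lambda>x. f x - g x) < e/2"
      using near[of "e/2"] \<open>e > 0\<close> by auto
    obtain a where a: "a \<in> A" "L2norm m (\<lambda>x. g x - a x) < e/2"
      using g(1) half_gt_zero[OF \<open>e > 0\<close>] unfolding H2fun_def by blast
    have "a \<in> L2fun m" using a A by auto
    then have "L2norm m (\<lambda>x. f x - a x) < e"
      using L2norm_triangle_diff[OF f H2fun_L2fun[OF g(1)], of a] g(2) a(2) by linarith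
    then show ?thesis using a(1) by blast
  qed
  then show ?thesis using f by (simp add: H2fun_def)
qed

lemma subset_H2fun: "A \<subseteq> L2fun m \<Longrightarrow> A \<subseteq> H2fun A m"
  unfolding H2fun_def by (auto intro!: bexI)

text \<open>Lets the analysis run on functions instead of classes, at the price of congruence lemmas
  for equality almost everywhere.\<close>

lemma hcarrier_H2:
  assumes A: "A \<subseteq> L2fun m"
  shows "hcarrier (H2 A m) = ae_class m ` H2fun A m"
proof -
  have "hcarrier (H2 A m) = {u \<in> ae_class m ` L2fun m.
      \<forall>e>0. \<exists>v\<in>ae_class m ` A. L2norm m (\<lambda>x. rep u x - rep v x) < e}"
    unfolding H2_def using A by (subst L2_eq_L2sub) (simp add: L2_eq_L2sub closure_L2sub image_mono)
  also have "\<dots> = ae_class m ` {f \<in> L2fun m. \<forall>e>0. \<exists>a\<in>A. L2norm m (\<lambda>x. f x - a x) < e}"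
  proof -
    have "L2norm m (\<lambda>x. rep (ae_class m f) x - rep (ae_class m a) x) = L2norm m (\<lambda>x. f x - a x)"
      if "f \<in> L2fun m" "a \<in> A" for f a
      using that A by (intro L2norm_rep_diff L2fun_measurable) auto
    then show ?thesis by auto
  qed
  finally show ?thesis by (simp add: H2fun_def)
qed

lemma H2_eq_L2sub:
  assumes A: "A \<subseteq> L2fun m"
  shows "H2 A m = L2sub m (ae_class m ` H2fun A m)"
  using hcarrier_H2[OF A] by (simp add: L2sub_def H2_def)

lemma rep_H2fun:
  assumes u: "u \<in> ae_class m ` H2fun A m" and A: "A \<subseteq> borel_measurable m"
  shows "rep u \<in> H2fun A m" "ae_class m (rep u) = u"
proof -
  obtain f where f: "f \<in> H2fun A m" "u = ae_class m f" using u by (rule imageE)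
  show "rep u \<in> H2fun A m"
    unfolding f(2) by (rule H2fun_cong_AE[OF f(1) rep_ae_class[OF H2fun_measurable[OF f(1)]] A])
  show "ae_class m (rep u) = u" 
    unfolding f(2) by (rule rep_L2(2)) (use f(1) H2fun_L2fun in blast)
qed

section \<open>Jensen's equality for logmodular algebras\<close>

text \<open>No lower bound on \<open>x\<close> is imposed. For negative \<open>x\<close> the claim
  follows from \<open>exp (- x) \<ge> 1 - x\<close> and
  \<open>(1 + x + x^2) (1 - x) = 1 - x^3 \<ge> 1\<close>.\<close>

lemma exp_le_quadratic:
  fixes x :: real
  assumes "x \<le> 1"
  shows "exp x \<le> 1 + x + x\<^sup>2"
proof (cases "0 \<le> x")
  case True
  then show ?thesis using assms by (rule exp_bound)
next
  case False
  have "exp x \<le> 1 / (1 - x)"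
    using exp_ge_add_one_self[of "- x"] False by (simp add: exp_minus field_simps)
  also have "\<dots> \<le> 1 + x + x\<^sup>2"
  proof -
    have "x ^ 3 \<le> 0" using False by (simp add: power_le_zero_eq)
    moreover have "(1 + x + x\<^sup>2) * (1 - x) = 1 - x ^ 3"
      by (simp add: algebra_simps power2_eq_square power3_eq_cube)
    ultimately show ?thesis using False by (simp add: divide_le_eq)
  qed
  finally show ?thesis .
qed

text \<open>The functional \<phi> is represented by integration against \<open>m\<close>; its
  multiplicativity on \<open>A\<close> becomes \<open>integral_mult\<close>.\<close>

locale logmodular_prob = prob_space m for m :: "'a::t2_space measure" +
  fixes A :: "('a \<Rightarrow> complex) set"
  assumes compact_UNIV: "compact (UNIV :: 'a set)"
    and logmodular: "logmodular_algebra A"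
    and sets_m: "sets m = sets borel"
    and integral_mult: "f \<in> A \<Longrightarrow> g \<in> A \<Longrightarrow> (\<integral>x. f x * g x \<partial>m) = (\<integral>x. f x \<partial>m) * (\<integral>x. g x \<partial>m)"
begin

lemma A_continuous: "f \<in> A \<Longrightarrow> continuous_on UNIV f"
  and A_const: "(\<lambda>x. c) \<in> A"
  and A_add: "f \<in> A \<Longrightarrow> g \<in> A \<Longrightarrow> (\<lambda>x. f x + g x) \<in> A"
  and A_mult: "f \<in> A \<Longrightarrow> g \<in> A \<Longrightarrow> (\<lambda>x. f x * g x) \<in> A"
  using logmodular by (simp_all add: logmodular_algebra_def uniform_algebra_def)

lemma A_scale: "f \<in> A \<Longrightarrow> (\<lambda>x. c * f x) \<in> A"
  using A_mult[OF A_const] .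

lemma A_diff: "f \<in> A \<Longrightarrow> g \<in> A \<Longrightarrow> (\<lambda>x. f x - g x) \<in> A"
  using A_add[of f "\<lambda>x. - 1 * g x"] A_scale[of g "- 1"] by simp

lemma A_prod: fixes n :: nat shows "(\<And>i. i < n \<Longrightarrow> f i \<in> A) \<Longrightarrow> (\<lambda>x. \<Prod>i<n. f i x) \<in> A"
  by (induction n) (auto intro: A_const A_mult)

lemma integral_prod: fixes n :: nat shows "(\<And>i. i < n \<Longrightarrow> f i \<in> A) \<Longrightarrow> (\<integral>x. (\<Prod>i<n. f i x) \<partial>m) = (\<Prod>i<n. \<integral>x. f i x \<partial>m)"
proof (induction n)
  case 0
  then show ?case by (simp add: prob_space)
next
  case (Suc n)
  then show ?case using integral_mult[OF A_prod[of n f]] by simp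
qed

lemma continuous_measurable:
  fixes f :: "'a \<Rightarrow> 'b::topological_space"
  assumes "continuous_on UNIV f"
  shows "f \<in> borel_measurable m"
  using borel_measurable_continuous_onI[OF assms] measurable_cong_sets[OF sets_m refl] by blast

lemma A_measurable: "f \<in> A \<Longrightarrow> f \<in> borel_measurable m"
  by (intro continuous_measurable A_continuous)

lemma continuous_bounded:
  fixes f :: "'a \<Rightarrow> 'b::real_normed_vector"
  assumes "continuous_on UNIV f"
  obtains C where "C > 0" "\<And>x. norm (f x) \<le> C"
  using compact_imp_bounded[OF compact_continuous_image[OF assms compact_UNIV]]
  unfolding bounded_pos by auto

lemma continuous_integrable:
  fixes f :: "'a \<Rightarrow> 'b::{banach,second_countable_topology}"
  assumes f: "continuous_on UNIV f"
  shows "integrable m f"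
proof -
  obtain C where "\<And>x. norm (f x) \<le> C" using continuous_bounded[OF f] by blast
  then show ?thesis
    by (intro integrable_const_bound[where B = C] continuous_measurable f) auto
qed

lemma A_L2fun: "A \<subseteq> L2fun m"
proof
  fix f assume f: "f \<in> A"
  have "continuous_on UNIV (\<lambda>x. (cmod (f x))\<^sup>2)" by (intro continuous_intros A_continuous f)
  then show "f \<in> L2fun m"
    using A_measurable[OF f] continuous_integrable by (simp add: L2fun_def)
qed

lemma A_integrable: "f \<in> A \<Longrightarrow> integrable m f"
  by (intro continuous_integrable A_continuous)

lemma alg_unitsD:
  assumes "f \<in> alg_units A"
  shows "f \<in> A" "f x \<noteq> 0" "(\<lambda>x. inverse (f x)) \<in> A" "(\<lambda>x. inverse (f x)) \<in> alg_units A"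
    "continuous_on UNIV (\<lambda>x. ln (cmod (f x)))" "(\<integral>x. f x \<partial>m) * (\<integral>x. inverse (f x) \<partial>m) = 1"
proof -
  obtain g where g: "g \<in> A" "\<And>x. f x * g x = 1" and f: "f \<in> A"
    using assms by (auto simp: alg_units_def)
  show "f \<in> A" by (rule f)
  show nz: "f x \<noteq> 0" for x using g(2)[of x] by auto
  have "g = (\<lambda>x. inverse (f x))" using g(2) nz by (auto simp: fun_eq_iff inverse_eq_divide eq_divide_eq mult.commute)
  then show i: "(\<lambda>x. inverse (f x)) \<in> A" using g by simp
  then show "(\<lambda>x. inverse (f x)) \<in> alg_units A" using f nz by (auto simp: alg_units_def intro!: bexI[of _ f])
  show "continuous_on UNIV (\<lambda>x. ln (cmod (f x)))"
    by (intro continuous_intros A_continuous f) (simp add: nz)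
  show "(\<integral>x. f x \<partial>m) * (\<integral>x. inverse (f x) \<partial>m) = 1"
    using integral_mult[OF f i] nz by (simp add: prob_space)
qed

lemma logmodular_approx:
  assumes "continuous_on UNIV u" "e > 0"
  obtains f where "f \<in> alg_units A" "\<And>x. \<bar>u x - ln (cmod (f x))\<bar> < e"
  using logmodular assms unfolding logmodular_algebra_def by blast

text \<open>The power means \<open>(\<integral> |f|^(1/k))^k\<close> tend to
  \<open>exp (\<integral> ln |f|)\<close>. Roots of \<open>f\<close> need not exist in
  \<open>A\<close>, but logmodularity gives a unit \<open>g\<close> with \<open>|g|\<close> close to
  \<open>|f|^(1/k)\<close>. Multiplicativity gives \<phi>(f) = \<phi>(r) \<phi>(g)^k with a
  remainder \<open>r\<close> of modulus near one, and \<phi>(g) is bounded by \<integral>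
  |g|.\<close>

lemma Jensen_le:
  assumes f: "f \<in> alg_units A"
  shows "cmod (\<integral>x. f x \<partial>m) \<le> exp (\<integral>x. ln (cmod (f x)) \<partial>m)"
proof -
  define u where "u x = ln (cmod (f x))" for x
  have u: "continuous_on UNIV u" using alg_unitsD(5)[OF f] by (simp add: u_def[abs_def])
  obtain C where C: "\<And>x. \<bar>u x\<bar> \<le> C" using continuous_bounded[OF u] by auto
  have ui: "integrable m u" "integrable m (\<lambda>x. (u x)\<^sup>2)"
    by (intro continuous_integrable continuous_intros u)+
  define I J where "I = (\<integral>x. u x \<partial>m)" and "J = (\<integral>x. (u x)\<^sup>2 \<partial>m)"
  have fu: "cmod (f x) = exp (u x)" for x using alg_unitsD(2)[OF f] by (simp add: u_def)
  \<comment> \<open>The condition \<open>real k \<ge> C\<close> ensures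
    \<open>u x / real k \<le> 1\<close>, the range of \<open>exp_le_quadratic\<close>.\<close>
  have bound: "cmod (\<integral>x. f x \<partial>m) \<le> exp (2 / real k + I + J / real k)" if k: "real k \<ge> C" "k > 0" for k
  proof -
    \<comment> \<open>The error is multiplied by \<open>k\<close> when the root is raised to the
      \<open>k\<close>-th power, so it has to be of smaller order than \<open>1 / k\<close>.\<close>
    define e where "e = 1 / (real k)\<^sup>2"
    have e: "e > 0" "real k * e = 1 / real k" using k by (auto simp: e_def power2_eq_square)
    have "continuous_on UNIV (\<lambda>x. u x / real k)" by (intro continuous_intros u) (use k in auto)
    then obtain g where g: "g \<in> alg_units A" and ge: "\<And>x. \<bar>u x / real k - ln (cmod (g x))\<bar> < e"
      using logmodular_approx e(1) by blast
    have gn: "g x \<noteq> 0" for x by (rule alg_unitsD(2)[OF g])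
    have gu: "cmod (g x) = exp (ln (cmod (g x)))" for x using gn by simp
    \<comment> \<open>The quotient of \<open>f\<close> by \<open>g^k\<close>; it lies in
      \<open>A\<close> because \<open>g\<close> is a unit.\<close>
    define r where "r x = f x * (\<Prod>i<k. inverse (g x))" for x
    have rA: "r \<in> A" unfolding r_def[abs_def]
      by (intro A_mult A_prod alg_unitsD(1)[OF f] alg_unitsD(3)[OF g])
    have gk: "(\<lambda>x. \<Prod>i<k. g x) \<in> A" by (intro A_prod alg_unitsD(1)[OF g])
    have "f x = r x * (\<Prod>i<k. g x)" for x
      using gn[of x] by (simp add: r_def field_simps)
    then have "(\<integral>x. f x \<partial>m) = (\<integral>x. r x \<partial>m) * (\<integral>x. g x \<partial>m) ^ k"
      using integral_mult[OF rA gk] integral_prod[of k "\<lambda>_. g"] alg_unitsD(1)[OF g] by simp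
    then have eq: "cmod (\<integral>x. f x \<partial>m) = cmod (\<integral>x. r x \<partial>m) * cmod (\<integral>x. g x \<partial>m) ^ k"
      by (simp add: norm_mult norm_power)
    have "cmod (r x) \<le> exp (1 / real k)" for x
    proof -
      have "cmod (r x) = exp (u x) * inverse (exp (ln (cmod (g x)))) ^ k"
        by (simp add: r_def norm_mult norm_power norm_inverse fu gn)
      also have "\<dots> = exp (real k * (u x / real k - ln (cmod (g x))))"
        using k by (simp add: exp_minus[symmetric] exp_of_nat_mult[symmetric] exp_add[symmetric]
          right_diff_distrib flip: exp_minus)
      also have "\<dots> \<le> exp (real k * e)"
        using ge[of x] by (intro exp_le_cancel_iff[THEN iffD2] mult_left_mono) auto
      finally show ?thesis using e by simp
    qed
    then have "(\<integral>x. cmod (r x) \<partial>m) \<le> (\<integral>x. exp (1 / real k) \<partial>m)"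
      using A_integrable[OF rA] by (intro integral_mono) auto
    then have 1: "cmod (\<integral>x. r x \<partial>m) \<le> exp (1 / real k)"
      by (intro order_trans[OF integral_norm_bound]) (simp add: prob_space)
    have "cmod (g x) \<le> exp e * (1 + u x / real k + (u x)\<^sup>2 / (real k)\<^sup>2)" for x
    proof -
      have "cmod (g x) \<le> exp (e + u x / real k)"
        using ge[of x] by (subst gu) simp
      also have "\<dots> = exp e * exp (u x / real k)" by (rule exp_add)
      also have "exp (u x / real k) \<le> 1 + u x / real k + (u x / real k)\<^sup>2"
      proof (rule exp_le_quadratic)
        show "u x / real k \<le> 1" using C[of x] k by (simp add: divide_le_eq)
      qed
      finally show ?thesis by (simp add: power_divide)
    qed
    then have "(\<integral>x. cmod (g x) \<partial>m) \<le> (\<integral>x. exp e * (1 + u x / real k + (u x)\<^sup>2 / (real k)\<^sup>2) \<partial>m)"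
      using A_integrable[OF alg_unitsD(1)[OF g]] ui by (intro integral_mono) auto
    also have "\<dots> = exp e * (1 + (I / real k + J / (real k)\<^sup>2))"
      using ui by (simp add: I_def J_def prob_space)
    \<comment> \<open>Back to an exponential by \<open>1 + z \<le> exp z\<close>, so that the
      \<open>k\<close>-th power below multiplies the exponent.\<close>
    also have "\<dots> \<le> exp e * exp (I / real k + J / (real k)\<^sup>2)"
      by (intro mult_left_mono exp_ge_add_one_self) auto
    finally have 2: "cmod (\<integral>x. g x \<partial>m) \<le> exp (e + (I / real k + J / (real k)\<^sup>2))"
      by (intro order_trans[OF integral_norm_bound]) (simp add: exp_add)
    have "cmod (\<integral>x. f x \<partial>m) \<le> exp (1 / real k) * exp (e + (I / real k + J / (real k)\<^sup>2)) ^ k"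
      unfolding eq by (intro mult_mono power_mono 1 2) auto
    also have "\<dots> = exp (1 / real k + real k * (e + (I / real k + J / (real k)\<^sup>2)))"
      by (simp add: exp_of_nat_mult exp_add)
    also have "1 / real k + real k * (e + (I / real k + J / (real k)\<^sup>2)) = 2 / real k + I + J / real k"
      using k e(2) by (simp add: distrib_left power2_eq_square)
    finally show ?thesis .
  qed
  have "(\<lambda>k. exp (2 / real k + I + J / real k)) \<longlonglongrightarrow> exp (0 + I + 0)"
    by (intro tendsto_intros lim_const_over_n)
  moreover have "\<forall>\<^sub>F k in sequentially. cmod (\<integral>x. f x \<partial>m) \<le> exp (2 / real k + I + J / real k)"
    using eventually_ge_at_top[of "nat \<lceil>C\<rceil>"] eventually_gt_at_top[of 0]
    by eventually_elim (intro bound; linarith)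
  ultimately have "cmod (\<integral>x. f x \<partial>m) \<le> exp (0 + I + 0)"
    by (rule tendsto_lowerbound) simp
  then show ?thesis by (simp add: I_def u_def)
qed

text \<open>The reverse inequality is \<open>Jensen_le\<close> for the inverse of \<open>f\<close>,
  since \<phi>(f) \<phi>(1/f) = 1.\<close>

lemma Jensen_eq:
  assumes f: "f \<in> alg_units A"
  shows "cmod (\<integral>x. f x \<partial>m) = exp (\<integral>x. ln (cmod (f x)) \<partial>m)"
proof (rule antisym[OF Jensen_le[OF f]])
  note u = alg_unitsD[OF f]
  have "cmod (\<integral>x. inverse (f x) \<partial>m) \<le> exp (- (\<integral>x. ln (cmod (f x)) \<partial>m))"
    using Jensen_le[OF u(4)] u(2) by (simp add: norm_inverse ln_inverse)
  then have "1 \<le> cmod (\<integral>x. f x \<partial>m) * exp (- (\<integral>x. ln (cmod (f x)) \<partial>m))"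
    using u(6) by (metis norm_ge_zero norm_mult norm_one mult_left_mono)
  then show "exp (\<integral>x. ln (cmod (f x)) \<partial>m) \<le> cmod (\<integral>x. f x \<partial>m)"
    by (simp add: exp_minus field_simps)
qed

end

section \<open>H2 as a module over \<open>A\<close> and over bounded limits from
  \<open>A\<close>\<close>

lemma L2_bounded_convergence:
  assumes a: "\<And>n. a n \<in> borel_measurable m" "\<And>n x. cmod (a n x) \<le> 1" and \<alpha>: "\<alpha> \<in> borel_measurable m"
    and lim: "AE x in m. (\<lambda>n. a n x) \<longlonglongrightarrow> \<alpha> x" and f: "f \<in> L2fun m"
  shows "(\<lambda>x. \<alpha> x * f x) \<in> L2fun m" "(\<lambda>n. L2norm m (\<lambda>x. a n x * f x - \<alpha> x * f x)) \<longlonglongrightarrow> 0"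
proof -
  have [measurable]: "f \<in> borel_measurable m" by (rule L2fun_measurable[OF f])
  note [measurable] = a(1) \<alpha>
  have \<alpha>1: "AE x in m. cmod (\<alpha> x) \<le> 1"
    using lim
  proof eventually_elim
    case (elim x)
    show ?case by (rule LIMSEQ_le_const2[OF tendsto_norm[OF elim]]) (auto simp: a)
  qed
  show "(\<lambda>x. \<alpha> x * f x) \<in> L2fun m"
    by (rule L2fun_bound[OF f, where C = 1])
       (use \<alpha>1 in \<open>auto simp: norm_mult elim!: eventually_mono intro!: mult_left_le_one_le\<close>)
  have "(\<lambda>n. \<integral>x. (cmod (a n x * f x - \<alpha> x * f x))\<^sup>2 \<partial>m) \<longlonglongrightarrow> (\<integral>x. 0 \<partial>m)"
  proof (rule integral_dominated_convergence)
    show "integrable m (\<lambda>x. 4 * (cmod (f x))\<^sup>2)" using L2fun_integrable[OF f] by simp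
    show "AE x in m. (\<lambda>n. (cmod (a n x * f x - \<alpha> x * f x))\<^sup>2) \<longlonglongrightarrow> 0"
      using lim
    proof eventually_elim
      case (elim x)
      have "(\<lambda>n. (cmod (a n x * f x - \<alpha> x * f x))\<^sup>2) \<longlonglongrightarrow> (cmod (\<alpha> x * f x - \<alpha> x * f x))\<^sup>2"
        by (intro tendsto_intros elim)
      then show ?case by simp
    qed
    show "AE x in m. norm ((cmod (a n x * f x - \<alpha> x * f x))\<^sup>2) \<le> 4 * (cmod (f x))\<^sup>2" for n
      using \<alpha>1
    proof eventually_elim
      case (elim x)
      have "cmod (a n x * f x - \<alpha> x * f x) = cmod (a n x - \<alpha> x) * cmod (f x)"
        by (simp add: norm_mult flip: left_diff_distrib)
      also have "\<dots> \<le> 2 * cmod (f x)"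
        using norm_triangle_ineq4[of "a n x" "\<alpha> x"] a(2)[of n x] elim
        by (intro mult_right_mono) auto
      finally have "(cmod (a n x * f x - \<alpha> x * f x))\<^sup>2 \<le> (2 * cmod (f x))\<^sup>2"
        by (intro power_mono) auto
      then show ?case by (simp add: power_mult_distrib)
    qed
  qed measurable
  then have "(\<lambda>n. sqrt (\<integral>x. (cmod (a n x * f x - \<alpha> x * f x))\<^sup>2 \<partial>m)) \<longlonglongrightarrow> sqrt 0"
    by (intro tendsto_real_sqrt) simp
  then show "(\<lambda>n. L2norm m (\<lambda>x. a n x * f x - \<alpha> x * f x)) \<longlonglongrightarrow> 0"
    by (simp add: L2norm_def)
qed

context logmodular_prob
begin

lemma A_borel: "A \<subseteq> borel_measurable m"
  using A_measurable by blast

lemma integral_tendsto: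
  assumes F: "\<And>n. F n \<in> L2fun m" and f: "f \<in> L2fun m"
    and lim: "(\<lambda>n. L2norm m (\<lambda>x. F n x - f x)) \<longlonglongrightarrow> 0"
  shows "(\<lambda>n. \<integral>x. F n x \<partial>m) \<longlonglongrightarrow> (\<integral>x. f x \<partial>m)"
proof (rule LIM_zero_cancel, rule Lim_null_comparison[OF _ lim])
  have "norm ((\<integral>x. F n x \<partial>m) - (\<integral>x. f x \<partial>m)) \<le> L2norm m (\<lambda>x. F n x - f x)" for n
    using L2_integral_abs(3)[OF L2fun_diff[OF F f]] L2_integral_abs(1)[OF F] L2_integral_abs(1)[OF f]
    by simp
  then show "\<forall>\<^sub>F n in sequentially. norm ((\<integral>x. F n x \<partial>m) - (\<integral>x. f x \<partial>m)) \<le> L2norm m (\<lambda>x. F n x - f x)"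
    by simp
qed

lemma H2fun_limit:
  assumes F: "\<And>n. F n \<in> H2fun A m" and f: "f \<in> L2fun m"
    and lim: "(\<lambda>n. L2norm m (\<lambda>x. F n x - f x)) \<longlonglongrightarrow> 0"
  shows "f \<in> H2fun A m"
proof (rule H2fun_closed[OF f A_L2fun])
  fix e :: real assume "e > 0"
  then obtain n where "L2norm m (\<lambda>x. F n x - f x) < e"
    using order_tendstoD(2)[OF lim] by (auto simp: eventually_sequentially)
  then show "\<exists>g\<in>H2fun A m. L2norm m (\<lambda>x. f x - g x) < e"
    using F[of n] L2norm_commute[of m "F n" f] by auto
qed

text \<open>Starting at zero makes \<open>p n\<close> the sum of its increments, so that bounds on
  increments bound \<open>|p n|\<close> pointwise. The rate is \<open>1/4\<close> because the cutoff
  construction loses a square root, and \<open>1/2\<close> must remain for convergence in L2. The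
  pointwise limit is \<open>x\<close> since both are L2 limits of \<open>p\<close>.\<close>

lemma H2fun_approx:
  assumes x: "x \<in> H2fun A m"
  obtains C p where "\<And>n. p n \<in> A" "p 0 = (\<lambda>t. 0)"
    "\<And>n. L2norm m (\<lambda>t. p (Suc n) t - p n t) \<le> C * (1/4)^n"
    "AE t in m. (\<lambda>n. p n t) \<longlonglongrightarrow> x t" "(\<lambda>n. L2norm m (\<lambda>t. p n t - x t)) \<longlonglongrightarrow> 0"
proof -
  \<comment> \<open>At \<open>n = 0\<close> the function 0 has to be an admissible approximation,
    hence at least the norm of \<open>x\<close>; the added 1 keeps the tolerance positive when
    \<open>x\<close> is null.\<close>
  define B where "B = 1 + L2norm m x"
  have xL: "x \<in> L2fun m" by (rule H2fun_L2fun[OF x])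
  have B: "B \<ge> 1" by (simp add: B_def L2norm_nonneg)
  have "\<exists>a. a \<in> A \<and> L2norm m (\<lambda>t. x t - a t) \<le> B * (1/4)^n \<and> (n = 0 \<longrightarrow> a = (\<lambda>t. 0))" for n
  proof (cases "n = 0")
    case True
    then show ?thesis using A_const[of 0] by (intro exI[of _ "\<lambda>t. 0"]) (simp add: B_def)
  next
    case False
    have "0 < B * (1/4)^n" using B by simp
    then obtain a where "a \<in> A" "L2norm m (\<lambda>t. x t - a t) < B * (1/4)^n"
      using x unfolding H2fun_def by blast
    then show ?thesis using False by (intro exI[of _ a]) auto
  qed
  then obtain p where pA: "\<And>n. p n \<in> A" and p: "\<And>n. L2norm m (\<lambda>t. x t - p n t) \<le> B * (1/4)^n"
    and p0: "p 0 = (\<lambda>t. 0)" by metis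
  have pL: "p n \<in> L2fun m" for n using pA A_L2fun by blast
  have step: "L2norm m (\<lambda>t. p (Suc n) t - p n t) \<le> (2 * B) * (1/4)^n" for n
  proof -
    have "L2norm m (\<lambda>t. p (Suc n) t - p n t) \<le> L2norm m (\<lambda>t. p (Suc n) t - x t) + L2norm m (\<lambda>t. x t - p n t)"
      by (rule L2norm_triangle_diff[OF pL xL pL])
    also have "\<dots> \<le> B * (1/4)^Suc n + B * (1/4)^n"
      using p[of n] p[of "Suc n"] unfolding L2norm_commute[of m "p (Suc n)"] by (rule add_mono[rotated])
    also have "\<dots> \<le> (2 * B) * (1/4)^n" using B by simp
    finally show ?thesis .
  qed
  have "(2 * B) * (1/4)^n \<le> (2 * B) * (1/2)^n" for n
    using B by (intro mult_left_mono power_mono) auto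
  then have step2: "L2norm m (\<lambda>t. p (Suc n) t - p n t) \<le> (2 * B) * (1/2)^n" for n
    using step order_trans by blast
  have lim: "(\<lambda>n. L2norm m (\<lambda>t. p n t - x t)) \<longlonglongrightarrow> 0"
  proof (rule Lim_null_comparison)
    show "\<forall>\<^sub>F n in sequentially. norm (L2norm m (\<lambda>t. p n t - x t)) \<le> B * (1/4)^n"
      using p by (simp add: L2norm_commute[of m _ x] L2norm_nonneg)
    have "(\<lambda>n. (1/4::real)^n) \<longlonglongrightarrow> 0" by (rule LIMSEQ_power_zero) simp
    then show "(\<lambda>n. B * (1/4)^n) \<longlonglongrightarrow> 0" using tendsto_mult_right_zero by blast
  qed
  obtain y where y: "y \<in> L2fun m" "AE t in m. (\<lambda>n. p n t) \<longlonglongrightarrow> y t"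
    "(\<lambda>n. L2norm m (\<lambda>t. p n t - y t)) \<longlonglongrightarrow> 0"
    using L2_rapid_Cauchy_converges[OF pL step2] by blast
  have "L2norm m (\<lambda>t. x t - y t) \<le> 0"
  proof (rule LIMSEQ_le_const)
    show "(\<lambda>n. L2norm m (\<lambda>t. p n t - x t) + L2norm m (\<lambda>t. p n t - y t)) \<longlonglongrightarrow> 0"
      using tendsto_add[OF lim y(3)] by simp
    show "\<exists>N. \<forall>n\<ge>N. L2norm m (\<lambda>t. x t - y t) \<le> L2norm m (\<lambda>t. p n t - x t) + L2norm m (\<lambda>t. p n t - y t)"
      using L2norm_triangle_diff[OF xL pL y(1)] by (simp add: L2norm_commute[of m _ x])
  qed
  then have "AE t in m. x t - y t = 0"
    using L2norm_eq_0[OF L2fun_diff[OF xL y(1)]] L2norm_nonneg[of m "\<lambda>t. x t - y t"] by simp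
  then have "AE t in m. (\<lambda>n. p n t) \<longlonglongrightarrow> x t"
    using y(2) by eventually_elim simp
  then show thesis using that[OF pA p0 step _ lim] by blast
qed

lemma H2fun_add: "f \<in> H2fun A m \<Longrightarrow> g \<in> H2fun A m \<Longrightarrow> (\<lambda>x. f x + g x) \<in> H2fun A m"
proof -
  assume f: "f \<in> H2fun A m" and g: "g \<in> H2fun A m"
  note fL = H2fun_L2fun[OF f] and gL = H2fun_L2fun[OF g]
  have "\<exists>a\<in>A. L2norm m (\<lambda>x. f x + g x - a x) < e" if e: "e > 0" for e
  proof -
    obtain a b where ab: "a \<in> A" "L2norm m (\<lambda>x. f x - a x) < e/2" "b \<in> A" "L2norm m (\<lambda>x. g x - b x) < e/2"
      using f g half_gt_zero[OF e] unfolding H2fun_def by blast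
    have eq: "(\<lambda>x. f x + g x - (a x + b x)) = (\<lambda>x. (f x - a x) + (g x - b x))" by auto
    have "L2norm m (\<lambda>x. f x + g x - (a x + b x)) < e"
      unfolding eq using L2norm_triangle[of "\<lambda>x. f x - a x" m "\<lambda>x. g x - b x"] ab A_L2fun fL gL
      by (force intro: L2fun_diff)
    then show ?thesis by (intro bexI[of _ "\<lambda>x. a x + b x"] A_add ab)
  qed
  then show ?thesis using L2fun_add[OF fL gL] by (simp add: H2fun_def)
qed

text \<open>Both sides of the second claim are L2-continuous in \<open>f\<close> and agree on
  \<open>A\<close>: \<phi> remains multiplicative when one factor ranges over H2.\<close>

lemma A_mult_H2fun:
  assumes a: "a \<in> A" and f: "f \<in> H2fun A m"
  shows "(\<lambda>x. a x * f x) \<in> H2fun A m" "(\<integral>x. a x * f x \<partial>m) = (\<integral>x. a x \<partial>m) * (\<integral>x. f x \<partial>m)"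
proof -
  have fL: "f \<in> L2fun m" by (rule H2fun_L2fun[OF f])
  obtain C where C: "C > 0" "\<And>x. cmod (a x) \<le> C" using continuous_bounded[OF A_continuous[OF a]] by blast
  have am[measurable]: "a \<in> borel_measurable m" by (rule A_measurable[OF a])
  have af: "(\<lambda>x. a x * g x) \<in> L2fun m" if "g \<in> L2fun m" for g
    using that C L2fun_measurable[OF that]
    by (intro L2fun_bound[OF that, where C = C]) (auto simp: norm_mult intro!: mult_right_mono)
  obtain K p where p: "\<And>n. p n \<in> A" and "p 0 = (\<lambda>t. 0)"
    and "\<And>n. L2norm m (\<lambda>t. p (Suc n) t - p n t) \<le> K * (1/4)^n"
    and "AE t in m. (\<lambda>n. p n t) \<longlonglongrightarrow> f t"
    and plim: "(\<lambda>n. L2norm m (\<lambda>t. p n t - f t)) \<longlonglongrightarrow> 0"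
    by (rule H2fun_approx[OF f]) blast
  have pL: "p n \<in> L2fun m" for n using p A_L2fun by blast
  have lim: "(\<lambda>n. L2norm m (\<lambda>t. a t * p n t - a t * f t)) \<longlonglongrightarrow> 0"
  proof (rule Lim_null_comparison)
    have "L2norm m (\<lambda>t. a t * p n t - a t * f t) \<le> C * L2norm m (\<lambda>t. p n t - f t)" for n
      using C L2fun_measurable[OF pL] L2fun_measurable[OF fL]
      by (intro L2norm_mono L2fun_diff pL fL)
         (auto simp: norm_mult simp flip: right_diff_distrib intro!: mult_right_mono)
    then show "\<forall>\<^sub>F n in sequentially. norm (L2norm m (\<lambda>t. a t * p n t - a t * f t)) \<le> C * L2norm m (\<lambda>t. p n t - f t)"
      by (simp add: L2norm_nonneg)
    show "(\<lambda>n. C * L2norm m (\<lambda>t. p n t - f t)) \<longlonglongrightarrow> 0" by (rule tendsto_mult_right_zero[OF plim])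
  qed
  have apA: "(\<lambda>t. a t * p n t) \<in> A" for n by (rule A_mult[OF a p])
  show "(\<lambda>x. a x * f x) \<in> H2fun A m"
    by (rule H2fun_limit[OF _ af[OF fL] lim]) (use apA subset_H2fun[OF A_L2fun] in blast)
  have "(\<lambda>n. \<integral>t. a t * p n t \<partial>m) \<longlonglongrightarrow> (\<integral>t. a t * f t \<partial>m)"
    by (rule integral_tendsto[OF af[OF pL] af[OF fL] lim])
  moreover have "(\<lambda>n. (\<integral>t. a t \<partial>m) * (\<integral>t. p n t \<partial>m)) \<longlonglongrightarrow> (\<integral>t. a t \<partial>m) * (\<integral>t. f t \<partial>m)"
    by (intro tendsto_mult_left integral_tendsto[OF pL fL plim])
  ultimately show "(\<integral>x. a x * f x \<partial>m) = (\<integral>x. a x \<partial>m) * (\<integral>x. f x \<partial>m)"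
    using integral_mult[OF a p] LIMSEQ_unique by auto
qed

lemma H2fun_scale: "f \<in> H2fun A m \<Longrightarrow> (\<lambda>x. c * f x) \<in> H2fun A m"
  by (rule A_mult_H2fun(1)[OF A_const])

lemma H2fun_diff: "f \<in> H2fun A m \<Longrightarrow> g \<in> H2fun A m \<Longrightarrow> (\<lambda>x. f x - g x) \<in> H2fun A m"
  using H2fun_add[of f "\<lambda>x. - 1 * g x"] H2fun_scale[of g "- 1"] by simp

section \<open>Multipliers into the algebra\<close>

text \<open>A unit with logarithmic modulus just below \<open>- v\<close> has |\<phi>| at least
  \<open>exp (- s)\<close> by Jensen's equality. Rotated so that \<phi>(g) is positive, it must be
  near 1: as \<open>|g| \<le> 1\<close>, \<open>|g - 1|^2 \<le> 2 - 2 Re g\<close>, and the right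
  side integrates to at most \<open>2 (1 - exp (- s)) \<le> 2 s\<close>.\<close>

lemma exists_cutoff_factor:
  assumes v: "continuous_on UNIV v" and v0: "\<And>t. 0 \<le> v t" and \<delta>: "\<delta> > 0"
    and I: "(\<integral>t. v t \<partial>m) + \<delta> \<le> s"
  obtains g where "g \<in> A" "\<And>t. cmod (g t) \<le> exp (- v t)" "cmod (\<integral>t. g t \<partial>m) \<ge> exp (- s)"
    "L2norm m (\<lambda>t. g t - 1) \<le> sqrt (2 * s)"
proof -
  \<comment> \<open>Aiming \<delta>/2 below \<open>- v\<close> with error \<delta>/2 confines
    \<open>ln |f|\<close> to the interval from \<open>- v\<close> - \<delta> to
    \<open>- v\<close>.\<close>
  have "continuous_on UNIV (\<lambda>t. - v t - \<delta> / 2)" by (intro continuous_intros v)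
  then obtain f where f: "f \<in> alg_units A" and close: "\<And>t. \<bar>- v t - \<delta> / 2 - ln (cmod (f t))\<bar> < \<delta> / 2"
    using logmodular_approx half_gt_zero[OF \<delta>] by blast
  note u = alg_unitsD[OF f]
  have up: "ln (cmod (f t)) \<le> - v t" for t using close[of t] by (simp add: abs_if split: if_splits)
  have lo: "- v t - \<delta> \<le> ln (cmod (f t))" for t using close[of t] by (simp add: abs_if split: if_splits)
  define w where "w = (\<integral>t. f t \<partial>m)"
  have "- s \<le> (\<integral>t. - v t - \<delta> \<partial>m)"
    using I continuous_integrable[OF v] by (simp add: prob_space)
  also have "\<dots> \<le> (\<integral>t. ln (cmod (f t)) \<partial>m)"
    using continuous_integrable[OF v] continuous_integrable[OF u(5)] lo by (intro integral_mono) auto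
  finally have w: "exp (- s) \<le> cmod w" unfolding w_def Jensen_eq[OF f] by simp
  then have w0: "cmod w > 0" using exp_gt_zero[of "- s"] by linarith
  \<comment> \<open>The unimodular factor turns the integral \<open>w\<close> into
    \<open>|w|\<close>, without which the distance to 1 could not be estimated.\<close>
  define g where "g t = cnj w / cmod w * f t" for t
  have gA: "g \<in> A" unfolding g_def[abs_def] by (rule A_scale[OF u(1)])
  have gn: "cmod (g t) \<le> exp (- v t)" for t
  proof -
    have "cmod (g t) = exp (ln (cmod (f t)))"
      using w0 u(2)[of t] by (simp add: g_def norm_mult norm_divide)
    then show ?thesis using up[of t] by simp
  qed
  have "(\<integral>t. g t \<partial>m) = cnj w / cmod w * w" unfolding g_def w_def[symmetric] by (simp add: w_def)
  also have "\<dots> = of_real (cmod w)"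
    using w0 complex_norm_square[of w] by (simp add: field_simps power2_eq_square)
  finally have gi: "(\<integral>t. g t \<partial>m) = of_real (cmod w)" .
  have gL: "g \<in> L2fun m" and one: "(\<lambda>t. 1) \<in> L2fun m" using gA A_const[of 1] A_L2fun by blast+
  have "(L2norm m (\<lambda>t. g t - 1))\<^sup>2 \<le> 2 * s"
  proof -
    have "(L2norm m (\<lambda>t. g t - 1))\<^sup>2 \<le> (\<integral>t. 2 - 2 * Re (g t) \<partial>m)"
      unfolding L2norm_sq
    proof (rule integral_mono)
      show "integrable m (\<lambda>t. (cmod (g t - 1))\<^sup>2)" by (intro L2fun_integrable L2fun_diff gL one)
      show "integrable m (\<lambda>t. 2 - 2 * Re (g t))" using A_integrable[OF gA] by simp
      fix t
      have "exp (- v t) \<le> 1" using v0[of t] by simp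
      then have "cmod (g t) \<le> 1" using gn[of t] by linarith
      then have "(cmod (g t))\<^sup>2 \<le> 1" by (simp add: power_le_one)
      then show "(cmod (g t - 1))\<^sup>2 \<le> 2 - 2 * Re (g t)"
        unfolding cmod_power2 by (simp add: power2_eq_square algebra_simps)
    qed
    also have "\<dots> = 2 - 2 * Re (\<integral>t. g t \<partial>m)"
      using A_integrable[OF gA] by (simp add: prob_space)
    also have "\<dots> = 2 - 2 * cmod w" by (simp add: gi)
    also have "\<dots> \<le> 2 * s" using w exp_ge_add_one_self[of "- s"] by linarith
    finally show ?thesis .
  qed
  then have "L2norm m (\<lambda>t. g t - 1) \<le> sqrt (2 * s)" by (rule real_le_rsqrt)
  then show thesis using that[OF gA gn] gi w by simp
qed

text \<open>\<open>k n\<close> is the product of the first \<open>n\<close> cutoff factors. All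
  factors have modulus at most one, so a step of the product is no larger than the distance of the
  new factor from 1, which is of order \<open>sqrt ((1/4)^n) = (1/2)^n\<close>. This gives
  convergence of the product both in L2 and almost everywhere.\<close>

lemma exists_cutoff:
  fixes v :: "nat \<Rightarrow> 'a \<Rightarrow> real"
  assumes v: "\<And>n. continuous_on UNIV (v n)" and v0: "\<And>n t. 0 \<le> v n t"
    and I: "\<And>n. (\<integral>t. v n t \<partial>m) \<le> C * (1/4)^n"
  obtains k h c where "\<And>n. k n \<in> A" "\<And>n t. cmod (k n t) \<le> exp (- (\<Sum>i<n. v i t))"
    "h \<in> borel_measurable m" "AE t in m. (\<lambda>n. k n t) \<longlonglongrightarrow> h t" "(\<lambda>n. \<integral>t. k n t \<partial>m) \<longlonglongrightarrow> c" "c \<noteq> 0"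
proof -
  \<comment> \<open>The extra \<open>(1/4)^n\<close> is the slack \<delta> granted to the
    \<open>n\<close>-th factor.\<close>
  define D where "D = C + 1"
  have "0 \<le> (\<integral>t. v 0 t \<partial>m)" by (intro integral_nonneg_AE) (simp add: v0)
  then have D: "D > 0" using I[of 0] by (simp add: D_def)
  have "\<exists>g. g \<in> A \<and> (\<forall>t. cmod (g t) \<le> exp (- v n t)) \<and> cmod (\<integral>t. g t \<partial>m) \<ge> exp (- (D * (1/4)^n))
      \<and> L2norm m (\<lambda>t. g t - 1) \<le> sqrt (2 * (D * (1/4)^n))" for n
  proof -
    have "(\<integral>t. v n t \<partial>m) + (1/4)^n \<le> D * (1/4)^n" using I[of n] by (simp add: D_def distrib_right)
    then obtain g where "g \<in> A" "\<And>t. cmod (g t) \<le> exp (- v n t)" "cmod (\<integral>t. g t \<partial>m) \<ge> exp (- (D * (1/4)^n))"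
      "L2norm m (\<lambda>t. g t - 1) \<le> sqrt (2 * (D * (1/4)^n))"
      by (rule exists_cutoff_factor[OF v v0, rotated]) auto
    then show ?thesis by blast
  qed
  then obtain g where gA: "\<And>n. g n \<in> A" and gv: "\<And>n t. cmod (g n t) \<le> exp (- v n t)"
    and gi: "\<And>n. cmod (\<integral>t. g n t \<partial>m) \<ge> exp (- (D * (1/4)^n))"
    and g1: "\<And>n. L2norm m (\<lambda>t. g n t - 1) \<le> sqrt (2 * (D * (1/4)^n))"
    by metis
  define k where "k n t = (\<Prod>i<n. g i t)" for n t
  have kA: "k n \<in> A" for n unfolding k_def[abs_def] by (rule A_prod[OF gA])
  have kL: "k n \<in> L2fun m" for n using kA A_L2fun by blast
  have kv: "cmod (k n t) \<le> exp (- (\<Sum>i<n. v i t))" for n t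
  proof -
    have "cmod (k n t) = (\<Prod>i<n. cmod (g i t))" by (simp add: k_def prod_norm)
    also have "\<dots> \<le> (\<Prod>i<n. exp (- v i t))" by (intro prod_mono) (simp add: gv)
    also have "\<dots> = exp (- (\<Sum>i<n. v i t))" by (simp add: exp_sum sum_negf[symmetric])
    finally show ?thesis .
  qed
  have k1: "cmod (k n t) \<le> 1" for n t
  proof -
    have "exp (- (\<Sum>i<n. v i t)) \<le> 1" using v0 by (simp add: sum_nonneg)
    then show ?thesis using kv[of n t] by linarith
  qed
  have kstep: "L2norm m (\<lambda>t. k (Suc n) t - k n t) \<le> sqrt (2 * D) * (1/2)^n" for n
  proof -
    have "L2norm m (\<lambda>t. k (Suc n) t - k n t) \<le> 1 * L2norm m (\<lambda>t. g n t - 1)"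
    proof (rule L2norm_mono)
      have eq: "k (Suc n) t - k n t = k n t * (g n t - 1)" for t by (simp add: k_def algebra_simps)
      show "AE t in m. cmod (k (Suc n) t - k n t) \<le> 1 * cmod (g n t - 1)"
        unfolding eq norm_mult using k1 by (auto intro!: mult_left_le_one_le)
      show "(\<lambda>t. g n t - 1) \<in> L2fun m"
        using A_diff[OF gA[of n] A_const[of 1]] A_L2fun by blast
      show "(\<lambda>t. k (Suc n) t - k n t) \<in> borel_measurable m"
        by (rule A_measurable[OF A_diff[OF kA kA]])
    qed simp
    also have "\<dots> \<le> sqrt (2 * (D * (1/4)^n))" using g1[of n] by simp
    also have "2 * (D * (1/4)^n) = 2 * D * ((1/2)^n)\<^sup>2" by (simp add: power2_eq_square flip: power_mult_distrib)
    also have "sqrt (2 * D * ((1/2)^n)\<^sup>2) = sqrt (2 * D) * (1/2)^n" by (simp add: real_sqrt_mult)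
    finally show ?thesis .
  qed
  obtain h where h: "h \<in> L2fun m" "AE t in m. (\<lambda>n. k n t) \<longlonglongrightarrow> h t"
    "(\<lambda>n. L2norm m (\<lambda>t. k n t - h t)) \<longlonglongrightarrow> 0"
    using L2_rapid_Cauchy_converges[of k, OF kL kstep] by blast
  have lim: "(\<lambda>n. \<integral>t. k n t \<partial>m) \<longlonglongrightarrow> (\<integral>t. h t \<partial>m)" by (rule integral_tendsto[OF kL h(1,3)])
  \<comment> \<open>The logarithmic losses \<open>D * (1/4)^i\<close> of the factors add up to less
    than \<open>2 * D\<close> for every \<open>n\<close>, which keeps \<phi> of the limit away from
    zero.\<close>
  have "exp (- (2 * D)) \<le> cmod (\<integral>t. k n t \<partial>m)" for n
  proof -
    have "(\<Sum>i<n. (1/4::real)^i) \<le> 2"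
      by (subst sum_gp_strict) (simp add: field_simps)
    then have "D * (\<Sum>i<n. (1/4::real)^i) \<le> D * 2" using D by (intro mult_left_mono) auto
    then have "exp (- (2 * D)) \<le> exp (\<Sum>i<n. - (D * (1/4)^i))"
      by (simp add: sum_negf sum_distrib_left mult.commute)
    also have "\<dots> = (\<Prod>i<n. exp (- (D * (1/4)^i)))" by (simp add: exp_sum)
    also have "\<dots> \<le> (\<Prod>i<n. cmod (\<integral>t. g i t \<partial>m))" by (intro prod_mono) (simp add: gi)
    also have "\<dots> = cmod (\<integral>t. k n t \<partial>m)"
      unfolding k_def by (simp add: integral_prod[OF gA] prod_norm)
    finally show ?thesis .
  qed
  then have "exp (- (2 * D)) \<le> cmod (\<integral>t. h t \<partial>m)"
    by (intro LIMSEQ_le_const[OF tendsto_norm[OF lim]]) auto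
  then have "(\<integral>t. h t \<partial>m) \<noteq> 0" using exp_gt_zero[of "- (2 * D)"] by auto
  then show thesis using that[OF kA kv L2fun_measurable[OF h(1)] h(2) lim] by blast
qed

text \<open>One cutoff \<open>k\<close>, built from the increments of approximations
  \<open>p\<close> of \<open>x\<close> and \<open>q\<close> of \<open>y\<close>, serves both
  functions. Then \<open>a n = k n * p n\<close>, \<open>b n = k n * q n\<close>, \<alpha> =
  \<open>h x\<close> and \<beta> = \<open>h y\<close>, while \<open>c\<close> is the limit of
  \<phi>(k n). Boundedness is \<open>|k n p n| \<le> exp (- s) * s \<le> 1\<close>, where
  \<open>s\<close> is the sum of the first \<open>n\<close> increments.\<close>

lemma exists_common_multiplier:
  assumes x: "x \<in> H2fun A m" and y: "y \<in> H2fun A m"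
  obtains a b \<alpha> \<beta> c where "\<And>n. a n \<in> A" "\<And>n. b n \<in> A"
    "\<And>n t. cmod (a n t) \<le> 1" "\<And>n t. cmod (b n t) \<le> 1"
    "\<alpha> \<in> borel_measurable m" "\<beta> \<in> borel_measurable m"
    "AE t in m. (\<lambda>n. a n t) \<longlonglongrightarrow> \<alpha> t" "AE t in m. (\<lambda>n. b n t) \<longlonglongrightarrow> \<beta> t"
    "AE t in m. \<alpha> t * y t = \<beta> t * x t"
    "(\<lambda>n. \<integral>t. a n t \<partial>m) \<longlonglongrightarrow> c * (\<integral>t. x t \<partial>m)" "(\<lambda>n. \<integral>t. b n t \<partial>m) \<longlonglongrightarrow> c * (\<integral>t. y t \<partial>m)" "c \<noteq> 0"
proof -
  obtain C p where p: "\<And>n. p n \<in> A" and p0: "p 0 = (\<lambda>t. 0)"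
    and pC: "\<And>n. L2norm m (\<lambda>t. p (Suc n) t - p n t) \<le> C * (1/4)^n"
    and px: "AE t in m. (\<lambda>n. p n t) \<longlonglongrightarrow> x t"
    and plim: "(\<lambda>n. L2norm m (\<lambda>t. p n t - x t)) \<longlonglongrightarrow> 0"
    by (rule H2fun_approx[OF x]) blast
  obtain D q where q: "\<And>n. q n \<in> A" and q0: "q 0 = (\<lambda>t. 0)"
    and qD: "\<And>n. L2norm m (\<lambda>t. q (Suc n) t - q n t) \<le> D * (1/4)^n"
    and qy: "AE t in m. (\<lambda>n. q n t) \<longlonglongrightarrow> y t"
    and qlim: "(\<lambda>n. L2norm m (\<lambda>t. q n t - y t)) \<longlonglongrightarrow> 0"
    by (rule H2fun_approx[OF y]) blast
  have pL: "p n \<in> L2fun m" and qL: "q n \<in> L2fun m" for n using p q A_L2fun by blast+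
  \<comment> \<open>Adding the increments of both sequences makes the partial sums of
    \<open>v\<close> dominate \<open>|p n|\<close> and \<open>|q n|\<close> at once.\<close>
  define v where "v n t = cmod (p (Suc n) t - p n t) + cmod (q (Suc n) t - q n t)" for n t
  have vc: "continuous_on UNIV (v n)" for n
    unfolding v_def[abs_def] by (intro continuous_intros A_continuous p q)
  have v0: "0 \<le> v n t" for n t by (simp add: v_def)
  have vI: "(\<integral>t. v n t \<partial>m) \<le> (C + D) * (1/4)^n" for n
  proof -
    have dp: "(\<lambda>t. p (Suc n) t - p n t) \<in> L2fun m" and dq: "(\<lambda>t. q (Suc n) t - q n t) \<in> L2fun m"
      by (intro L2fun_diff pL qL)+
    have "(\<integral>t. v n t \<partial>m) = (\<integral>t. cmod (p (Suc n) t - p n t) \<partial>m) + (\<integral>t. cmod (q (Suc n) t - q n t) \<partial>m)"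
      unfolding v_def using L2_integral_abs(1)[OF dp] L2_integral_abs(1)[OF dq]
      by (intro Bochner_Integration.integral_add) auto
    also have "\<dots> \<le> C * (1/4)^n + D * (1/4)^n"
      by (intro add_mono order_trans[OF L2_integral_abs(2)[OF dp]] order_trans[OF L2_integral_abs(2)[OF dq]] pC qD)
    finally show ?thesis by (simp add: distrib_right)
  qed
  obtain k h c where k: "\<And>n. k n \<in> A" and kv: "\<And>n t. cmod (k n t) \<le> exp (- (\<Sum>i<n. v i t))"
    and h: "h \<in> borel_measurable m" and kh: "AE t in m. (\<lambda>n. k n t) \<longlonglongrightarrow> h t"
    and kc: "(\<lambda>n. \<integral>t. k n t \<partial>m) \<longlonglongrightarrow> c" and c: "c \<noteq> 0"
    by (rule exists_cutoff[OF vc v0 vI]) blast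
  have bound: "cmod (k n t * r n t) \<le> 1"
    if r0: "r 0 = (\<lambda>t. 0)" and rv: "\<And>n. cmod (r (Suc n) t - r n t) \<le> v n t" for n t and r :: "nat \<Rightarrow> 'a \<Rightarrow> complex"
  proof -
    have "cmod (r n t) \<le> (\<Sum>i<n. v i t)"
    proof (induction n)
      case 0 then show ?case by (simp add: r0)
    next
      case (Suc n)
      then show ?case using norm_triangle_ineq[of "r (Suc n) t - r n t" "r n t"] rv[of n] by simp
    qed
    then have "cmod (r n t) \<le> exp (\<Sum>i<n. v i t)"
      using exp_ge_add_one_self[of "\<Sum>i<n. v i t"] by linarith
    then have "cmod (k n t * r n t) \<le> exp (- (\<Sum>i<n. v i t)) * exp (\<Sum>i<n. v i t)"
      unfolding norm_mult by (intro mult_mono kv) auto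
    then show ?thesis by (simp flip: exp_add)
  qed
  have ap: "cmod (k n t * p n t) \<le> 1" for n t by (rule bound[of p, OF p0]) (simp add: v_def)
  have bq: "cmod (k n t * q n t) \<le> 1" for n t by (rule bound[of q, OF q0]) (simp add: v_def)
  have lim: "(\<lambda>n. \<integral>t. k n t * r n t \<partial>m) \<longlonglongrightarrow> c * (\<integral>t. z t \<partial>m)"
    if r: "\<And>n. r n \<in> A" and z: "z \<in> H2fun A m" and rz: "(\<lambda>n. L2norm m (\<lambda>t. r n t - z t)) \<longlonglongrightarrow> 0" for r z
  proof -
    have "(\<lambda>n. \<integral>t. r n t \<partial>m) \<longlonglongrightarrow> (\<integral>t. z t \<partial>m)"
      using r A_L2fun by (intro integral_tendsto H2fun_L2fun[OF z] rz) auto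
    then show ?thesis unfolding integral_mult[OF k r] by (intro tendsto_mult kc)
  qed
  note [measurable] = h H2fun_measurable[OF x] H2fun_measurable[OF y]
  show thesis
  proof (rule that[of "\<lambda>n t. k n t * p n t" "\<lambda>n t. k n t * q n t" "\<lambda>t. h t * x t" "\<lambda>t. h t * y t" c])
    show "AE t in m. (\<lambda>n. k n t * p n t) \<longlonglongrightarrow> h t * x t"
      using kh px by eventually_elim (rule tendsto_mult)
    show "AE t in m. (\<lambda>n. k n t * q n t) \<longlonglongrightarrow> h t * y t"
      using kh qy by eventually_elim (rule tendsto_mult)
  qed (auto intro!: A_mult k p q ap bq lim x y plim qlim c simp: mult.assoc mult.left_commute)
qed

text \<open>The combination to be thought of is \<open>h (x f - y g)\<close>, although
  \<open>x f\<close> and \<open>y g\<close> need not be square-integrable. Only bounded multipliers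
  occur, and \<phi> of the result is what multiplicativity would predict, with \<open>c\<close> in
  the role of \<phi>(h).\<close>

lemma H2fun_elimination:
  assumes x: "x \<in> H2fun A m" and y: "y \<in> H2fun A m"
  obtains a b \<alpha> \<beta> c where "\<And>n. a n \<in> A" "\<And>n. b n \<in> A" "c \<noteq> 0"
    "AE t in m. \<alpha> t * y t = \<beta> t * x t"
    "\<And>f g. f \<in> H2fun A m \<Longrightarrow> g \<in> H2fun A m \<Longrightarrow> (\<lambda>t. \<alpha> t * f t - \<beta> t * g t) \<in> H2fun A m"
    "\<And>f g. f \<in> H2fun A m \<Longrightarrow> g \<in> H2fun A m \<Longrightarrow>
      (\<lambda>n. L2norm m (\<lambda>t. (a n t * f t - b n t * g t) - (\<alpha> t * f t - \<beta> t * g t))) \<longlonglongrightarrow> 0"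
    "\<And>f g. f \<in> H2fun A m \<Longrightarrow> g \<in> H2fun A m \<Longrightarrow> (\<integral>t. \<alpha> t * f t - \<beta> t * g t \<partial>m)
      = c * ((\<integral>t. x t \<partial>m) * (\<integral>t. f t \<partial>m) - (\<integral>t. y t \<partial>m) * (\<integral>t. g t \<partial>m))"
proof -
  obtain a b \<alpha> \<beta> c where a: "\<And>n. a n \<in> A" and b: "\<And>n. b n \<in> A"
    and a1: "\<And>n t. cmod (a n t) \<le> 1" and b1: "\<And>n t. cmod (b n t) \<le> 1"
    and \<alpha>: "\<alpha> \<in> borel_measurable m" and \<beta>: "\<beta> \<in> borel_measurable m"
    and al: "AE t in m. (\<lambda>n. a n t) \<longlonglongrightarrow> \<alpha> t" and bl: "AE t in m. (\<lambda>n. b n t) \<longlonglongrightarrow> \<beta> t"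
    and eq: "AE t in m. \<alpha> t * y t = \<beta> t * x t"
    and ai: "(\<lambda>n. \<integral>t. a n t \<partial>m) \<longlonglongrightarrow> c * (\<integral>t. x t \<partial>m)"
    and bi: "(\<lambda>n. \<integral>t. b n t \<partial>m) \<longlonglongrightarrow> c * (\<integral>t. y t \<partial>m)" and c: "c \<noteq> 0"
    by (rule exists_common_multiplier[OF x y]) blast
  \<comment> \<open>A generic bounded limit \<gamma> of functions \<open>r n\<close> from
    \<open>A\<close>, to be instantiated with \<alpha> and with \<beta>.\<close>
  have main: "(\<lambda>t. \<gamma> t * f t) \<in> H2fun A m \<and> (\<lambda>n. L2norm m (\<lambda>t. r n t * f t - \<gamma> t * f t)) \<longlonglongrightarrow> 0
      \<and> (\<integral>t. \<gamma> t * f t \<partial>m) = d * (\<integral>t. f t \<partial>m)"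
    if f: "f \<in> H2fun A m" and r: "\<And>n. r n \<in> A" and r1: "\<And>n t. cmod (r n t) \<le> 1"
      and \<gamma>: "\<gamma> \<in> borel_measurable m" and rl: "AE t in m. (\<lambda>n. r n t) \<longlonglongrightarrow> \<gamma> t"
      and ri: "(\<lambda>n. \<integral>t. r n t \<partial>m) \<longlonglongrightarrow> d" for f r \<gamma> d
  proof -
    note lim = L2_bounded_convergence[OF A_measurable[OF r] r1 \<gamma> rl H2fun_L2fun[OF f]]
    note rf = A_mult_H2fun[OF r f]
    have 1: "(\<lambda>t. \<gamma> t * f t) \<in> H2fun A m" by (rule H2fun_limit[OF rf(1) lim])
    have "(\<lambda>n. \<integral>t. r n t * f t \<partial>m) \<longlonglongrightarrow> (\<integral>t. \<gamma> t * f t \<partial>m)"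
      by (rule integral_tendsto[OF H2fun_L2fun[OF rf(1)] lim])
    moreover have "(\<lambda>n. \<integral>t. r n t * f t \<partial>m) \<longlonglongrightarrow> d * (\<integral>t. f t \<partial>m)"
      unfolding rf(2) by (intro tendsto_mult_right ri)
    ultimately show ?thesis using 1 lim(2) LIMSEQ_unique by blast
  qed
  note ma = main[OF _ a a1 \<alpha> al ai] and mb = main[OF _ b b1 \<beta> bl bi]
  show thesis
  proof (rule that[OF a b c eq])
    fix f g assume f: "f \<in> H2fun A m" and g: "g \<in> H2fun A m"
    note 1 = ma[OF f] and 2 = mb[OF g]
    show "(\<lambda>t. \<alpha> t * f t - \<beta> t * g t) \<in> H2fun A m" using 1 2 by (intro H2fun_diff) auto
    show "(\<integral>t. \<alpha> t * f t - \<beta> t * g t \<partial>m)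
      = c * ((\<integral>t. x t \<partial>m) * (\<integral>t. f t \<partial>m) - (\<integral>t. y t \<partial>m) * (\<integral>t. g t \<partial>m))"
      using 1 2 L2_integral_abs(1)[OF H2fun_L2fun[OF conjunct1[OF 1]]]
        L2_integral_abs(1)[OF H2fun_L2fun[OF conjunct1[OF 2]]] by (simp add: right_diff_distrib mult.assoc)
    show "(\<lambda>n. L2norm m (\<lambda>t. (a n t * f t - b n t * g t) - (\<alpha> t * f t - \<beta> t * g t))) \<longlonglongrightarrow> 0"
    proof (rule Lim_null_comparison)
      have "L2norm m (\<lambda>t. (a n t * f t - b n t * g t) - (\<alpha> t * f t - \<beta> t * g t))
          \<le> L2norm m (\<lambda>t. a n t * f t - \<alpha> t * f t) + L2norm m (\<lambda>t. b n t * g t - \<beta> t * g t)" for n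
      proof -
        have e: "(\<lambda>t. (a n t * f t - b n t * g t) - (\<alpha> t * f t - \<beta> t * g t))
            = (\<lambda>t. (a n t * f t - \<alpha> t * f t) + (\<beta> t * g t - b n t * g t))" by auto
        have d1: "(\<lambda>t. a n t * f t - \<alpha> t * f t) \<in> L2fun m"
          using 1 A_mult_H2fun(1)[OF a f] by (intro L2fun_diff H2fun_L2fun) auto
        have d2: "(\<lambda>t. \<beta> t * g t - b n t * g t) \<in> L2fun m"
          using 2 A_mult_H2fun(1)[OF b g] by (intro L2fun_diff H2fun_L2fun) auto
        show ?thesis unfolding e L2norm_commute[of m "\<lambda>t. b n t * g t" "\<lambda>t. \<beta> t * g t"]
          by (rule L2norm_triangle[OF d1 d2])
      qed
      then show "\<forall>\<^sub>F n in sequentially. norm (L2norm m (\<lambda>t. (a n t * f t - b n t * g t) - (\<alpha> t * f t - \<beta> t * g t)))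
          \<le> L2norm m (\<lambda>t. a n t * f t - \<alpha> t * f t) + L2norm m (\<lambda>t. b n t * g t - \<beta> t * g t)"
        by (simp add: L2norm_nonneg)
      show "(\<lambda>n. L2norm m (\<lambda>t. a n t * f t - \<alpha> t * f t) + L2norm m (\<lambda>t. b n t * g t - \<beta> t * g t)) \<longlonglongrightarrow> 0"
        using tendsto_add[of "\<lambda>n. L2norm m (\<lambda>t. a n t * f t - \<alpha> t * f t)" 0 sequentially
          "\<lambda>n. L2norm m (\<lambda>t. b n t * g t - \<beta> t * g t)" 0] 1 2 by simp
    qed
  qed
qed

section \<open>Invariant subspaces of finite direct sums\<close>

text \<open>Bounded operators on H2 as they appear on functions. Linearity holds only up to null
  sets because an operator on classes returns a chosen representative.\<close>

definition L2op :: "(('a \<Rightarrow> complex) \<Rightarrow> 'a \<Rightarrow> complex) \<Rightarrow> bool" where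
  "L2op T \<longleftrightarrow> (\<forall>f\<in>H2fun A m. T f \<in> H2fun A m) \<and>
     (\<forall>f\<in>H2fun A m. \<forall>g\<in>H2fun A m. AE x in m. T (\<lambda>x. f x + g x) x = T f x + T g x) \<and>
     (\<forall>c. \<forall>f\<in>H2fun A m. AE x in m. T (\<lambda>x. c * f x) x = c * T f x) \<and>
     (\<exists>K. \<forall>f\<in>H2fun A m. L2norm m (T f) \<le> K * L2norm m f)"

lemma L2opD:
  assumes "L2op T"
  shows "f \<in> H2fun A m \<Longrightarrow> T f \<in> H2fun A m"
    "f \<in> H2fun A m \<Longrightarrow> g \<in> H2fun A m \<Longrightarrow> AE x in m. T (\<lambda>x. f x + g x) x = T f x + T g x"
    "f \<in> H2fun A m \<Longrightarrow> AE x in m. T (\<lambda>x. c * f x) x = c * T f x"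
  using assms unfolding L2op_def by blast+

lemma H2fun_zero: "(\<lambda>x. 0) \<in> H2fun A m"
  using subset_H2fun[OF A_L2fun] A_const by blast

lemma H2fun_sum: "finite F \<Longrightarrow> (\<And>i. i \<in> F \<Longrightarrow> X i \<in> H2fun A m) \<Longrightarrow> (\<lambda>x. \<Sum>i\<in>F. l i * X i x) \<in> H2fun A m"
proof (induction F rule: finite_induct)
  case empty
  show ?case by (simp add: H2fun_zero)
next
  case (insert i F)
  have "X i \<in> H2fun A m" "(\<lambda>x. \<Sum>i\<in>F. l i * X i x) \<in> H2fun A m" using insert by auto
  from H2fun_add[OF H2fun_scale[OF this(1), of "l i"] this(2)] show ?case using insert(1,2) by simp
qed

lemma L2op_Lipschitz:
  assumes T: "L2op T"
  shows "\<exists>K>0. \<forall>f\<in>H2fun A m. \<forall>g\<in>H2fun A m.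
      L2norm m (\<lambda>x. T f x - T g x) \<le> K * L2norm m (\<lambda>x. f x - g x)"
proof -
  obtain K where K: "\<And>f. f \<in> H2fun A m \<Longrightarrow> L2norm m (T f) \<le> K * L2norm m f"
    using T unfolding L2op_def by blast
  show ?thesis
  \<comment> \<open>A positive constant, so that tolerances can later be divided by it.\<close>
  proof (intro exI[of _ "max K 1"] conjI ballI)
    fix f g assume f: "f \<in> H2fun A m" and g: "g \<in> H2fun A m"
    have d: "(\<lambda>x. f x - g x) \<in> H2fun A m" by (rule H2fun_diff[OF f g])
    have "AE x in m. T f x = T g x + T (\<lambda>x. f x - g x) x" using L2opD(2)[OF T g d] by simp
    then have "L2norm m (\<lambda>x. T f x - T g x) = L2norm m (T (\<lambda>x. f x - g x))"
      using H2fun_measurable[OF L2opD(1)[OF T f]] H2fun_measurable[OF L2opD(1)[OF T g]]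
        H2fun_measurable[OF L2opD(1)[OF T d]]
      by (intro L2norm_cong_AE) (auto elim: eventually_mono)
    also have "\<dots> \<le> K * L2norm m (\<lambda>x. f x - g x)" by (rule K[OF d])
    also have "\<dots> \<le> max K 1 * L2norm m (\<lambda>x. f x - g x)" by (intro mult_right_mono L2norm_nonneg) simp
    finally show "L2norm m (\<lambda>x. T f x - T g x) \<le> max K 1 * L2norm m (\<lambda>x. f x - g x)" .
  qed simp
qed

lemma L2op_cong:
  assumes T: "L2op T" and f: "f \<in> H2fun A m" and g: "g \<in> H2fun A m" and eq: "AE x in m. f x = g x"
  shows "AE x in m. T f x = T g x"
proof -
  obtain K where K: "L2norm m (\<lambda>x. T f x - T g x) \<le> K * L2norm m (\<lambda>x. f x - g x)"
    using L2op_Lipschitz[OF T] f g by blast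
  have "L2norm m (\<lambda>x. f x - g x) = 0"
    using L2norm_eq_0[OF L2fun_diff[OF H2fun_L2fun[OF f] H2fun_L2fun[OF g]]] eq by simp
  then have "L2norm m (\<lambda>x. T f x - T g x) = 0"
    using K L2norm_nonneg[of m "\<lambda>x. T f x - T g x"] by simp
  then show ?thesis
    using L2norm_eq_0[OF H2fun_L2fun[OF H2fun_diff[OF L2opD(1)[OF T f] L2opD(1)[OF T g]]]] by simp
qed

lemma L2op_sum:
  assumes T: "L2op T" and F: "finite F" and X: "\<And>i. i \<in> F \<Longrightarrow> X i \<in> H2fun A m"
  shows "AE x in m. T (\<lambda>x. \<Sum>i\<in>F. l i * X i x) x = (\<Sum>i\<in>F. l i * T (X i) x)"
  using F X
proof (induction F rule: finite_induct)
  case empty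
  show ?case using L2opD(3)[OF T H2fun_zero, of 0] by simp
next
  case (insert i F)
  have Xi: "X i \<in> H2fun A m" and s: "(\<lambda>x. \<Sum>i\<in>F. l i * X i x) \<in> H2fun A m"
    using insert by (auto intro: H2fun_sum)
  have IH: "AE x in m. T (\<lambda>x. \<Sum>i\<in>F. l i * X i x) x = (\<Sum>i\<in>F. l i * T (X i) x)"
    using insert by blast
  have "AE x in m. T (\<lambda>x. l i * X i x + (\<Sum>i\<in>F. l i * X i x)) x
      = l i * T (X i) x + (\<Sum>i\<in>F. l i * T (X i) x)"
    using L2opD(2)[OF T H2fun_scale[OF Xi, of "l i"] s] L2opD(3)[OF T Xi, of "l i"] IH
    by eventually_elim simp
  then show ?case using insert(1,2) by simp
qed

end

text \<open>Transitivity in terms of sets of functions. The last premise of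
  \<open>transitive\<close> is closedness; it also makes \<open>S\<close> saturated under equality
  almost everywhere, so that \<open>S = H2fun A m\<close> is the right form of being the whole
  space.\<close>

locale transitive_ops = logmodular_prob m A for m :: "'a::t2_space measure" and A +
  fixes \<T> :: "(('a \<Rightarrow> complex) \<Rightarrow> 'a \<Rightarrow> complex) set"
  assumes L2op: "T \<in> \<T> \<Longrightarrow> L2op T"
    and mult_in: "a \<in> A \<Longrightarrow> \<exists>T\<in>\<T>. \<forall>f\<in>H2fun A m. AE x in m. T f x = a x * f x"
    and transitive: "\<lbrakk>S \<subseteq> H2fun A m; (\<lambda>x. 0) \<in> S;
        \<And>f g. f \<in> S \<Longrightarrow> g \<in> S \<Longrightarrow> (\<lambda>x. f x + g x) \<in> S; \<And>c f. f \<in> S \<Longrightarrow> (\<lambda>x. c * f x) \<in> S;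
        \<And>T f. T \<in> \<T> \<Longrightarrow> f \<in> S \<Longrightarrow> T f \<in> S;
        \<And>f. f \<in> H2fun A m \<Longrightarrow> (\<And>e. e > 0 \<Longrightarrow> \<exists>g\<in>S. L2norm m (\<lambda>x. f x - g x) < e) \<Longrightarrow> f \<in> S\<rbrakk>
      \<Longrightarrow> (\<forall>f\<in>S. AE x in m. f x = 0) \<or> S = H2fun A m"
begin

text \<open>Transitivity applied to the L2 closure \<open>C\<close> of \<open>S\<close>. Invariance
  is asked only up to null sets, which is what linear combinations of coordinates satisfy.\<close>

lemma invariant_null_or_dense:
  assumes S: "S \<subseteq> H2fun A m" "(\<lambda>x. 0) \<in> S"
    and add: "\<And>f g. f \<in> S \<Longrightarrow> g \<in> S \<Longrightarrow> (\<lambda>x. f x + g x) \<in> S"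
    and scale: "\<And>c f. f \<in> S \<Longrightarrow> (\<lambda>x. c * f x) \<in> S"
    and inv: "\<And>T f. T \<in> \<T> \<Longrightarrow> f \<in> S \<Longrightarrow> \<exists>g\<in>S. AE x in m. T f x = g x"
  shows "(\<forall>f\<in>S. AE x in m. f x = 0) \<or> (\<forall>f\<in>H2fun A m. \<forall>e>0. \<exists>g\<in>S. L2norm m (\<lambda>x. f x - g x) < e)"
proof -
  define C where "C = {f \<in> H2fun A m. \<forall>e>0. \<exists>g\<in>S. L2norm m (\<lambda>x. f x - g x) < e}"
  have CI: "f \<in> C" if "f \<in> H2fun A m" "\<And>e. e > 0 \<Longrightarrow> \<exists>g\<in>S. L2norm m (\<lambda>x. f x - g x) < e" for f
    using that by (simp add: C_def)
  have CD: "f \<in> H2fun A m" "e > 0 \<Longrightarrow> \<exists>g\<in>S. L2norm m (\<lambda>x. f x - g x) < e" if "f \<in> C" for f e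
    using that by (simp_all add: C_def)
  note L = H2fun_L2fun
  have SL: "g \<in> L2fun m" if "g \<in> S" for g using that S L by blast
  have SC: "S \<subseteq> C"
  proof
    fix g assume g: "g \<in> S"
    show "g \<in> C"
    proof (rule CI)
      show "g \<in> H2fun A m" using g S by blast
      show "\<exists>h\<in>S. L2norm m (\<lambda>x. g x - h x) < e" if "e > 0" for e
        by (rule bexI[OF _ g]) (simp add: that)
    qed
  qed
  have "(\<forall>f\<in>C. AE x in m. f x = 0) \<or> C = H2fun A m"
  proof (rule transitive)
    show "C \<subseteq> H2fun A m" using CD by blast
    show "(\<lambda>x. 0) \<in> C" using S SC by blast
    fix f g assume f: "f \<in> C" and g: "g \<in> C"
    show "(\<lambda>x. f x + g x) \<in> C"
    proof (rule CI)
      show "(\<lambda>x. f x + g x) \<in> H2fun A m" by (intro H2fun_add CD f g)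
      fix e :: real assume e: "e > 0"
      obtain a b where ab: "a \<in> S" "L2norm m (\<lambda>x. f x - a x) < e/2" "b \<in> S" "L2norm m (\<lambda>x. g x - b x) < e/2"
        using CD(2)[OF f half_gt_zero[OF e]] CD(2)[OF g half_gt_zero[OF e]] by blast
      have eq: "(\<lambda>x. f x + g x - (a x + b x)) = (\<lambda>x. (f x - a x) + (g x - b x))" by auto
      have "L2norm m (\<lambda>x. f x + g x - (a x + b x)) < e"
        unfolding eq
        using L2norm_triangle[OF L2fun_diff[OF L[OF CD(1)[OF f]] SL[OF ab(1)]] L2fun_diff[OF L[OF CD(1)[OF g]] SL[OF ab(3)]]] ab(2,4)
        by linarith
      then show "\<exists>h\<in>S. L2norm m (\<lambda>x. f x + g x - h x) < e"
        by (intro bexI[of _ "\<lambda>x. a x + b x"] add ab)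
    qed
  next
    fix c f assume f: "f \<in> C"
    show "(\<lambda>x. c * f x) \<in> C"
    proof (rule CI)
      show "(\<lambda>x. c * f x) \<in> H2fun A m" by (intro H2fun_scale CD f)
      fix e :: real assume e: "e > 0"
      have c0: "cmod c + 1 > 0" using norm_ge_zero[of c] by linarith
      obtain a where a: "a \<in> S" "L2norm m (\<lambda>x. f x - a x) < e / (cmod c + 1)"
        using CD(2)[OF f divide_pos_pos[OF e c0]] by blast
      have "L2norm m (\<lambda>x. c * f x - c * a x) = cmod c * L2norm m (\<lambda>x. f x - a x)"
        by (simp add: L2norm_scale flip: right_diff_distrib)
      also have "\<dots> \<le> (cmod c + 1) * L2norm m (\<lambda>x. f x - a x)" by (intro mult_right_mono L2norm_nonneg) simp
      also have "\<dots> < e" using a(2) c0 by (simp add: field_simps)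
      finally show "\<exists>h\<in>S. L2norm m (\<lambda>x. c * f x - h x) < e"
        by (intro bexI[of _ "\<lambda>x. c * a x"] scale a)
    qed
  next
    fix T f assume T: "T \<in> \<T>" and f: "f \<in> C"
    note op = L2op[OF T]
    show "T f \<in> C"
    proof (rule CI)
      show Tf: "T f \<in> H2fun A m" by (intro L2opD(1)[OF op] CD f)
      fix e :: real assume e: "e > 0"
      obtain K where K: "K > 0" "\<forall>f\<in>H2fun A m. \<forall>g\<in>H2fun A m.
          L2norm m (\<lambda>x. T f x - T g x) \<le> K * L2norm m (\<lambda>x. f x - g x)"
        using L2op_Lipschitz[OF op] by blast
      obtain a where a: "a \<in> S" "L2norm m (\<lambda>x. f x - a x) < e / K"
        using CD(2)[OF f divide_pos_pos[OF e K(1)]] by blast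
      have aH: "a \<in> H2fun A m" using a S by blast
      obtain g where g: "g \<in> S" "AE x in m. T a x = g x" using inv[OF T a(1)] by blast
      have gH: "g \<in> H2fun A m" using g S by blast
      have "L2norm m (\<lambda>x. T f x - g x) = L2norm m (\<lambda>x. T f x - T a x)"
        using g(2) H2fun_measurable[OF Tf] H2fun_measurable[OF gH] H2fun_measurable[OF L2opD(1)[OF op aH]]
        by (intro L2norm_cong_AE) (auto elim: eventually_mono)
      also have "\<dots> \<le> K * L2norm m (\<lambda>x. f x - a x)" using K(2) CD(1)[OF f] aH by blast
      also have "\<dots> < e" using a(2) K(1) by (simp add: field_simps)
      finally show "\<exists>h\<in>S. L2norm m (\<lambda>x. T f x - h x) < e" using g(1) by blast
    qed
  next
    fix f assume f: "f \<in> H2fun A m" and near: "\<And>e. e > 0 \<Longrightarrow> \<exists>g\<in>C. L2norm m (\<lambda>x. f x - g x) < e"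
    show "f \<in> C"
    proof (rule CI[OF f])
      fix e :: real assume e: "e > 0"
      obtain g where g: "g \<in> C" "L2norm m (\<lambda>x. f x - g x) < e/2" using near[OF half_gt_zero[OF e]] by blast
      obtain a where a: "a \<in> S" "L2norm m (\<lambda>x. g x - a x) < e/2" using CD(2)[OF g(1) half_gt_zero[OF e]] by blast
      have "L2norm m (\<lambda>x. f x - a x) < e"
        using L2norm_triangle_diff[OF L[OF f] L[OF CD(1)[OF g(1)]] SL[OF a(1)]] g(2) a(2) by linarith
      then show "\<exists>h\<in>S. L2norm m (\<lambda>x. f x - h x) < e" using a(1) by blast
    qed
  qed
  then show ?thesis using SC CD by blast
qed

lemma invariant_integral_zero:
  assumes S: "S \<subseteq> H2fun A m" "(\<lambda>x. 0) \<in> S"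
    and add: "\<And>f g. f \<in> S \<Longrightarrow> g \<in> S \<Longrightarrow> (\<lambda>x. f x + g x) \<in> S"
    and scale: "\<And>c f. f \<in> S \<Longrightarrow> (\<lambda>x. c * f x) \<in> S"
    and inv: "\<And>T f. T \<in> \<T> \<Longrightarrow> f \<in> S \<Longrightarrow> \<exists>g\<in>S. AE x in m. T f x = g x"
    and int0: "\<And>f. f \<in> S \<Longrightarrow> (\<integral>x. f x \<partial>m) = 0" and f: "f \<in> S"
  shows "AE x in m. f x = 0"
proof -
  have one: "(\<lambda>x. 1) \<in> H2fun A m" using subset_H2fun[OF A_L2fun] A_const by blast
  \<comment> \<open>The constant 1 has \<phi>-value 1, so its distance from every function with
    \<phi>-value 0 is at least 1.\<close>
  have far: "\<not> (L2norm m (\<lambda>x. 1 - g x) < 1)" if g: "g \<in> S" for g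
  proof -
    have gH: "g \<in> H2fun A m" using g S by blast
    have "(\<integral>x. 1 - g x \<partial>m) = 1"
      using L2_integral_abs(1)[OF H2fun_L2fun[OF gH]] int0[OF g] by (simp add: prob_space)
    then show ?thesis
      using L2_integral_abs(3)[OF H2fun_L2fun[OF H2fun_diff[OF one gH]]] by simp
  qed
  have "\<not> (\<forall>f\<in>H2fun A m. \<forall>e>0. \<exists>g\<in>S. L2norm m (\<lambda>x. f x - g x) < e)"
  proof
    assume "\<forall>f\<in>H2fun A m. \<forall>e>0. \<exists>g\<in>S. L2norm m (\<lambda>x. f x - g x) < e"
    from bspec[OF this one] have "\<exists>g\<in>S. L2norm m (\<lambda>x. 1 - g x) < 1" by simp
    then show False using far by blast
  qed
  moreover have "(\<forall>f\<in>S. AE x in m. f x = 0) \<or> (\<forall>f\<in>H2fun A m. \<forall>e>0. \<exists>g\<in>S. L2norm m (\<lambda>x. f x - g x) < e)"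
    by (rule invariant_null_or_dense) fact+
  ultimately show ?thesis using f by blast
qed

text \<open>For finite \<open>F\<close>, the closed invariant subspaces of a direct sum of copies of
  H2 indexed by \<open>F\<close>. Families are total functions on the index type; the last clause
  makes membership depend only on the classes of the coordinates in \<open>F\<close>.\<close>

definition invariant_closed :: "'i set \<Rightarrow> ('i \<Rightarrow> 'a \<Rightarrow> complex) set \<Rightarrow> bool" where
  "invariant_closed F M \<longleftrightarrow> (\<forall>X\<in>M. \<forall>i\<in>F. X i \<in> H2fun A m) \<and> (\<lambda>i x. 0) \<in> M \<and>
     (\<forall>X\<in>M. \<forall>Y\<in>M. (\<lambda>i x. X i x + Y i x) \<in> M) \<and> (\<forall>c. \<forall>X\<in>M. (\<lambda>i x. c * X i x) \<in> M) \<and>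
     (\<forall>T\<in>\<T>. \<forall>X\<in>M. (\<lambda>i. T (X i)) \<in> M) \<and>
     (\<forall>X. (\<forall>i\<in>F. X i \<in> H2fun A m) \<and> (\<forall>e>0. \<exists>Y\<in>M. \<forall>i\<in>F. L2norm m (\<lambda>x. X i x - Y i x) < e) \<longrightarrow> X \<in> M)"

lemma invariant_closedD:
  assumes "invariant_closed F M"
  shows "X \<in> M \<Longrightarrow> i \<in> F \<Longrightarrow> X i \<in> H2fun A m" "(\<lambda>i x. 0) \<in> M"
    "X \<in> M \<Longrightarrow> Y \<in> M \<Longrightarrow> (\<lambda>i x. X i x + Y i x) \<in> M" "X \<in> M \<Longrightarrow> (\<lambda>i x. c * X i x) \<in> M"
    "T \<in> \<T> \<Longrightarrow> X \<in> M \<Longrightarrow> (\<lambda>i. T (X i)) \<in> M"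
    "(\<And>i. i \<in> F \<Longrightarrow> X i \<in> H2fun A m) \<Longrightarrow>
      (\<And>e. e > 0 \<Longrightarrow> \<exists>Y\<in>M. \<forall>i\<in>F. L2norm m (\<lambda>x. X i x - Y i x) < e) \<Longrightarrow> X \<in> M"
  using assms unfolding invariant_closed_def by blast+

lemma invariant_closed_cong:
  assumes M: "invariant_closed F M" and X: "X \<in> M"
    and Y: "\<And>i. i \<in> F \<Longrightarrow> Y i \<in> H2fun A m" "\<And>i. i \<in> F \<Longrightarrow> AE x in m. Y i x = X i x"
  shows "Y \<in> M"
proof (rule invariant_closedD(6)[OF M Y(1)])
  fix e :: real assume "e > 0"
  moreover have "L2norm m (\<lambda>x. Y i x - X i x) = 0" if i: "i \<in> F" for i
    using L2norm_eq_0[OF L2fun_diff[OF H2fun_L2fun[OF Y(1)[OF i]] H2fun_L2fun[OF invariant_closedD(1)[OF M X i]]]]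
      Y(2)[OF i] by simp
  ultimately show "\<exists>Z\<in>M. \<forall>i\<in>F. L2norm m (\<lambda>x. Y i x - Z i x) < e"
    by (intro bexI[OF _ X]) simp
qed

text \<open>Lifts a relation between \<phi>-values to a relation between functions. The combinations
  form an invariant manifold because operators commute with constant coefficients, and \<phi>
  vanishes on it.\<close>

lemma invariant_closed_annihilator:
  assumes M: "invariant_closed F M" and F: "finite F"
    and int0: "\<And>X. X \<in> M \<Longrightarrow> (\<Sum>i\<in>F. l i * (\<integral>x. X i x \<partial>m)) = 0" and X: "X \<in> M"
  shows "AE x in m. (\<Sum>i\<in>F. l i * X i x) = 0"
proof (rule invariant_integral_zero[where S = "(\<lambda>X x. \<Sum>i\<in>F. l i * X i x) ` M"])
  note D = invariant_closedD[OF M]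
  show "(\<lambda>X x. \<Sum>i\<in>F. l i * X i x) ` M \<subseteq> H2fun A m" using D(1) F by (auto intro: H2fun_sum)
  show "(\<lambda>x. 0) \<in> (\<lambda>X x. \<Sum>i\<in>F. l i * X i x) ` M" using D(2) by (intro image_eqI[where x = "\<lambda>i x. 0"]) auto
  show "(\<lambda>x. \<Sum>i\<in>F. l i * X i x) \<in> (\<lambda>X x. \<Sum>i\<in>F. l i * X i x) ` M" using X by blast
next
  fix f g assume "f \<in> (\<lambda>X x. \<Sum>i\<in>F. l i * X i x) ` M" "g \<in> (\<lambda>X x. \<Sum>i\<in>F. l i * X i x) ` M"
  then obtain X Y where XY: "X \<in> M" "f = (\<lambda>x. \<Sum>i\<in>F. l i * X i x)" "Y \<in> M" "g = (\<lambda>x. \<Sum>i\<in>F. l i * Y i x)" by blast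
  show "(\<lambda>x. f x + g x) \<in> (\<lambda>X x. \<Sum>i\<in>F. l i * X i x) ` M"
    using invariant_closedD(3)[OF M XY(1,3)]
    by (intro image_eqI[where x = "\<lambda>i x. X i x + Y i x"]) (auto simp: XY sum.distrib distrib_left)
next
  fix c f assume "f \<in> (\<lambda>X x. \<Sum>i\<in>F. l i * X i x) ` M"
  then obtain X where XY: "X \<in> M" "f = (\<lambda>x. \<Sum>i\<in>F. l i * X i x)" by blast
  show "(\<lambda>x. c * f x) \<in> (\<lambda>X x. \<Sum>i\<in>F. l i * X i x) ` M"
    using invariant_closedD(4)[OF M XY(1)]
    by (intro image_eqI[where x = "\<lambda>i x. c * X i x"]) (auto simp: XY sum_distrib_left mult.left_commute)
next
  fix T f assume T: "T \<in> \<T>" and "f \<in> (\<lambda>X x. \<Sum>i\<in>F. l i * X i x) ` M"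
  then obtain X where XY: "X \<in> M" "f = (\<lambda>x. \<Sum>i\<in>F. l i * X i x)" by blast
  have ae: "AE x in m. T f x = (\<Sum>i\<in>F. l i * T (X i) x)"
    unfolding XY(2) using invariant_closedD(1)[OF M XY(1)] by (intro L2op_sum L2op T F)
  show "\<exists>g\<in>(\<lambda>X x. \<Sum>i\<in>F. l i * X i x) ` M. AE x in m. T f x = g x"
    by (rule bexI[OF _ imageI[OF invariant_closedD(5)[OF M T XY(1)]]]) (rule ae)
next
  fix f assume "f \<in> (\<lambda>X x. \<Sum>i\<in>F. l i * X i x) ` M"
  then obtain X where XY: "X \<in> M" "f = (\<lambda>x. \<Sum>i\<in>F. l i * X i x)" by blast
  have "(\<integral>x. f x \<partial>m) = (\<Sum>i\<in>F. l i * (\<integral>x. X i x \<partial>m))"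
    unfolding XY(2) using L2_integral_abs(1)[OF H2fun_L2fun[OF invariant_closedD(1)[OF M XY(1)]]]
    by (subst Bochner_Integration.integral_sum) auto
  then show "(\<integral>x. f x \<partial>m) = 0" using int0[OF XY(1)] by simp
qed

lemma invariant_closed_mult:
  assumes M: "invariant_closed F M" and X: "X \<in> M" and a: "a \<in> A"
  shows "(\<lambda>i x. a x * X i x) \<in> M"
proof -
  obtain T where T: "T \<in> \<T>" and Ta: "\<forall>f\<in>H2fun A m. AE x in m. T f x = a x * f x"
    using mult_in[OF a] by blast
  note XH = invariant_closedD(1)[OF M X]
  show ?thesis
  proof (rule invariant_closed_cong[OF M invariant_closedD(5)[OF M T X]])
    fix i assume i: "i \<in> F"
    show "(\<lambda>x. a x * X i x) \<in> H2fun A m" by (rule A_mult_H2fun(1)[OF a XH[OF i]])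
    have "AE x in m. T (X i) x = a x * X i x" using Ta XH[OF i] by blast
    then show "AE x in m. a x * X i x = T (X i) x" by (rule eventually_mono) simp
  qed
qed

lemma invariant_closed_diff:
  assumes M: "invariant_closed F M" and X: "X \<in> M" and Y: "Y \<in> M"
  shows "(\<lambda>i x. X i x - Y i x) \<in> M"
  using invariant_closedD(3)[OF M X invariant_closedD(4)[OF M Y, of "- 1"]] by simp

text \<open>The multipliers are chosen for the \<open>j\<close>-th coordinates but act on all of
  them. \<open>Z\<close> is the limit of \<open>a n Y - b n X\<close>, which belong to
  \<open>M\<close>; as \<open>F\<close> is finite, one \<open>n\<close> is good for every
  coordinate.\<close>

lemma invariant_closed_elimination:
  assumes M: "invariant_closed F M" and F: "finite F" and j: "j \<in> F" and X: "X \<in> M" and Y: "Y \<in> M"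
  obtains Z c where "Z \<in> M" "AE x in m. Z j x = 0" "c \<noteq> 0"
    "\<And>i. i \<in> F \<Longrightarrow> (\<integral>x. Z i x \<partial>m)
      = c * ((\<integral>x. X j x \<partial>m) * (\<integral>x. Y i x \<partial>m) - (\<integral>x. Y j x \<partial>m) * (\<integral>x. X i x \<partial>m))"
proof -
  note XH = invariant_closedD(1)[OF M X] and YH = invariant_closedD(1)[OF M Y]
  obtain a b \<alpha> \<beta> c where a: "\<And>n. a n \<in> A" and b: "\<And>n. b n \<in> A" and c: "c \<noteq> 0"
    and eq: "AE t in m. \<alpha> t * Y j t = \<beta> t * X j t"
    and ZH: "\<And>f g. f \<in> H2fun A m \<Longrightarrow> g \<in> H2fun A m \<Longrightarrow> (\<lambda>t. \<alpha> t * f t - \<beta> t * g t) \<in> H2fun A m"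
    and lim: "\<And>f g. f \<in> H2fun A m \<Longrightarrow> g \<in> H2fun A m \<Longrightarrow>
      (\<lambda>n. L2norm m (\<lambda>t. (a n t * f t - b n t * g t) - (\<alpha> t * f t - \<beta> t * g t))) \<longlonglongrightarrow> 0"
    and int: "\<And>f g. f \<in> H2fun A m \<Longrightarrow> g \<in> H2fun A m \<Longrightarrow> (\<integral>t. \<alpha> t * f t - \<beta> t * g t \<partial>m)
      = c * ((\<integral>t. X j t \<partial>m) * (\<integral>t. f t \<partial>m) - (\<integral>t. Y j t \<partial>m) * (\<integral>t. g t \<partial>m))"
    by (rule H2fun_elimination[OF XH[OF j] YH[OF j]]) blast
  define Z where "Z i t = \<alpha> t * Y i t - \<beta> t * X i t" for i t
  have "Z \<in> M"
  proof (rule invariant_closedD(6)[OF M])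
    show "Z i \<in> H2fun A m" if "i \<in> F" for i
      unfolding Z_def[abs_def] by (rule ZH[OF YH[OF that] XH[OF that]])
    fix e :: real assume e: "e > 0"
    have "\<forall>\<^sub>F n in sequentially. \<forall>i\<in>F. L2norm m (\<lambda>t. (a n t * Y i t - b n t * X i t) - Z i t) < e"
    proof (rule eventually_ball_finite[OF F], rule ballI)
      fix i assume i: "i \<in> F"
      show "\<forall>\<^sub>F n in sequentially. L2norm m (\<lambda>t. (a n t * Y i t - b n t * X i t) - Z i t) < e"
        unfolding Z_def by (rule order_tendstoD(2)[OF lim[OF YH[OF i] XH[OF i]] e])
    qed
    then obtain n where n: "\<forall>i\<in>F. L2norm m (\<lambda>t. (a n t * Y i t - b n t * X i t) - Z i t) < e"
      using eventually_happens'[OF sequentially_bot] by blast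
    show "\<exists>W\<in>M. \<forall>i\<in>F. L2norm m (\<lambda>t. Z i t - W i t) < e"
    proof (rule bexI)
      show "(\<lambda>i t. a n t * Y i t - b n t * X i t) \<in> M"
        by (intro invariant_closed_diff[OF M] invariant_closed_mult[OF M] X Y a b)
      show "\<forall>i\<in>F. L2norm m (\<lambda>t. Z i t - (a n t * Y i t - b n t * X i t)) < e"
      proof
        fix i assume "i \<in> F"
        then show "L2norm m (\<lambda>t. Z i t - (a n t * Y i t - b n t * X i t)) < e"
          using n L2norm_commute[of m "Z i" "\<lambda>t. a n t * Y i t - b n t * X i t"] by simp
      qed
    qed
  qed
  moreover have "AE x in m. Z j x = 0" using eq by eventually_elim (simp add: Z_def)
  moreover have "(\<integral>x. Z i x \<partial>m)
      = c * ((\<integral>x. X j x \<partial>m) * (\<integral>x. Y i x \<partial>m) - (\<integral>x. Y j x \<partial>m) * (\<integral>x. X i x \<partial>m))" if "i \<in> F" for i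
    unfolding Z_def by (rule int[OF YH[OF that] XH[OF that]])
  ultimately show thesis using that c by blast
qed

text \<open>The elements of \<open>M\<close> with zero \<open>j\<close>-th coordinate, seen as
  families over \<open>F\<close>. The coordinate is overwritten by 0 because over \<open>F\<close>
  the value at \<open>j\<close> has to be arbitrary.\<close>

lemma invariant_closed_section:
  assumes M: "invariant_closed (insert j F) M" and j: "j \<notin> F"
  shows "invariant_closed F {X. (\<forall>i\<in>F. X i \<in> H2fun A m) \<and> X(j := \<lambda>x. 0) \<in> M}" (is "invariant_closed F ?N")
  unfolding invariant_closed_def
proof (intro conjI ballI allI impI)
  note D = invariant_closedD[OF M]
  have NI: "X \<in> ?N" if "\<And>i. i \<in> F \<Longrightarrow> X i \<in> H2fun A m" "Y \<in> M" "X(j := \<lambda>x. 0) = Y" for X Y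
    using that by simp
  have NH: "X i \<in> H2fun A m" if "X \<in> ?N" "i \<in> F" for X i using that by simp
  have NM: "X(j := \<lambda>x. 0) \<in> M" if "X \<in> ?N" for X using that by simp
  show "X i \<in> H2fun A m" if "X \<in> ?N" "i \<in> F" for X i using that by simp
  show "(\<lambda>i x. 0) \<in> ?N"
    by (rule NI[OF H2fun_zero D(2)]) auto
  show "(\<lambda>i x. X i x + Y i x) \<in> ?N" if X: "X \<in> ?N" and Y: "Y \<in> ?N" for X Y
    by (rule NI[OF H2fun_add[OF NH[OF X] NH[OF Y]] D(3)[OF NM[OF X] NM[OF Y]]]) auto
  show "(\<lambda>i x. c * X i x) \<in> ?N" if X: "X \<in> ?N" for X c
    by (rule NI[OF H2fun_scale[OF NH[OF X]] D(4)[OF NM[OF X], of c]]) auto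
  show "(\<lambda>i. T (X i)) \<in> ?N" if T: "T \<in> \<T>" and X: "X \<in> ?N" for T X
  proof (rule NI[OF L2opD(1)[OF L2op[OF T] NH[OF X]] _ refl])
    show "(\<lambda>i. T (X i))(j := \<lambda>x. 0) \<in> M"
    proof (rule invariant_closed_cong[OF M D(5)[OF T NM[OF X]]])
      fix i assume i: "i \<in> insert j F"
      show "((\<lambda>i. T (X i))(j := \<lambda>x. 0)) i \<in> H2fun A m"
        using i L2opD(1)[OF L2op[OF T] NH[OF X]] H2fun_zero by (auto simp: fun_upd_def)
      have "AE x in m. T (\<lambda>x. 0) x = 0" using L2opD(3)[OF L2op[OF T] H2fun_zero, of 0] by simp
      then show "AE x in m. ((\<lambda>i. T (X i))(j := \<lambda>x. 0)) i x = T ((X(j := \<lambda>x. 0)) i) x"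
        by (cases "i = j") auto
    qed
  qed
  fix X assume *: "(\<forall>i\<in>F. X i \<in> H2fun A m) \<and> (\<forall>e>0. \<exists>Y\<in>?N. \<forall>i\<in>F. L2norm m (\<lambda>x. X i x - Y i x) < e)"
  have "X(j := \<lambda>x. 0) \<in> M"
  proof (rule D(6))
    show "(X(j := \<lambda>x. 0)) i \<in> H2fun A m" if "i \<in> insert j F" for i
      using that conjunct1[OF *] H2fun_zero by (auto simp: fun_upd_def)
    fix e :: real assume e: "e > 0"
    then obtain Y where Y: "Y \<in> ?N" "\<forall>i\<in>F. L2norm m (\<lambda>x. X i x - Y i x) < e" using * by blast
    have "\<forall>i\<in>insert j F. L2norm m (\<lambda>x. (X(j := \<lambda>x. 0)) i x - (Y(j := \<lambda>x. 0)) i x) < e"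
      using Y(2) e j by auto
    then show "\<exists>Y\<in>M. \<forall>i\<in>insert j F. L2norm m (\<lambda>x. (X(j := \<lambda>x. 0)) i x - Y i x) < e"
      using NM[OF Y(1)] by (rule bexI)
  qed
  then show "X \<in> ?N" using conjunct1[OF *] by simp
qed

text \<open>Induction through the section \<open>N\<close> of \<open>M\<close> at \<open>j\<close>.
  If \<open>N\<close> is everything, only the \<open>j\<close>-th coordinates of \<open>M\<close>
  matter; if \<open>N\<close> satisfies a relation, elimination extends it to \<open>M\<close> by
  one more coefficient.\<close>

lemma invariant_closed_full_or_annihilated:
  assumes "finite F" and "invariant_closed F M"
  shows "(\<forall>X. (\<forall>i\<in>F. X i \<in> H2fun A m) \<longrightarrow> X \<in> M) \<or>
    (\<exists>l. (\<exists>i\<in>F. l i \<noteq> 0) \<and> (\<forall>X\<in>M. AE x in m. (\<Sum>i\<in>F. l i * X i x) = 0))"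
  using assms
proof (induction F arbitrary: M rule: finite_induct)
  case empty
  have "X \<in> M" for X
    by (rule invariant_closedD(6)[OF empty]) (use invariant_closedD(2)[OF empty] in auto)
  then show ?case by blast
next
  case (insert j F)
  note F = insert(1) and j = insert(2) and IH = insert.IH and M = insert.prems
  note D = invariant_closedD[OF M]
  have fin: "finite (insert j F)" using F by simp
  define N where "N = {X. (\<forall>i\<in>F. X i \<in> H2fun A m) \<and> X(j := \<lambda>x. 0) \<in> M}"
  have sum_j: "(\<Sum>i\<in>insert j F. (if i = j then 1 else 0) * z i) = z j" for z :: "_ \<Rightarrow> complex"
    using F j by (simp add: sum.insert) (intro sum.neutral, auto)
  have N: "invariant_closed F N" unfolding N_def by (rule invariant_closed_section[OF M j])
  from IH[OF N] show ?case
  proof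
    assume full: "\<forall>X. (\<forall>i\<in>F. X i \<in> H2fun A m) \<longrightarrow> X \<in> N"
    have "(\<forall>f\<in>(\<lambda>X. X j) ` M. AE x in m. f x = 0) \<or>
        (\<forall>f\<in>H2fun A m. \<forall>e>0. \<exists>g\<in>(\<lambda>X. X j) ` M. L2norm m (\<lambda>x. f x - g x) < e)"
    proof (rule invariant_null_or_dense)
      show "(\<lambda>X. X j) ` M \<subseteq> H2fun A m" using D(1) by blast
      show "(\<lambda>x. 0) \<in> (\<lambda>X. X j) ` M" using D(2) by (rule rev_image_eqI) simp
    next
      fix f g assume "f \<in> (\<lambda>X. X j) ` M" "g \<in> (\<lambda>X. X j) ` M"
      then obtain X Y where "X \<in> M" "f = X j" "Y \<in> M" "g = Y j" by blast
      then show "(\<lambda>x. f x + g x) \<in> (\<lambda>X. X j) ` M" by (intro rev_image_eqI[OF D(3)[of X Y]]) auto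
    next
      fix c f assume "f \<in> (\<lambda>X. X j) ` M"
      then obtain X where "X \<in> M" "f = X j" by blast
      then show "(\<lambda>x. c * f x) \<in> (\<lambda>X. X j) ` M" by (intro rev_image_eqI[OF D(4)[of X c]]) auto
    next
      fix T f assume T: "T \<in> \<T>" and "f \<in> (\<lambda>X. X j) ` M"
      then obtain X where X: "X \<in> M" "f = X j" by blast
      show "\<exists>g\<in>(\<lambda>X. X j) ` M. AE x in m. T f x = g x"
        by (rule bexI[OF _ imageI[OF D(5)[OF T X(1)]]]) (simp add: X(2))
    qed
    then show ?case
    proof
      assume null: "\<forall>f\<in>(\<lambda>X. X j) ` M. AE x in m. f x = 0"
      have "\<forall>X\<in>M. AE x in m. (\<Sum>i\<in>insert j F. (if i = j then 1 else 0) * X i x) = 0"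
        unfolding sum_j using null by blast
      then show ?case by (intro disjI2 exI[of _ "\<lambda>i. if i = j then 1 else 0"]) auto
    next
      assume dense: "\<forall>f\<in>H2fun A m. \<forall>e>0. \<exists>g\<in>(\<lambda>X. X j) ` M. L2norm m (\<lambda>x. f x - g x) < e"
      have "X \<in> M" if X: "\<forall>i\<in>insert j F. X i \<in> H2fun A m" for X
      proof (rule D(6))
        show "X i \<in> H2fun A m" if "i \<in> insert j F" for i using X that by blast
        fix e :: real assume e: "e > 0"
        have Xj: "X j \<in> H2fun A m" using X by simp
        obtain Y where Y: "Y \<in> M" "L2norm m (\<lambda>x. X j x - Y j x) < e"
          using bspec[OF dense Xj] e by blast
        \<comment> \<open>Only the \<open>j\<close>-th coordinate is approximated. The others are
          corrected exactly, the differences being the coordinates of an element of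
          \<open>N\<close>.\<close>
        have "\<forall>i\<in>F. (\<lambda>x. X i x - Y i x) \<in> H2fun A m"
          using X D(1)[OF Y(1)] by (auto intro: H2fun_diff)
        then have "(\<lambda>i x. X i x - Y i x) \<in> N" using full by simp
        then have "(\<lambda>i x. X i x - Y i x)(j := \<lambda>x. 0) \<in> M" by (simp add: N_def)
        from D(3)[OF Y(1) this]
        have W: "(\<lambda>i x. Y i x + ((\<lambda>i x. X i x - Y i x)(j := \<lambda>x. 0)) i x) \<in> M" .
        have "\<forall>i\<in>insert j F. L2norm m (\<lambda>x. X i x - (Y i x + ((\<lambda>i x. X i x - Y i x)(j := \<lambda>x. 0)) i x)) < e"
          using Y(2) e by auto
        then show "\<exists>Y\<in>M. \<forall>i\<in>insert j F. L2norm m (\<lambda>x. X i x - Y i x) < e" using W by (rule bexI)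
      qed
      then show ?case by blast
    qed
  next
    assume "\<exists>l. (\<exists>i\<in>F. l i \<noteq> 0) \<and> (\<forall>X\<in>N. AE x in m. (\<Sum>i\<in>F. l i * X i x) = 0)"
    then obtain l i1 where l: "i1 \<in> F" "l i1 \<noteq> 0" and kill: "\<forall>X\<in>N. AE x in m. (\<Sum>i\<in>F. l i * X i x) = 0"
      by blast
    define L where "L X = (\<Sum>i\<in>F. l i * (\<integral>x. X i x \<partial>m))" for X :: "_ \<Rightarrow> 'a \<Rightarrow> complex"
    \<comment> \<open>The eliminated \<open>Z\<close> lies in \<open>N\<close>, so
      \<open>L Z = 0\<close>; by the formula for its integrals, \<open>L Z\<close> is
      \<open>c\<close> times the difference of the two sides.\<close>
    have cross: "(\<integral>x. X j x \<partial>m) * L Y = (\<integral>x. Y j x \<partial>m) * L X" if X: "X \<in> M" and Y: "Y \<in> M" for X Y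
    proof -
      obtain Z c where Z: "Z \<in> M" "AE x in m. Z j x = 0" and c: "c \<noteq> 0"
        and int: "\<And>i. i \<in> insert j F \<Longrightarrow> (\<integral>x. Z i x \<partial>m)
          = c * ((\<integral>x. X j x \<partial>m) * (\<integral>x. Y i x \<partial>m) - (\<integral>x. Y j x \<partial>m) * (\<integral>x. X i x \<partial>m))"
        by (rule invariant_closed_elimination[OF M fin insertI1 X Y]) blast
      have "Z(j := \<lambda>x. 0) \<in> M"
      proof (rule invariant_closed_cong[OF M Z(1)])
        fix i assume "i \<in> insert j F"
        then show "(Z(j := \<lambda>x. 0)) i \<in> H2fun A m" using D(1)[OF Z(1)] H2fun_zero by (auto simp: fun_upd_def)
        show "AE x in m. (Z(j := \<lambda>x. 0)) i x = Z i x" using Z(2) by (cases "i = j") auto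
      qed
      then have ZN: "Z \<in> N" using D(1)[OF Z(1)] by (simp add: N_def)
      have ae: "AE x in m. (\<Sum>i\<in>F. l i * Z i x) = 0" using kill ZN by blast
      have Zi: "integrable m (\<lambda>x. l i * Z i x)" if "i \<in> F" for i
        using L2_integral_abs(1)[OF H2fun_L2fun[OF D(1)[OF Z(1)]]] that by auto
      have "(\<Sum>i\<in>F. l i * (\<integral>x. Z i x \<partial>m)) = (\<integral>x. (\<Sum>i\<in>F. l i * Z i x) \<partial>m)"
        using Zi by (subst Bochner_Integration.integral_sum) auto
      also have "\<dots> = (\<integral>x. 0 \<partial>m)"
        using ae Zi by (intro integral_cong_AE borel_measurable_sum borel_measurable_integrable) auto
      finally have "0 = (\<Sum>i\<in>F. l i * (\<integral>x. Z i x \<partial>m))" by simp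
      also have "\<dots> = (\<Sum>i\<in>F. c * ((\<integral>x. X j x \<partial>m) * (l i * (\<integral>x. Y i x \<partial>m)) - (\<integral>x. Y j x \<partial>m) * (l i * (\<integral>x. X i x \<partial>m))))"
        by (intro sum.cong refl) (simp add: int algebra_simps)
      also have "\<dots> = c * ((\<integral>x. X j x \<partial>m) * L Y - (\<integral>x. Y j x \<partial>m) * L X)"
        by (simp add: L_def sum_distrib_left sum_subtractf right_diff_distrib)
      finally show ?thesis using c by simp
    qed
    \<comment> \<open>By \<open>cross\<close>, \<open>L\<close> and \<phi> of the
      \<open>j\<close>-th coordinate are proportional on \<open>M\<close>. If the latter vanishes,
      \<open>j\<close> alone carries the relation; otherwise \<open>L\<close> is \<tau> times it,
      and - \<tau> is the coefficient at \<open>j\<close>. The old coefficient at \<open>i1\<close>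
      keeps the relation nontrivial.\<close>
    have "\<exists>l'. (\<exists>i\<in>insert j F. l' i \<noteq> 0) \<and> (\<forall>X\<in>M. (\<Sum>i\<in>insert j F. l' i * (\<integral>x. X i x \<partial>m)) = 0)"
    proof (cases "\<forall>X\<in>M. (\<integral>x. X j x \<partial>m) = 0")
      case True
      then show ?thesis
        by (intro exI[of _ "\<lambda>i. if i = j then 1 else 0"]) (simp only: sum_j, auto)
    next
      case False
      then obtain X where X: "X \<in> M" "(\<integral>x. X j x \<partial>m) \<noteq> 0" by blast
      define \<tau> where "\<tau> = L X / (\<integral>x. X j x \<partial>m)"
      have "(\<Sum>i\<in>insert j F. (l(j := - \<tau>)) i * (\<integral>x. Y i x \<partial>m)) = 0" if "Y \<in> M" for Y
      proof -
        have "(\<Sum>i\<in>F. (l(j := - \<tau>)) i * (\<integral>x. Y i x \<partial>m)) = L Y"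
          unfolding L_def using j by (intro sum.cong) auto
        then show ?thesis using F j cross[OF X(1) that] X(2)
          by (simp add: \<tau>_def field_simps)
      qed
      moreover have "(l(j := - \<tau>)) i1 \<noteq> 0" using l j by auto
      ultimately show ?thesis using l(1) by (intro exI[of _ "l(j := - \<tau>)"]) blast
    qed
    then obtain l' i' where l': "i' \<in> insert j F" "l' i' \<noteq> 0"
      and z: "\<And>X. X \<in> M \<Longrightarrow> (\<Sum>i\<in>insert j F. l' i * (\<integral>x. X i x \<partial>m)) = 0" by blast
    have "\<forall>X\<in>M. AE x in m. (\<Sum>i\<in>insert j F. l' i * X i x) = 0"
      using invariant_closed_annihilator[OF M fin z] by blast
    then show ?case using l' by blast
  qed
qed

end

section \<open>Bounded operators on \<open>H\<^sup>2\<close>\<close>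

lemma hadd_ae_class:
  assumes "f \<in> borel_measurable m" "g \<in> borel_measurable m"
  shows "hadd (L2sub m C) (ae_class m f) (ae_class m g) = ae_class m (\<lambda>x. f x + g x)"
proof -
  note r = rep_ae_class[OF assms(1)] rep_ae_class[OF assms(2)]
  have "AE x in m. rep (ae_class m f) x + rep (ae_class m g) x = f x + g x"
    using r(2,4) by eventually_elim simp
  then show ?thesis
    unfolding L2sub_sel by (intro ae_class_cong borel_measurable_add assms r)
qed

lemma hscale_ae_class:
  assumes "f \<in> borel_measurable m"
  shows "hscale (L2sub m C) c (ae_class m f) = ae_class m (\<lambda>x. c * f x)"
proof -
  note r = rep_ae_class[OF assms]
  have "AE x in m. c * rep (ae_class m f) x = c * f x"
    using r(2) by eventually_elim simp
  then show ?thesis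
    unfolding L2sub_sel by (intro ae_class_cong borel_measurable_times borel_measurable_const assms r)
qed

context logmodular_prob
begin

definition Hcar :: "('a \<Rightarrow> complex) set set" where
  "Hcar = ae_class m ` H2fun A m"

lemma H2_L2sub: "H2 A m = L2sub m Hcar"
  unfolding Hcar_def by (rule H2_eq_L2sub[OF A_L2fun])

lemma Hcar_L2: "Hcar \<subseteq> ae_class m ` L2fun m"
  unfolding Hcar_def by (intro image_mono) (auto simp: H2fun_L2fun)

lemma ae_class_Hcar: "f \<in> H2fun A m \<Longrightarrow> ae_class m f \<in> Hcar"
  by (simp add: Hcar_def)

lemma rep_Hcar:
  assumes "u \<in> Hcar"
  shows "rep u \<in> H2fun A m" "ae_class m (rep u) = u" "rep u \<in> borel_measurable m"
proof -
  show "rep u \<in> H2fun A m" "ae_class m (rep u) = u"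
    using rep_H2fun[OF assms[unfolded Hcar_def] A_borel] .
  then show "rep u \<in> borel_measurable m" by (intro H2fun_measurable)
qed

definition lift :: "(('a \<Rightarrow> complex) set \<Rightarrow> ('a \<Rightarrow> complex) set) \<Rightarrow> ('a \<Rightarrow> complex) \<Rightarrow> 'a \<Rightarrow> complex" where
  "lift T f = rep (T (ae_class m f))"

lemma bounded_opsD:
  assumes "T \<in> bounded_ops (H2 A m)"
  shows "u \<in> Hcar \<Longrightarrow> T u \<in> Hcar"
    "u \<in> Hcar \<Longrightarrow> v \<in> Hcar \<Longrightarrow> T (hadd (L2sub m Hcar) u v) = hadd (L2sub m Hcar) (T u) (T v)"
    "u \<in> Hcar \<Longrightarrow> T (hscale (L2sub m Hcar) c u) = hscale (L2sub m Hcar) c (T u)"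
    "\<exists>K. \<forall>u\<in>Hcar. L2norm m (rep (T u)) \<le> K * L2norm m (rep u)"
  using assms unfolding bounded_ops_def H2_L2sub by (auto simp del: L2sub_sel(3,4) simp: hnorm_L2sub)

lemma L2op_lift:
  assumes T: "T \<in> bounded_ops (H2 A m)"
  shows "L2op (lift T)"
  unfolding L2op_def
proof (intro conjI ballI allI)
  note D = bounded_opsD[OF T]
  have TH: "T (ae_class m f) \<in> Hcar" if "f \<in> H2fun A m" for f by (rule D(1)[OF ae_class_Hcar[OF that]])
  show "lift T f \<in> H2fun A m" if "f \<in> H2fun A m" for f
    unfolding lift_def by (rule rep_Hcar(1)[OF TH[OF that]])
  show "AE x in m. lift T (\<lambda>x. f x + g x) x = lift T f x + lift T g x"
    if f: "f \<in> H2fun A m" and g: "g \<in> H2fun A m" for f g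
  proof -
    have "T (ae_class m (\<lambda>x. f x + g x)) = T (hadd (L2sub m Hcar) (ae_class m f) (ae_class m g))"
      by (simp only: hadd_ae_class H2fun_measurable[OF f] H2fun_measurable[OF g])
    also have "\<dots> = ae_class m (\<lambda>x. lift T f x + lift T g x)"
      by (simp only: D(2)[OF ae_class_Hcar[OF f] ae_class_Hcar[OF g]]) (simp add: lift_def)
    finally have *: "T (ae_class m (\<lambda>x. f x + g x)) = ae_class m (\<lambda>x. lift T f x + lift T g x)" .
    show ?thesis unfolding lift_def[of T "\<lambda>x. f x + g x"] *
      unfolding lift_def by (intro rep_ae_class borel_measurable_add rep_Hcar(3) TH f g)
  qed
  show "AE x in m. lift T (\<lambda>x. c * f x) x = c * lift T f x" if f: "f \<in> H2fun A m" for c f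
  proof -
    have "T (ae_class m (\<lambda>x. c * f x)) = T (hscale (L2sub m Hcar) c (ae_class m f))"
      by (simp only: hscale_ae_class H2fun_measurable[OF f])
    also have "\<dots> = ae_class m (\<lambda>x. c * lift T f x)"
      by (simp only: D(3)[OF ae_class_Hcar[OF f]]) (simp add: lift_def)
    finally have *: "T (ae_class m (\<lambda>x. c * f x)) = ae_class m (\<lambda>x. c * lift T f x)" .
    show ?thesis unfolding lift_def[of T "\<lambda>x. c * f x"] *
      unfolding lift_def by (intro rep_ae_class borel_measurable_times borel_measurable_const rep_Hcar(3) TH f)
  qed
  obtain K where K: "\<forall>u\<in>Hcar. L2norm m (rep (T u)) \<le> K * L2norm m (rep u)" using D(4) by blast
  have "L2norm m (lift T f) \<le> K * L2norm m f" if f: "f \<in> H2fun A m" for f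
    using bspec[OF K ae_class_Hcar[OF f]] L2norm_rep[OF H2fun_measurable[OF f]] by (simp add: lift_def)
  then show "\<exists>K. \<forall>f\<in>H2fun A m. L2norm m (lift T f) \<le> K * L2norm m f" by blast
qed

section \<open>Multiplication by elements of \<open>Hinf\<close>\<close>

lemma topspace_weak_star: "topspace (weak_star_topology m) = Linf m"
  unfolding weak_star_topology_def topspace_pullback_topology by auto

lemma Hinf_Linf: "h \<in> Hinf A m \<Longrightarrow> h \<in> Linf m"
  using closure_of_subset_topspace[of "weak_star_topology m" A] by (auto simp: Hinf_def topspace_weak_star)

lemma A_subset_Hinf: "A \<subseteq> Hinf A m"
proof -
  have "a \<in> Linf m" if a: "a \<in> A" for a
  proof -
    obtain C where "\<And>x. cmod (a x) \<le> C" using continuous_bounded[OF A_continuous[OF a]] by blast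
    then show ?thesis using A_measurable[OF a] by (auto simp: Linf_def)
  qed
  then show ?thesis unfolding Hinf_def by (intro closure_of_subset) (auto simp: topspace_weak_star)
qed

lemma Linf_mult_L2:
  assumes h: "h \<in> Linf m"
  shows "\<exists>C\<ge>0. \<forall>f\<in>L2fun m. (\<lambda>x. h x * f x) \<in> L2fun m \<and>
    L2norm m (\<lambda>x. h x * f x) \<le> C * L2norm m f"
proof -
  obtain C where C: "AE x in m. cmod (h x) \<le> C" and hm: "h \<in> borel_measurable m"
    using h by (auto simp: Linf_def)
  have meas: "(\<lambda>x. h x * f x) \<in> borel_measurable m" if "f \<in> L2fun m" for f
    by (intro borel_measurable_times hm L2fun_measurable that)
  have le: "AE x in m. cmod (h x * f x) \<le> max C 0 * cmod (f x)" for f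
    using C by eventually_elim (auto simp: norm_mult intro!: mult_right_mono)
  show ?thesis
    by (intro exI[of _ "max C 0"] conjI ballI L2fun_bound[OF _ meas le] L2norm_mono[OF _ meas le]) auto
qed

text \<open>Were \<open>h a\<close> outside \<open>H\<^sup>2\<close>, a function \<open>w\<close> orthogonal to \<open>A\<close> but not to \<open>h a\<close> would give
  the weak-star continuous functional \<open>g \<mapsto> \<integral> g a cnj w\<close>, which vanishes on \<open>A\<close> and not at \<open>h\<close>.\<close>

lemma Hinf_mult_A:
  assumes h: "h \<in> Hinf A m" and a: "a \<in> A"
  shows "(\<lambda>x. h x * a x) \<in> H2fun A m"
proof (rule ccontr)
  assume not: "(\<lambda>x. h x * a x) \<notin> H2fun A m"
  have hL: "h \<in> Linf m" by (rule Hinf_Linf[OF h])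
  have aL: "a \<in> L2fun m" using a A_L2fun by blast
  have haL: "(\<lambda>x. h x * a x) \<in> L2fun m"
    using Linf_mult_L2[OF hL] aL by blast
  have "\<not> (\<forall>e>0. \<exists>b\<in>A. L2norm m (\<lambda>x. h x * a x - b x) < e)"
    using not haL by (simp add: H2fun_def)
  then obtain e where e: "e > 0" and far: "\<not> (\<exists>b\<in>A. L2norm m (\<lambda>x. h x * a x - b x) < e)" by blast
  have far': "e \<le> L2norm m (\<lambda>x. h x * a x - b x)" if "b \<in> A" for b
    using far that not_less by blast
  have ne: "A \<noteq> {}" using a by blast
  obtain w where w: "w \<in> L2fun m" and orth: "\<And>b. b \<in> A \<Longrightarrow> (\<integral>x. b x * cnj (w x) \<partial>m) = 0"
    and nz: "(\<integral>x. h x * a x * cnj (w x) \<partial>m) \<noteq> 0"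
    by (rule L2_orthogonal_witness[OF A_L2fun ne A_add A_scale haL e far']) auto
  define g where "g x = a x * cnj (w x)" for x
  have gL1: "g \<in> L1 m"
    unfolding g_def[abs_def] L1_def using L2fun_integrable_mult_cnj[OF aL w] by simp
  define P where "P = product_topology (\<lambda>g. euclidean :: complex topology) (L1 m)"
  define \<Phi> where "\<Phi> h = (\<lambda>g\<in>L1 m. \<integral>x. h x * g x \<partial>m)" for h
  define U where "U = {k \<in> topspace P. k g \<in> - {0}}"
  have "openin P U"
    unfolding U_def
    by (rule openin_continuous_map_preimage[where Y = euclidean])
       (auto simp: P_def gL1 intro: continuous_map_product_projection)
  then have o: "openin (weak_star_topology m) (\<Phi> -` U \<inter> Linf m)"
    unfolding weak_star_topology_def openin_pullback_topology \<Phi>_def[abs_def] P_def by blast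
  have \<Phi>U: "\<Phi> k \<in> U \<longleftrightarrow> (\<integral>x. k x * g x \<partial>m) \<noteq> 0" for k
    by (auto simp: U_def P_def \<Phi>_def gL1)
  have hU: "h \<in> \<Phi> -` U \<inter> Linf m" using hL nz by (simp add: \<Phi>U g_def mult.assoc)
  have "\<forall>V. h \<in> V \<and> openin (weak_star_topology m) V \<longrightarrow> (\<exists>b. b \<in> A \<and> b \<in> V)"
    using h unfolding Hinf_def in_closure_of by (rule conjunct2)
  from mp[OF spec[OF this] conjI[OF hU o]] obtain b where b: "b \<in> A" "b \<in> \<Phi> -` U" by blast
  have "(\<integral>x. b x * g x \<partial>m) = (\<integral>x. (b x * a x) * cnj (w x) \<partial>m)" by (simp add: g_def mult.assoc)
  then show False using b orth[OF A_mult[OF b(1) a]] by (simp add: \<Phi>U)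
qed

lemma mult_op_bounded:
  assumes h: "h \<in> Hinf A m"
  shows "mult_op A m h \<in> bounded_ops (H2 A m)"
proof -
  have hL: "h \<in> Linf m" by (rule Hinf_Linf[OF h])
  then have hm: "h \<in> borel_measurable m" by (simp add: Linf_def)
  obtain C where C: "C \<ge> 0" and mL: "\<And>f. f \<in> L2fun m \<Longrightarrow> (\<lambda>x. h x * f x) \<in> L2fun m"
    and mC: "\<And>f. f \<in> L2fun m \<Longrightarrow> L2norm m (\<lambda>x. h x * f x) \<le> C * L2norm m f"
    using Linf_mult_L2[OF hL] by blast
  \<comment> \<open>Passes from \<open>A\<close> to H2 by density, multiplication by
    \<open>h\<close> being bounded on L2.\<close>
  have hH: "(\<lambda>x. h x * f x) \<in> H2fun A m" if f: "f \<in> H2fun A m" for f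
  proof (rule H2fun_closed[OF mL[OF H2fun_L2fun[OF f]] A_L2fun])
    fix e :: real assume e: "e > 0"
    have C1: "C + 1 > 0" using C by simp
    obtain a where a: "a \<in> A" "L2norm m (\<lambda>x. f x - a x) < e / (C + 1)"
      using f divide_pos_pos[OF e C1] unfolding H2fun_def by blast
    have "(\<lambda>x. f x - a x) \<in> L2fun m" using a(1) A_L2fun H2fun_L2fun[OF f] by (auto intro: L2fun_diff)
    from mC[OF this] have "L2norm m (\<lambda>x. h x * f x - h x * a x) \<le> C * L2norm m (\<lambda>x. f x - a x)"
      by (simp add: right_diff_distrib)
    also have "\<dots> \<le> (C + 1) * L2norm m (\<lambda>x. f x - a x)" by (intro mult_right_mono L2norm_nonneg) simp
    also have "\<dots> < e" using a(2) C1 by (simp add: field_simps)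
    finally show "\<exists>g\<in>H2fun A m. L2norm m (\<lambda>x. h x * f x - g x) < e"
      by (intro bexI[of _ "\<lambda>x. h x * a x"] Hinf_mult_A h a)
  qed
  have op: "mult_op A m h = (\<lambda>u\<in>Hcar. ae_class m (\<lambda>x. h x * rep u x))"
    by (simp add: mult_op_def H2_L2sub)
  have cls: "ae_class m (\<lambda>x. h x * rep (ae_class m f) x) = ae_class m (\<lambda>x. h x * f x)"
    if f: "f \<in> borel_measurable m" for f
  proof (rule ae_class_cong)
    show "AE x in m. h x * rep (ae_class m f) x = h x * f x"
      using rep_ae_class(2)[OF f] by eventually_elim simp
  qed (intro borel_measurable_times hm f rep_ae_class)+
  have add: "rep u \<in> borel_measurable m" "ae_class m (\<lambda>x. rep u x + rep v x) \<in> Hcar" "ae_class m (\<lambda>x. c * rep u x) \<in> Hcar"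
    if "u \<in> Hcar" "v \<in> Hcar" for u v c
    using rep_Hcar[OF that(1)] rep_Hcar[OF that(2)] by (auto intro!: ae_class_Hcar H2fun_add H2fun_scale)
  show ?thesis
    unfolding bounded_ops_def H2_L2sub
  proof (intro CollectI conjI ballI allI)
    show "mult_op A m h \<in> hcarrier (L2sub m Hcar) \<rightarrow>\<^sub>E hcarrier (L2sub m Hcar)"
      unfolding op L2sub_sel by (auto intro: ae_class_Hcar hH rep_Hcar)
    fix u v c assume u: "u \<in> hcarrier (L2sub m Hcar)"
    then have u': "u \<in> Hcar" by simp
    note ru = rep_Hcar[OF u']
    have hru: "(\<lambda>x. h x * rep u x) \<in> borel_measurable m" by (intro borel_measurable_times hm ru)
    show "mult_op A m h (hscale (L2sub m Hcar) c u) = hscale (L2sub m Hcar) c (mult_op A m h u)"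
    proof -
      have "mult_op A m h (hscale (L2sub m Hcar) c u) = ae_class m (\<lambda>x. h x * (c * rep u x))"
        unfolding op using add[OF u' u'] by (simp add: cls borel_measurable_times)
      also have "\<dots> = ae_class m (\<lambda>x. c * (h x * rep u x))" by (simp add: mult.left_commute)
      also have "\<dots> = hscale (L2sub m Hcar) c (mult_op A m h u)"
        using hscale_ae_class[OF hru] u' by (simp add: op del: L2sub_sel(4))
      finally show ?thesis .
    qed
    assume v: "v \<in> hcarrier (L2sub m Hcar)"
    then have v': "v \<in> Hcar" by simp
    have hrv: "(\<lambda>x. h x * rep v x) \<in> borel_measurable m" by (intro borel_measurable_times hm rep_Hcar[OF v'])
    have "mult_op A m h (hadd (L2sub m Hcar) u v) = ae_class m (\<lambda>x. h x * (rep u x + rep v x))"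
      unfolding op using add[OF u' v'] add[OF v' u'] by (simp add: cls)
    also have "\<dots> = ae_class m (\<lambda>x. h x * rep u x + h x * rep v x)" by (simp add: distrib_left)
    also have "\<dots> = hadd (L2sub m Hcar) (mult_op A m h u) (mult_op A m h v)"
      using hadd_ae_class[OF hru hrv] u' v' by (simp add: op del: L2sub_sel(3))
    finally show "mult_op A m h (hadd (L2sub m Hcar) u v) = hadd (L2sub m Hcar) (mult_op A m h u) (mult_op A m h v)" .
  next
    have "hnorm (L2sub m Hcar) (mult_op A m h u) \<le> C * hnorm (L2sub m Hcar) u" if u: "u \<in> Hcar" for u
      using mC[OF H2fun_L2fun[OF rep_Hcar(1)[OF u]]]
        L2norm_rep[OF borel_measurable_times[OF hm rep_Hcar(3)[OF u]]] u
      by (simp add: hnorm_L2sub op)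
    then show "\<exists>K. \<forall>u\<in>hcarrier (L2sub m Hcar). hnorm (L2sub m Hcar) (mult_op A m h u) \<le> K * hnorm (L2sub m Hcar) u"
      by auto
  qed
qed

section \<open>Transitive algebras seen on functions\<close>

lemma unital_subalgebraD:
  assumes "unital_subalgebra (H2 A m) \<A>"
  shows "T \<in> \<A> \<Longrightarrow> T \<in> bounded_ops (H2 A m)"
    "(\<lambda>u\<in>Hcar. u) \<in> \<A>"
    "S \<in> \<A> \<Longrightarrow> T \<in> \<A> \<Longrightarrow> (\<lambda>u\<in>Hcar. hadd (L2sub m Hcar) (S u) (T u)) \<in> \<A>"
    "T \<in> \<A> \<Longrightarrow> (\<lambda>u\<in>Hcar. hscale (L2sub m Hcar) c (T u)) \<in> \<A>"
    "S \<in> \<A> \<Longrightarrow> T \<in> \<A> \<Longrightarrow> (\<lambda>u\<in>Hcar. S (T u)) \<in> \<A>"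
  using assms unfolding unital_subalgebra_def H2_L2sub by (auto simp del: L2sub_sel(3,4))

lemma L2norm_rep_diff_Hcar:
  assumes "u \<in> Hcar" "g \<in> borel_measurable m"
  shows "L2norm m (\<lambda>x. rep u x - rep (ae_class m g) x) = L2norm m (\<lambda>x. rep u x - g x)"
  using L2norm_rep_diff[OF rep_Hcar(3)[OF assms(1)] assms(2)] rep_Hcar(2)[OF assms(1)] by simp

text \<open>Closed sets of functions are saturated under equality almost everywhere, so they
  correspond to closed sets of classes. Multiplication by \<open>A\<close> is available because
  \<open>A\<close> is contained in \<open>Hinf A m\<close>.\<close>

lemma transitive_ops_lift:
  assumes tr: "transitive_algebra (H2 A m) \<A>" and mult: "mult_op A m ` Hinf A m \<subseteq> \<A>"
  shows "transitive_ops m A (lift ` \<A>)"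
proof
  have alg: "unital_subalgebra (H2 A m) \<A>" using tr by (simp add: transitive_algebra_def)
  note bd = unital_subalgebraD(1)[OF alg]
  show "L2op T" if "T \<in> lift ` \<A>" for T using that bd L2op_lift by blast
  show "\<exists>T\<in>lift ` \<A>. \<forall>f\<in>H2fun A m. AE x in m. T f x = a x * f x" if a: "a \<in> A" for a
  proof (rule bexI)
    show "lift (mult_op A m a) \<in> lift ` \<A>" using mult A_subset_Hinf a by blast
    show "\<forall>f\<in>H2fun A m. AE x in m. lift (mult_op A m a) f x = a x * f x"
    proof
      fix f assume f: "f \<in> H2fun A m"
      note fm = H2fun_measurable[OF f]
      have op: "mult_op A m a (ae_class m f) = ae_class m (\<lambda>x. a x * rep (ae_class m f) x)"
        using ae_class_Hcar[OF f] by (simp add: mult_op_def H2_L2sub)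
      have "(\<lambda>x. a x * rep (ae_class m f) x) \<in> borel_measurable m"
        by (intro borel_measurable_times A_measurable a rep_ae_class fm)
      from rep_ae_class(2)[OF this] rep_ae_class(2)[OF fm]
      show "AE x in m. lift (mult_op A m a) f x = a x * f x"
        unfolding lift_def op by eventually_elim simp
    qed
  qed
  fix S
  assume S: "S \<subseteq> H2fun A m" "(\<lambda>x. 0) \<in> S"
    and add: "\<And>f g. f \<in> S \<Longrightarrow> g \<in> S \<Longrightarrow> (\<lambda>x. f x + g x) \<in> S"
    and scale: "\<And>c f. f \<in> S \<Longrightarrow> (\<lambda>x. c * f x) \<in> S"
    and inv: "\<And>T f. T \<in> lift ` \<A> \<Longrightarrow> f \<in> S \<Longrightarrow> T f \<in> S"
    and closed: "\<And>f. f \<in> H2fun A m \<Longrightarrow> (\<And>e. e > 0 \<Longrightarrow> \<exists>g\<in>S. L2norm m (\<lambda>x. f x - g x) < e) \<Longrightarrow> f \<in> S"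
  have SH: "g \<in> H2fun A m" "g \<in> borel_measurable m" if "g \<in> S" for g
    using that S(1) H2fun_measurable by blast+
  define M where "M = ae_class m ` S"
  have MH: "M \<subseteq> Hcar" unfolding M_def Hcar_def by (rule image_mono[OF S(1)])
  have "hsubspace (H2 A m) M"
    unfolding hsubspace_def H2_L2sub
  proof (intro conjI ballI allI)
    show "M \<subseteq> hcarrier (L2sub m Hcar)" using MH by simp
    show "hzero (L2sub m Hcar) \<in> M" using S(2) by (simp add: M_def)
    fix u c assume "u \<in> M"
    then obtain f where f: "f \<in> S" "u = ae_class m f" unfolding M_def by (rule imageE)
    show "hscale (L2sub m Hcar) c u \<in> M"
      unfolding f(2) hscale_ae_class[OF SH(2)[OF f(1)]] M_def by (rule imageI[OF scale[OF f(1)]])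
    fix v assume "v \<in> M"
    then obtain g where g: "g \<in> S" "v = ae_class m g" unfolding M_def by (rule imageE)
    show "hadd (L2sub m Hcar) u v \<in> M"
      unfolding f(2) g(2) hadd_ae_class[OF SH(2)[OF f(1)] SH(2)[OF g(1)]] M_def
      by (rule imageI[OF add[OF f(1) g(1)]])
  qed
  moreover have "closedin (htopology (H2 A m)) M"
  proof -
    have "htopology (L2sub m Hcar) closure_of M \<subseteq> M"
      unfolding closure_L2sub[OF Hcar_L2 MH]
    proof
      fix u assume "u \<in> {u \<in> Hcar. \<forall>e>0. \<exists>v\<in>M. L2norm m (\<lambda>x. rep u x - rep v x) < e}"
      then have u: "u \<in> Hcar" and near: "\<forall>e>0. \<exists>v\<in>M. L2norm m (\<lambda>x. rep u x - rep v x) < e" by auto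
      have "rep u \<in> S"
      proof (rule closed[OF rep_Hcar(1)[OF u]])
        fix e :: real assume "e > 0"
        then obtain v where v: "v \<in> M" "L2norm m (\<lambda>x. rep u x - rep v x) < e" using near by blast
        obtain g where g: "g \<in> S" "v = ae_class m g" using v(1) unfolding M_def by (rule imageE)
        show "\<exists>g\<in>S. L2norm m (\<lambda>x. rep u x - g x) < e"
          using v(2) L2norm_rep_diff_Hcar[OF u SH(2)[OF g(1)]] g by auto
      qed
      then have "ae_class m (rep u) \<in> M" unfolding M_def by (rule imageI)
      then show "u \<in> M" by (simp only: rep_Hcar(2)[OF u])
    qed
    then show ?thesis
      unfolding H2_L2sub using MH topspace_L2sub[OF Hcar_L2] by (simp add: closure_of_subset_eq[symmetric])
  qed
  moreover have "\<forall>T\<in>\<A>. T ` M \<subseteq> M"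
  proof (intro ballI subsetI)
    fix T w assume T: "T \<in> \<A>" and "w \<in> T ` M"
    then obtain f where f: "f \<in> S" "w = T (ae_class m f)" unfolding M_def by blast
    have "lift T f \<in> S" by (rule inv[OF imageI[OF T] f(1)])
    then have "ae_class m (lift T f) \<in> M" unfolding M_def by (rule imageI)
    moreover have "w \<in> Hcar" unfolding f(2)
      by (rule bounded_opsD(1)[OF bd[OF T] ae_class_Hcar[OF SH(1)[OF f(1)]]])
    ultimately show "w \<in> M" using rep_Hcar(2) by (simp add: lift_def f(2))
  qed
  ultimately have "M = {hzero (H2 A m)} \<or> M = hcarrier (H2 A m)"
    using tr unfolding transitive_algebra_def by blast
  then show "(\<forall>f\<in>S. AE x in m. f x = 0) \<or> S = H2fun A m"
  proof
    assume "M = {hzero (H2 A m)}"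
    then have "ae_class m f = ae_class m (\<lambda>x. 0)" if "f \<in> S" for f
      using that by (auto simp: M_def H2_L2sub)
    then have "AE x in m. f x = 0" if "f \<in> S" for f
      using that ae_class_eq_iff[OF SH(2)[OF that], of "\<lambda>x. 0"] by simp
    then show ?thesis by blast
  next
    assume "M = hcarrier (H2 A m)"
    then have M: "M = Hcar" by (simp add: H2_L2sub)
    have "f \<in> S" if f: "f \<in> H2fun A m" for f
    proof (rule closed[OF f])
      fix e :: real assume e: "e > 0"
      have "ae_class m f \<in> ae_class m ` S" using ae_class_Hcar[OF f] M M_def by simp
      then obtain g where g: "g \<in> S" "ae_class m f = ae_class m g" by (rule imageE)
      then have "AE x in m. f x = g x" using ae_class_eq_iff[OF H2fun_measurable[OF f] SH(2)[OF g(1)]] by simp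
      then have "L2norm m (\<lambda>x. f x - g x) = 0"
        using L2norm_eq_0[OF H2fun_L2fun[OF H2fun_diff[OF f SH(1)[OF g(1)]]]] by simp
      then show "\<exists>g\<in>S. L2norm m (\<lambda>x. f x - g x) < e" using e g(1) by (intro bexI[of _ g]) simp
    qed
    then show ?thesis using S(1) by blast
  qed
qed

text \<open>The closure of the tuples of all \<open>T u\<close>, with the vectors \<open>u\<close>
  of \<open>F\<close> serving as their own indices. It is invariant because the algebra is closed
  under composition: \<open>S\<close> sends an approximation by \<open>T\<close> to one by
  \<open>S\<close> after \<open>T\<close>.\<close>

lemma invariant_closed_orbit:
  assumes tr: "transitive_algebra (H2 A m) \<A>" and mult: "mult_op A m ` Hinf A m \<subseteq> \<A>"
    and F: "F \<subseteq> Hcar"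
  shows "transitive_ops.invariant_closed m A (lift ` \<A>) F
    {X. (\<forall>u\<in>F. X u \<in> H2fun A m) \<and> (\<forall>e>0. \<exists>T\<in>\<A>. \<forall>u\<in>F. L2norm m (\<lambda>x. X u x - rep (T u) x) < e)}"
    (is "transitive_ops.invariant_closed m A (lift ` \<A>) F ?M")
proof -
  interpret transitive_ops m A "lift ` \<A>" by (rule transitive_ops_lift[OF tr mult])
  have alg: "unital_subalgebra (H2 A m) \<A>" using tr by (simp add: transitive_algebra_def)
  note ua = unital_subalgebraD[OF alg]
  note bd = bounded_opsD[OF ua(1)]
  have MI: "X \<in> ?M" if "\<And>u. u \<in> F \<Longrightarrow> X u \<in> H2fun A m"
    "\<And>e. e > 0 \<Longrightarrow> \<exists>T\<in>\<A>. \<forall>u\<in>F. L2norm m (\<lambda>x. X u x - rep (T u) x) < e" for X using that by blast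
  have MH: "X u \<in> H2fun A m" if "X \<in> ?M" "u \<in> F" for X u using that by blast
  have MA: "\<exists>T\<in>\<A>. \<forall>u\<in>F. L2norm m (\<lambda>x. X u x - rep (T u) x) < e" if "X \<in> ?M" "e > 0" for X e using that by blast
  have TuH: "T u \<in> Hcar" if "T \<in> \<A>" "u \<in> F" for T u using bd(1)[OF that(1)] that(2) F by blast
  have rT: "rep (T u) \<in> H2fun A m" "rep (T u) \<in> borel_measurable m" "rep (T u) \<in> L2fun m" if "T \<in> \<A>" "u \<in> F" for T u
    using rep_Hcar[OF TuH[OF that]] by (auto intro: H2fun_L2fun)
  have swap: "L2norm m (\<lambda>x. f x - rep (ae_class m g) x) = L2norm m (\<lambda>x. f x - g x)"
    if "f \<in> H2fun A m" "g \<in> borel_measurable m" for f g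
    using rep_ae_class[OF that(2)] H2fun_measurable[OF that(1)] that(2)
    by (intro L2norm_cong_AE) auto
  show ?thesis
    unfolding invariant_closed_def
  proof (intro conjI ballI allI impI)
    fix X u assume "X \<in> ?M" "u \<in> F"
    then show "X u \<in> H2fun A m" by (rule MH)
  next
    show "(\<lambda>i x. 0) \<in> ?M"
    proof (rule MI[OF H2fun_zero])
      fix e :: real assume e: "e > 0"
      \<comment> \<open>The zero operator, obtained as the multiple 0 of the identity.\<close>
      define T where "T = (\<lambda>u\<in>Hcar. hscale (L2sub m Hcar) 0 ((\<lambda>u\<in>Hcar. u) u))"
      have T: "T \<in> \<A>" unfolding T_def by (rule ua(4)[OF ua(2)])
      have "L2norm m (\<lambda>x. 0 - rep (T u) x) < e" if "u \<in> F" for u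
      proof -
        have u: "u \<in> Hcar" using that F by blast
        have "T u = ae_class m (\<lambda>x. 0)" using u by (simp add: T_def)
        then show ?thesis using swap[OF H2fun_zero, of "\<lambda>x. 0"] e by simp
      qed
      then show "\<exists>T\<in>\<A>. \<forall>u\<in>F. L2norm m (\<lambda>x. 0 - rep (T u) x) < e" using T by blast
    qed
  next
    fix X Y assume X: "X \<in> ?M" and Y: "Y \<in> ?M"
    show "(\<lambda>i x. X i x + Y i x) \<in> ?M"
    proof (rule MI[OF H2fun_add[OF MH[OF X] MH[OF Y]]])
      fix e :: real assume e: "e > 0"
      obtain S where S: "S \<in> \<A>" "\<forall>u\<in>F. L2norm m (\<lambda>x. X u x - rep (S u) x) < e / 2"
        using MA[OF X half_gt_zero[OF e]] by blast
      obtain T where T: "T \<in> \<A>" "\<forall>u\<in>F. L2norm m (\<lambda>x. Y u x - rep (T u) x) < e / 2"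
        using MA[OF Y half_gt_zero[OF e]] by blast
      define R where "R = (\<lambda>u\<in>Hcar. hadd (L2sub m Hcar) (S u) (T u))"
      have R: "R \<in> \<A>" unfolding R_def by (rule ua(3)[OF S(1) T(1)])
      have "L2norm m (\<lambda>x. X u x + Y u x - rep (R u) x) < e" if u: "u \<in> F" for u
      proof -
        have Ru: "R u = ae_class m (\<lambda>x. rep (S u) x + rep (T u) x)" using u F by (auto simp: R_def)
        have "L2norm m (\<lambda>x. X u x + Y u x - rep (R u) x) = L2norm m (\<lambda>x. X u x + Y u x - (rep (S u) x + rep (T u) x))"
          unfolding Ru by (intro swap H2fun_add MH[OF X u] MH[OF Y u] borel_measurable_add rT S(1) T(1) u)
        also have "(\<lambda>x. X u x + Y u x - (rep (S u) x + rep (T u) x)) = (\<lambda>x. (X u x - rep (S u) x) + (Y u x - rep (T u) x))"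
          by auto
        also have "L2norm m \<dots> \<le> L2norm m (\<lambda>x. X u x - rep (S u) x) + L2norm m (\<lambda>x. Y u x - rep (T u) x)"
          by (intro L2norm_triangle L2fun_diff H2fun_L2fun[OF MH[OF X u]] H2fun_L2fun[OF MH[OF Y u]] rT S(1) T(1) u)
        also have "\<dots> < e" using bspec[OF S(2) u] bspec[OF T(2) u] by linarith
        finally show ?thesis .
      qed
      then show "\<exists>T\<in>\<A>. \<forall>u\<in>F. L2norm m (\<lambda>x. X u x + Y u x - rep (T u) x) < e" using R by blast
    qed
  next
    fix X c assume X: "X \<in> ?M"
    show "(\<lambda>i x. c * X i x) \<in> ?M"
    proof (rule MI[OF H2fun_scale[OF MH[OF X]]])
      fix e :: real assume e: "e > 0"
      have c0: "cmod c + 1 > 0" using norm_ge_zero[of c] by linarith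
      obtain S where S: "S \<in> \<A>" "\<forall>u\<in>F. L2norm m (\<lambda>x. X u x - rep (S u) x) < e / (cmod c + 1)"
        using MA[OF X divide_pos_pos[OF e c0]] by blast
      define R where "R = (\<lambda>u\<in>Hcar. hscale (L2sub m Hcar) c (S u))"
      have R: "R \<in> \<A>" unfolding R_def by (rule ua(4)[OF S(1)])
      have "L2norm m (\<lambda>x. c * X u x - rep (R u) x) < e" if u: "u \<in> F" for u
      proof -
        have Ru: "R u = ae_class m (\<lambda>x. c * rep (S u) x)" using u F by (auto simp: R_def)
        have "L2norm m (\<lambda>x. c * X u x - rep (R u) x) = L2norm m (\<lambda>x. c * X u x - c * rep (S u) x)"
          unfolding Ru
          by (intro swap H2fun_scale MH[OF X u] borel_measurable_times borel_measurable_const rT S(1) u)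
        also have "\<dots> = cmod c * L2norm m (\<lambda>x. X u x - rep (S u) x)"
          by (simp add: L2norm_scale flip: right_diff_distrib)
        also have "\<dots> \<le> (cmod c + 1) * L2norm m (\<lambda>x. X u x - rep (S u) x)"
          by (intro mult_right_mono L2norm_nonneg) simp
        also have "\<dots> < e" using bspec[OF S(2) u] c0 by (simp add: field_simps)
        finally show ?thesis .
      qed
      then show "\<exists>T\<in>\<A>. \<forall>u\<in>F. L2norm m (\<lambda>x. c * X u x - rep (T u) x) < e" using R by blast
    qed
  next
    fix S' X assume "S' \<in> lift ` \<A>" and X: "X \<in> ?M"
    then obtain S where S: "S \<in> \<A>" "S' = lift S" by blast
    note op = L2op_lift[OF ua(1)[OF S(1)]]
    have SX: "lift S (X u) \<in> H2fun A m" if "u \<in> F" for u by (rule L2opD(1)[OF op MH[OF X that]])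
    show "(\<lambda>i. S' (X i)) \<in> ?M" unfolding S(2)
    proof (rule MI[OF SX])
      fix e :: real assume e: "e > 0"
      obtain K where K: "K > 0" "\<forall>f\<in>H2fun A m. \<forall>g\<in>H2fun A m.
          L2norm m (\<lambda>x. lift S f x - lift S g x) \<le> K * L2norm m (\<lambda>x. f x - g x)"
        using L2op_Lipschitz[OF op] by blast
      obtain T where T: "T \<in> \<A>" "\<forall>u\<in>F. L2norm m (\<lambda>x. X u x - rep (T u) x) < e / K"
        using MA[OF X divide_pos_pos[OF e K(1)]] by blast
      define R where "R = (\<lambda>u\<in>Hcar. S (T u))"
      have R: "R \<in> \<A>" unfolding R_def by (rule ua(5)[OF S(1) T(1)])
      have "L2norm m (\<lambda>x. lift S (X u) x - rep (R u) x) < e" if u: "u \<in> F" for u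
      proof -
        have "R u = S (T u)" using u F by (auto simp: R_def)
        \<comment> \<open>An equality of functions, not merely almost everywhere: the class of
          \<open>rep (T u)\<close> is \<open>T u\<close> itself.\<close>
        then have Ru: "rep (R u) = lift S (rep (T u))"
          using rep_Hcar(2)[OF TuH[OF T(1) u]] by (simp add: lift_def)
        have "L2norm m (\<lambda>x. lift S (X u) x - rep (R u) x) \<le> K * L2norm m (\<lambda>x. X u x - rep (T u) x)"
          unfolding Ru using K(2) MH[OF X u] rT(1)[OF T(1) u] by blast
        also have "\<dots> < e" using bspec[OF T(2) u] K(1) by (simp add: field_simps)
        finally show ?thesis .
      qed
      then show "\<exists>T\<in>\<A>. \<forall>u\<in>F. L2norm m (\<lambda>x. lift S (X u) x - rep (T u) x) < e" using R by blast
    qed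
  next
    fix X assume *: "(\<forall>u\<in>F. X u \<in> H2fun A m) \<and> (\<forall>e>0. \<exists>Y\<in>?M. \<forall>u\<in>F. L2norm m (\<lambda>x. X u x - Y u x) < e)"
    have XH: "X u \<in> H2fun A m" if "u \<in> F" for u using * that by blast
    show "X \<in> ?M"
    proof (rule MI[OF XH])
      fix e :: real assume e: "e > 0"
      obtain Y where Y: "Y \<in> ?M" "\<forall>u\<in>F. L2norm m (\<lambda>x. X u x - Y u x) < e / 2"
        using mp[OF spec[OF conjunct2[OF *]] half_gt_zero[OF e]] by blast
      obtain T where T: "T \<in> \<A>" "\<forall>u\<in>F. L2norm m (\<lambda>x. Y u x - rep (T u) x) < e / 2"
        using MA[OF Y(1) half_gt_zero[OF e]] by blast
      have "L2norm m (\<lambda>x. X u x - rep (T u) x) < e" if u: "u \<in> F" for u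
        using L2norm_triangle_diff[OF H2fun_L2fun[OF XH[OF u]] H2fun_L2fun[OF MH[OF Y(1) u]] rT(3)[OF T(1) u]]
          bspec[OF Y(2) u] bspec[OF T(2) u] by linarith
      then show "\<exists>T\<in>\<A>. \<forall>u\<in>F. L2norm m (\<lambda>x. X u x - rep (T u) x) < e" using T(1) by blast
    qed
  qed
qed

text \<open>Induction on the number of vectors. Either every tuple, in particular that of
  \<open>B\<close>, is in the closed orbit, or the vectors are linearly dependent. In the second
  case one of them is dropped and recovered by linearity, for \<open>B\<close> and for its
  approximant alike.\<close>

lemma transitive_approximates:
  assumes tr: "transitive_algebra (H2 A m) \<A>" and mult: "mult_op A m ` Hinf A m \<subseteq> \<A>"
    and B: "B \<in> bounded_ops (H2 A m)"
    and "finite F" "F \<subseteq> Hcar" "e > 0"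
  shows "\<exists>T\<in>\<A>. \<forall>u\<in>F. L2norm m (\<lambda>x. rep (T u) x - rep (B u) x) < e"
  using assms(4-6)
proof (induction "card F" arbitrary: F e rule: less_induct)
  case less
  note F = less.prems(1,2) and e = less.prems(3)
  interpret transitive_ops m A "lift ` \<A>" by (rule transitive_ops_lift[OF tr mult])
  have alg: "unital_subalgebra (H2 A m) \<A>" using tr by (simp add: transitive_algebra_def)
  note ua = unital_subalgebraD[OF alg]
  define M where "M = {X. (\<forall>u\<in>F. X u \<in> H2fun A m) \<and>
      (\<forall>e>0. \<exists>T\<in>\<A>. \<forall>u\<in>F. L2norm m (\<lambda>x. X u x - rep (T u) x) < e)}"
  have M: "invariant_closed F M"
    unfolding M_def by (rule invariant_closed_orbit[OF tr mult F(2)])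
  have rep_op: "rep (T u) \<in> H2fun A m" if "T \<in> bounded_ops (H2 A m)" "u \<in> F" for T u
    using rep_Hcar(1)[OF bounded_opsD(1)[OF that(1)]] that(2) F(2) by blast
  from invariant_closed_full_or_annihilated[OF F(1) M] show ?case
  proof
    assume full: "\<forall>X. (\<forall>u\<in>F. X u \<in> H2fun A m) \<longrightarrow> X \<in> M"
    have "(\<lambda>u. rep (B u)) \<in> M"
      by (rule mp[OF spec[OF full]]) (intro ballI rep_op[OF B])
    then obtain T where "T \<in> \<A>" "\<forall>u\<in>F. L2norm m (\<lambda>x. rep (B u) x - rep (T u) x) < e"
      using e unfolding M_def by blast
    then show ?thesis using L2norm_commute[of m "rep (B _)"] by auto
  next
    assume "\<exists>l. (\<exists>i\<in>F. l i \<noteq> 0) \<and> (\<forall>X\<in>M. AE x in m. (\<Sum>i\<in>F. l i * X i x) = 0)"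
    then obtain l u0 where u0: "u0 \<in> F" "l u0 \<noteq> 0"
      and kill: "\<And>X. X \<in> M \<Longrightarrow> AE x in m. (\<Sum>i\<in>F. l i * X i x) = 0" by blast
    have FH: "u \<in> Hcar" "rep u \<in> H2fun A m" "ae_class m (rep u) = u" if "u \<in> F" for u
      using that F(2) rep_Hcar by blast+
    \<comment> \<open>The tuple of the vectors themselves, reached by the identity. The relation
      holding on \<open>M\<close> thus becomes a linear dependence within \<open>F\<close>.\<close>
    have "rep \<in> M"
      unfolding M_def
    proof (intro CollectI conjI ballI allI impI)
      fix e :: real assume "e > 0"
      then show "\<exists>T\<in>\<A>. \<forall>u\<in>F. L2norm m (\<lambda>x. rep u x - rep (T u) x) < e"
        using FH(1) by (intro bexI[OF _ ua(2)]) simp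
    qed (rule FH(2))
    from kill[OF this] have ae: "AE x in m. (\<Sum>u\<in>F. l u * rep u x) = 0" .
    define G where "G = F - {u0}"
    have G: "finite G" "G \<subseteq> Hcar" "card G < card F" "G \<subseteq> F"
      using F card_Diff1_less[OF F(1) u0(1)] by (auto simp: G_def)
    define d where "d u = - l u / l u0" for u
    have u0_eq: "AE x in m. rep u0 x = (\<Sum>u\<in>G. d u * rep u x)"
      using ae
    proof eventually_elim
      case (elim x)
      then have "l u0 * rep u0 x + (\<Sum>u\<in>G. l u * rep u x) = 0"
        using sum.remove[OF F(1) u0(1), of "\<lambda>u. l u * rep u x"] by (simp add: G_def)
      then have "rep u0 x = - (\<Sum>u\<in>G. l u * rep u x) / l u0"
        using u0(2) by (simp add: field_simps eq_neg_iff_add_eq_0)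
      also have "\<dots> = (\<Sum>u\<in>G. d u * rep u x)"
        by (simp add: d_def sum_divide_distrib sum_negf)
      finally show ?case .
    qed
    have op_u0: "AE x in m. rep (T u0) x = (\<Sum>u\<in>G. d u * rep (T u) x)" if T: "T \<in> bounded_ops (H2 A m)" for T
    proof -
      note op = L2op_lift[OF T]
      have GH: "rep u \<in> H2fun A m" if "u \<in> G" for u using FH(2) G(4) that by blast
      have "AE x in m. lift T (rep u0) x = lift T (\<lambda>x. \<Sum>u\<in>G. d u * rep u x) x"
        by (rule L2op_cong[OF op FH(2)[OF u0(1)] H2fun_sum[OF G(1) GH] u0_eq])
      moreover have "AE x in m. lift T (\<lambda>x. \<Sum>u\<in>G. d u * rep u x) x = (\<Sum>u\<in>G. d u * lift T (rep u) x)"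
        by (rule L2op_sum[OF op G(1) GH])
      ultimately have "AE x in m. lift T (rep u0) x = (\<Sum>u\<in>G. d u * lift T (rep u) x)"
        by eventually_elim simp
      moreover have "lift T (rep u) = rep (T u)" if "u \<in> F" for u
        using FH(3)[OF that] by (simp add: lift_def)
      ultimately show ?thesis using u0(1) G(4) by (simp add: subset_iff)
    qed
    define s where "s = (\<Sum>u\<in>G. cmod (d u))"
    have s: "s \<ge> 0" unfolding s_def by (intro sum_nonneg) simp
    \<comment> \<open>An error \<epsilon> on each vector of \<open>G\<close> becomes at most
      \<open>s\<close> \<epsilon> at \<open>u0\<close>, and both must stay within \<open>e\<close>;
      the added 1 covers \<open>s = 0\<close>.\<close>
    define \<epsilon> where "\<epsilon> = e / (s + 1)"
    have \<epsilon>: "\<epsilon> > 0" "\<epsilon> \<le> e" "s * \<epsilon> < e" using s e by (auto simp: \<epsilon>_def field_simps)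
    obtain T where T: "T \<in> \<A>" "\<forall>u\<in>G. L2norm m (\<lambda>x. rep (T u) x - rep (B u) x) < \<epsilon>"
      using less.hyps[OF G(3,1,2) \<epsilon>(1)] by blast
    note Tb = ua(1)[OF T(1)]
    have diffH: "(\<lambda>x. rep (T u) x - rep (B u) x) \<in> H2fun A m" if "u \<in> F" for u
      by (intro H2fun_diff rep_op Tb B that)
    have sum_le: "L2norm m (\<lambda>x. \<Sum>u\<in>J. d u * (rep (T u) x - rep (B u) x)) \<le> (\<Sum>u\<in>J. cmod (d u)) * \<epsilon>"
      if "finite J" "J \<subseteq> G" for J
      using that
    proof (induction J rule: finite_induct)
      case empty
      then show ?case by simp
    next
      case (insert v J)
      have v: "v \<in> F" "v \<in> G" and J: "J \<subseteq> F" using insert.prems G(4) by auto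
      have h1: "(\<lambda>x. d v * (rep (T v) x - rep (B v) x)) \<in> L2fun m"
        by (rule H2fun_L2fun[OF H2fun_scale[OF diffH[OF v(1)]]])
      have h2: "(\<lambda>x. \<Sum>u\<in>J. d u * (rep (T u) x - rep (B u) x)) \<in> L2fun m"
        by (rule H2fun_L2fun[OF H2fun_sum[OF insert.hyps(1) diffH]]) (use J in blast)
      have "L2norm m (\<lambda>x. \<Sum>u\<in>insert v J. d u * (rep (T u) x - rep (B u) x))
          = L2norm m (\<lambda>x. d v * (rep (T v) x - rep (B v) x) + (\<Sum>u\<in>J. d u * (rep (T u) x - rep (B u) x)))"
        using insert.hyps by simp
      also have "\<dots> \<le> L2norm m (\<lambda>x. d v * (rep (T v) x - rep (B v) x))
          + L2norm m (\<lambda>x. \<Sum>u\<in>J. d u * (rep (T u) x - rep (B u) x))"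
        by (rule L2norm_triangle[OF h1 h2])
      also have "\<dots> \<le> cmod (d v) * \<epsilon> + (\<Sum>u\<in>J. cmod (d u)) * \<epsilon>"
        unfolding L2norm_scale using insert T(2) v(2) by (intro add_mono mult_left_mono) (auto intro: less_imp_le)
      finally show ?case using insert.hyps by (simp add: distrib_right)
    qed
    have "L2norm m (\<lambda>x. rep (T u0) x - rep (B u0) x) < e"
    proof -
      have "AE x in m. rep (T u0) x - rep (B u0) x = (\<Sum>u\<in>G. d u * (rep (T u) x - rep (B u) x))"
        using op_u0[OF Tb] op_u0[OF B] by eventually_elim (simp add: right_diff_distrib sum_subtractf)
      then have "L2norm m (\<lambda>x. rep (T u0) x - rep (B u0) x) = L2norm m (\<lambda>x. \<Sum>u\<in>G. d u * (rep (T u) x - rep (B u) x))"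
        using G(4) by (intro L2norm_cong_AE H2fun_measurable[OF H2fun_sum[OF G(1) diffH]] H2fun_measurable[OF diffH[OF u0(1)]]) auto
      also have "\<dots> \<le> s * \<epsilon>" unfolding s_def by (rule sum_le[OF G(1) subset_refl])
      finally show ?thesis using \<epsilon>(3) by linarith
    qed
    moreover have "L2norm m (\<lambda>x. rep (T u) x - rep (B u) x) < e" if "u \<in> G" for u
      using bspec[OF T(2) that] \<epsilon>(2) by linarith
    ultimately have "\<forall>u\<in>F. L2norm m (\<lambda>x. rep (T u) x - rep (B u) x) < e"
      by (auto simp: G_def)
    then show ?thesis using T(1) by blast
  qed
qed

section \<open>Density in the strong operator topology\<close>

lemma Hinf_catalytic: "catalytic (H2 A m) (mult_op A m ` Hinf A m)"
  unfolding catalytic_def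
proof (intro conjI allI impI)
  show "mult_op A m ` Hinf A m \<subseteq> bounded_ops (H2 A m)" using mult_op_bounded by blast
  fix \<A> assume "transitive_algebra (H2 A m) \<A> \<and> mult_op A m ` Hinf A m \<subseteq> \<A>"
  then have tr: "transitive_algebra (H2 A m) \<A>" and mult: "mult_op A m ` Hinf A m \<subseteq> \<A>" by auto
  have alg: "unital_subalgebra (H2 A m) \<A>" using tr by (simp add: transitive_algebra_def)
  note ua = unital_subalgebraD[OF alg]
  define P where "P = product_topology (\<lambda>u. htopology (H2 A m)) Hcar"
  have SOT: "strong_operator_topology (H2 A m) = subtopology P (bounded_ops (H2 A m))"
    by (simp add: strong_operator_topology_def P_def H2_L2sub)
  have topH: "topspace (htopology (H2 A m)) = Hcar"
    unfolding H2_L2sub by (rule topspace_L2sub[OF Hcar_L2])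
  have "bounded_ops (H2 A m) \<subseteq> Hcar \<rightarrow>\<^sub>E Hcar" unfolding bounded_ops_def H2_L2sub L2sub_sel by blast
  then have top: "topspace (strong_operator_topology (H2 A m)) = bounded_ops (H2 A m)"
    unfolding SOT P_def using topH by auto
  show "strong_operator_topology (H2 A m) closure_of \<A> = bounded_ops (H2 A m)"
  proof (rule antisym)
    show "strong_operator_topology (H2 A m) closure_of \<A> \<subseteq> bounded_ops (H2 A m)"
      using closure_of_subset_topspace top by metis
    show "bounded_ops (H2 A m) \<subseteq> strong_operator_topology (H2 A m) closure_of \<A>"
    proof
      fix B assume B: "B \<in> bounded_ops (H2 A m)"
      show "B \<in> strong_operator_topology (H2 A m) closure_of \<A>"
        unfolding in_closure_of
      proof (intro conjI allI impI)
        show "B \<in> topspace (strong_operator_topology (H2 A m))" using B top by simp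
        fix W assume "B \<in> W \<and> openin (strong_operator_topology (H2 A m)) W"
        then obtain V where V: "openin P V" "W = V \<inter> bounded_ops (H2 A m)" "B \<in> V"
          unfolding SOT openin_subtopology by blast
        from bspec[OF iffD1[OF openin_product_topology_alt V(1)[unfolded P_def]] V(3)]
        obtain U where U: "finite {u \<in> Hcar. U u \<noteq> topspace (htopology (H2 A m))} \<and>
            (\<forall>u\<in>Hcar. openin (htopology (H2 A m)) (U u)) \<and> B \<in> Pi\<^sub>E Hcar U \<and> Pi\<^sub>E Hcar U \<subseteq> V"
          by (rule exE)
        then have fin: "finite {u \<in> Hcar. U u \<noteq> topspace (htopology (H2 A m))}"
          and opU: "\<And>u. u \<in> Hcar \<Longrightarrow> openin (htopology (H2 A m)) (U u)"
          and BU: "B \<in> Pi\<^sub>E Hcar U" and UV: "Pi\<^sub>E Hcar U \<subseteq> V"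
          by simp_all
        \<comment> \<open>The vectors that the basic neighbourhood really constrains; at all others
          \<open>U u\<close> is the whole space.\<close>
        define F where "F = {u \<in> Hcar. U u \<noteq> topspace (htopology (H2 A m))}"
        have F: "finite F" "F \<subseteq> Hcar" using fin by (auto simp: F_def)
        have "\<exists>e>0. \<forall>v\<in>Hcar. L2norm m (\<lambda>x. rep (B u) x - rep v x) < e \<longrightarrow> v \<in> U u" if "u \<in> Hcar" for u
        proof -
          have "openin (htopology (L2sub m Hcar)) (U u)" "B u \<in> U u"
            using opU[OF that] BU that by (auto simp: H2_L2sub)
          from openin_L2sub_ball[OF Hcar_L2 this] show ?thesis by metis
        qed
        then obtain r where r0: "\<And>u. u \<in> Hcar \<Longrightarrow> r u > 0"
          and r: "\<And>u v. u \<in> Hcar \<Longrightarrow> v \<in> Hcar \<Longrightarrow> L2norm m (\<lambda>x. rep (B u) x - rep v x) < r u \<Longrightarrow> v \<in> U u"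
          by metis
        \<comment> \<open>The entry 1 keeps the minimum meaningful when \<open>F\<close> is
          empty.\<close>
        define e where "e = Min (insert 1 (r ` F))"
        have e: "e > 0" "\<And>u. u \<in> F \<Longrightarrow> e \<le> r u"
          using F r0 by (auto simp: e_def)
        obtain T where T: "T \<in> \<A>" "\<forall>u\<in>F. L2norm m (\<lambda>x. rep (T u) x - rep (B u) x) < e"
          using transitive_approximates[OF tr mult B F e(1)] by blast
        have Tb: "T \<in> bounded_ops (H2 A m)" by (rule ua(1)[OF T(1)])
        have "T \<in> Pi\<^sub>E Hcar U"
        proof (rule PiE_I)
          fix u assume u: "u \<in> Hcar"
          show "T u \<in> U u"
          proof (cases "u \<in> F")
            case True
            have "L2norm m (\<lambda>x. rep (B u) x - rep (T u) x) < r u"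
              using bspec[OF T(2) True] e(2)[OF True] L2norm_commute[of m "rep (B u)" "rep (T u)"] by linarith
            then show ?thesis by (rule r[OF u bounded_opsD(1)[OF Tb u]])
          next
            case False
            then show ?thesis using u topH bounded_opsD(1)[OF Tb u] by (simp add: F_def)
          qed
        next
          fix u assume "u \<notin> Hcar"
          then show "T u = undefined"
            using Tb unfolding bounded_ops_def H2_L2sub by (auto simp: PiE_def extensional_def)
        qed
        then show "\<exists>T. T \<in> \<A> \<and> T \<in> W" using T(1) UV V(2) Tb by blast
      qed
    qed
  qed
qed

end

theorem theorem3p6:
  fixes A :: "('a::t2_space \<Rightarrow> complex) set"
    and \<phi> :: "('a \<Rightarrow> complex) \<Rightarrow> complex"
    and m :: "'a measure"
  assumes "compact (UNIV :: 'a set)"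
    and "logmodular_algebra A"
    and "\<phi> \<in> mult_functionals A"
    and "representing_measure A \<phi> m"
    and "is_rkhs A m"
  shows "catalytic (H2 A m) (mult_op A m ` Hinf A m)"
proof -
  have rep: "\<And>f. f \<in> A \<Longrightarrow> \<phi> f = (\<integral>x. f x \<partial>m)" and fin: "finite_measure m" and sets: "sets m = sets borel"
    using assms(4) by (auto simp: representing_measure_def regular_borel_measure_def)
  have prod: "\<phi> (\<lambda>x. f x * g x) = \<phi> f * \<phi> g" if "f \<in> A" "g \<in> A" for f g
    using assms(3) that by (simp add: mult_functionals_def)
  obtain f where f: "f \<in> A" "\<phi> f \<noteq> 0" using assms(3) by (auto simp: mult_functionals_def)
  have closed: "(\<lambda>x. f x * g x) \<in> A" if "f \<in> A" "g \<in> A" for f g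
    using assms(2) that by (simp add: logmodular_algebra_def uniform_algebra_def)
  have one: "(\<lambda>x. 1) \<in> A" using assms(2) by (simp add: logmodular_algebra_def uniform_algebra_def)
  \<comment> \<open>A multiplicative functional with a nonzero value sends 1 to 1, which makes
    \<open>m\<close> a probability measure.\<close>
  have "\<phi> (\<lambda>x. 1) * \<phi> f = \<phi> f" using prod[OF one f(1)] by simp
  then have "\<phi> (\<lambda>x. 1) = 1" using f(2) by simp
  then have "complex_of_real (measure m (space m)) = 1"
    using rep[OF one] by (simp add: scaleR_conv_of_real)
  then have "measure m (space m) = 1" by (metis of_real_eq_1_iff)
  then have "prob_space m"
    using fin by (intro prob_spaceI) (simp add: finite_measure.emeasure_eq_measure)
  then interpret prob_space m .
  interpret logmodular_prob m A
  proof
    show "compact (UNIV :: 'a set)" "logmodular_algebra A" "sets m = sets borel" by fact+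
    show "(\<integral>x. f x * g x \<partial>m) = (\<integral>x. f x \<partial>m) * (\<integral>x. g x \<partial>m)" if "f \<in> A" "g \<in> A" for f g
      using prod[OF that] rep that closed[OF that] by simp
  qed
  show ?thesis by (rule Hinf_catalytic)
qed

end
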